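(* Let $\mu(dx)=e^{-(U+W)(x)}dx$, with smooth $U$ and $W$, be a probability measure on $\mathbb R^d$. Assume that (1) for some $\alpha_W>0$, $\beta_W\ge1$ and $R\ge0$, $\langle x,\nabla W(x)\rangle\ge\alpha_W|x|^{\beta_W}$ for all $|x|\ge R$; (2) $|\langle x,\nabla U(x)\rangle|\le\kappa_U|x|^{\beta_U}$ for some $\kappa_U\ge0$, $\beta_U\le\beta_W$ and all $|x|\ge R$; and let $R'\ge R$, $R'>0$, be such that for some $\gamma>0$, $\alpha_W(R')^{\beta_W-1}-\frac{d-1}{R'}-\gamma-\kappa_U(R')^{\beta_U-1}>0$. Assume in addition that $W$ is convex and that $\nu(dx)=e^{-W(x)}dx$ is a centered probability measure. Then $$C_P(\mu_{R'})\le\frac{C_{Klar}\,\sigma^2(\nu)\,(1+\ln d)}{\nu(B(0,R'))}\,e^{\mathrm{Osc}_{B(0,R')}U}.$$ If in addition $W$ is radially symmetric, $C_{Klar}(1+\ln d)$ may be replaced by $2$.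
   Context: $C_P(\mu)$ is the optimal constant in the Poincaré inequality $\mathrm{Var}_\mu(g)\le C_P(\mu)\int|\nabla g|^2d\mu$. $\mu_{R'}$ is the normalized restriction of $\mu$ to the Euclidean ball $B(0,R')$; $\mathrm{Osc}_Ah=\sup_Ah-\inf_Ah$. $\sigma^2(\nu)$ is the largest eigenvalue of the covariance matrix of $\nu$. $C_{Klar}$ is a universal constant (existing by a theorem of Klartag) such that $C_P(\rho)\le C_{Klar}\,\sigma^2(\rho)\,(1+\ln d)$ for every $d$ and every log-concave probability measure $\rho$ on $\mathbb R^d$. *)

theory Defs
  imports "HOL-Probability.Probability"
begin

definition grad :: "(real^'n \<Rightarrow> real) \<Rightarrow> real^'n \<Rightarrow> real^'n" where
  "grad f x = (THE D. GDERIV f x :> D)"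

fun C_k :: "nat \<Rightarrow> (real^'n \<Rightarrow> real) \<Rightarrow> bool" where
  "C_k 0 f \<longleftrightarrow> continuous_on UNIV f"
| "C_k (Suc k) f \<longleftrightarrow> f differentiable_on UNIV \<and> (\<forall>i. C_k k (\<lambda>x. grad f x $ i))"

definition smooth :: "(real^'n \<Rightarrow> real) \<Rightarrow> bool" where
  "smooth f \<longleftrightarrow> (\<forall>k. C_k k f)"

definition exp_measure :: "(real^'n \<Rightarrow> real) \<Rightarrow> (real^'n) measure" where
  "exp_measure V = density lborel (\<lambda>x. ennreal (exp (- V x)))"

definition poincare_ineq :: "(real^'n) measure \<Rightarrow> ennreal \<Rightarrow> bool" where
  "poincare_ineq \<mu> C \<longleftrightarrow>
     (\<forall>g. smooth g \<and> integrable \<mu> (\<lambda>x. (g x)\<^sup>2) \<longrightarrow>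
        ennreal (prob_space.variance \<mu> g) \<le> C * (\<integral>\<^sup>+ x. ennreal ((norm (grad g x))\<^sup>2) \<partial>\<mu>))"

text \<open>The optimal constant takes values in \<^typ>\<open>ennreal\<close>; it is \<^term>\<open>\<infinity> :: ennreal\<close> exactly when no
  finite constant is admissible.\<close>

definition poincare_const :: "(real^'n) measure \<Rightarrow> ennreal" where
  "poincare_const \<mu> = Inf {C. poincare_ineq \<mu> C}"

definition cov_matrix :: "(real^'n) measure \<Rightarrow> real^'n^'n" where
  "cov_matrix \<nu> = (\<chi> i j. \<integral>x. (x $ i - (\<integral>y. y $ i \<partial>\<nu>)) * (x $ j - (\<integral>y. y $ j \<partial>\<nu>)) \<partial>\<nu>)"

definition is_eigenvalue :: "real^'n^'n \<Rightarrow> real \<Rightarrow> bool" where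
  "is_eigenvalue A l \<longleftrightarrow> (\<exists>v. v \<noteq> 0 \<and> A *v v = l *\<^sub>R v)"

definition sigma2 :: "(real^'n) measure \<Rightarrow> real" where
  "sigma2 \<nu> = (GREATEST l. is_eigenvalue (cov_matrix \<nu>) l)"

definition centered :: "(real^'n) measure \<Rightarrow> bool" where
  "centered \<nu> \<longleftrightarrow> integrable \<nu> (\<lambda>x. x) \<and> (\<integral>x. x \<partial>\<nu>) = 0"

text \<open>The density may vanish, so restrictions to convex sets are included.\<close>

definition log_concave_measure :: "(real^'n) measure \<Rightarrow> bool" where
  "log_concave_measure \<rho> \<longleftrightarrow>
     (\<exists>f. f \<in> borel_measurable borel \<and> (\<forall>x. 0 \<le> f x) \<and>
        (\<forall>x y t. 0 < t \<and> t < 1 \<longrightarrow>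
           f x powr (1 - t) * f y powr t \<le> f ((1 - t) *\<^sub>R x + t *\<^sub>R y)) \<and>
        \<rho> = density lborel (\<lambda>x. ennreal (f x)))"

text \<open>A type of vectors fixes one dimension \<open>d = CARD('n)\<close>, so Klartag's bound is recorded dimension by
  dimension.  A universal constant is a \<open>C\<close> that satisfies this predicate at every \<open>'n\<close>; a
  theorem that assumes it only at the dimension at hand therefore applies to such a \<open>C\<close>.\<close>

definition klartag_bound :: "'n::finite itself \<Rightarrow> real \<Rightarrow> bool" where
  "klartag_bound _ C \<longleftrightarrow>
     (\<forall>\<rho> :: (real^'n) measure. prob_space \<rho> \<and> log_concave_measure \<rho> \<longrightarrow>
        poincare_const \<rho> \<le> ennreal (C * sigma2 \<rho> * (1 + ln (real CARD('n)))))"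

definition osc :: "'a set \<Rightarrow> ('a \<Rightarrow> real) \<Rightarrow> real" where
  "osc A h = (SUP x\<in>A. h x) - (INF x\<in>A. h x)"

text \<open>\<^const>\<open>uniform_measure\<close> normalizes the restriction of an arbitrary measure, not only of
  Lebesgue measure.\<close>

definition ball_restr :: "(real^'n) measure \<Rightarrow> real \<Rightarrow> (real^'n) measure" where
  "ball_restr \<mu> r = uniform_measure \<mu> (ball 0 r)"

end

theory Submission
  imports Defs
begin

text \<open>Restriction to the ball costs the covariance a factor \<open>1 / \<nu>(B(0,R'))\<close>, because \<open>\<nu>\<close> is
  centered, and the factor \<open>exp(-U)\<close> costs \<open>exp(Osc U)\<close> by the Holley--Stroock argument. With
  Klartag's bound for the log-concave restriction of \<open>\<nu>\<close> this is the first inequality.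

  In the radial case, \<open>r = |x|\<close> and \<open>\<theta> = x/|x|\<close> are independent. For \<open>d \<ge> 2\<close> both the law of \<open>r\<close>
  (density proportional to \<open>r^(d-1) exp(-W)\<close>, hence curvature at least \<open>(d-1)/r^2\<close>) and the average
  over \<open>r\<close> as a function of \<open>\<theta>\<close> satisfy Poincare inequalities with constant \<open>E|x|^2/(d-1)\<close>,
  which is at most \<open>2 \<sigma>^2\<close>. For \<open>d = 1\<close> the constant 2 is sharp (Laplace law): one bounds the
  first Dirichlet eigenvalue of a half-line by following the Pruefer angle of the eigenvalue
  equation with a Lyapunov function that is exact for the exponential law.\<close>

section \<open>One-dimensional Dirichlet problems\<close>

text \<open>The curvature \<open>(d-1)/r^2\<close> is smallest at the rim, so a plain curvature
  bound would give only \<open>R'^2/(d-1)\<close>. The second moment enters instead because the dual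
  function has to be controlled in mean only, and its mean is paired with \<open>r\<close> by
  Cauchy-Schwarz. The final 2 is \<open>d/(d-1) <= 2\<close>. For \<open>d = 1\<close> this is void:
  there is no curvature left, and the two-point sphere has no spectral gap. There the variance is
  replaced by the second moment about \<open>f 0\<close>, which turns the problem into Dirichlet
  problems on the two half-lines. The comparison that keeps the angle below \<pi> needs a strict
  moment inequality, so the radial bound is proved with
  \<open>2 \<sigma>^2 / \<nu>(B) + \<epsilon>\<close>. The same \<epsilon> absorbs the infimum in
  the definition of the Poincare constant. The spherical inequality is drawn from the Gaussian one,
  so that only one-dimensional calculus and polar coordinates are needed. The radial growth of
  \<open>W\<close> serves to give \<nu> a finite second moment: covariance entries are Bochner
  integrals, which default to 0 without integrability. The factor \<open>exp(-U)\<close> is handled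
  last, on the ball, where continuity makes \<open>U\<close> bounded.\<close>

lemma barrier_pos:
  fixes f f' :: "real \<Rightarrow> real"
  assumes der: "\<And>s. s \<in> {a..b} \<Longrightarrow> (f has_real_derivative f' s) (at s within {a..b})"
    and fa: "f a \<ge> 0"
    and up: "\<And>s. s \<in> {a..b} \<Longrightarrow> f s = 0 \<Longrightarrow> f' s > 0"
    and s: "a < s" "s \<le> b"
  shows "f s > 0"
proof -
  have cont: "continuous_on {a..b} f"
    using der by (meson DERIV_continuous continuous_on_eq_continuous_within)
  have nonneg: "f s \<ge> 0" if s: "a \<le> s" "s \<le> b" for s
  proof (rule ccontr)
    assume neg: "\<not> f s \<ge> 0"
    \<comment> \<open>The largest point \<open>t\<close> of \<open>Z\<close> is the last one before
      \<open>s\<close> with \<open>f >= 0\<close>. There \<open>f t = 0\<close>, and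
      \<open>f\<close> is negative just after it, against \<open>f' t > 0\<close>.\<close>
    define Z where "Z = {a..s} \<inter> f -` {0..}"
    have "closed Z"
      unfolding Z_def using s
      by (intro continuous_closed_preimage continuous_on_subset[OF cont]) auto
    then have "compact Z"
      by (auto simp: Z_def compact_eq_bounded_closed intro: bounded_subset[OF bounded_closed_interval[of a s]])
    moreover have "a \<in> Z" using fa s by (auto simp: Z_def)
    ultimately obtain t where t: "t \<in> Z" "\<And>x. x \<in> Z \<Longrightarrow> x \<le> t"
      by (metis compact_attains_sup empty_iff)
    have ts: "t < s" using t neg by (cases "t = s") (auto simp: Z_def)
    have below: "f x < 0" if "t < x" "x \<le> s" for x
      using t(2)[of x] that t(1) by (cases "f x < 0") (auto simp: Z_def)
    have "f t = 0"
    proof (rule ccontr)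
      assume "f t \<noteq> 0"
      then have "f t > 0" using t by (auto simp: Z_def)
      moreover have "continuous_on {t..s} f" 
        by (rule continuous_on_subset[OF cont]) (use t s in \<open>auto simp: Z_def\<close>)
      ultimately obtain x where "t \<le> x" "x \<le> s" "f x = 0"
        using IVT2'[of f s 0 t] neg ts by auto
      then show False using below[of x] \<open>f t > 0\<close> by (cases "x = t") auto
    qed
    then have "f' t > 0" using t s up by (auto simp: Z_def)
    then obtain e where e: "e > 0" "\<And>h. h > 0 \<Longrightarrow> t + h \<in> {a..b} \<Longrightarrow> h < e \<Longrightarrow> f t < f (t + h)"
      using has_real_derivative_pos_inc_right[OF der[of t]] t s by (auto simp: Z_def)
    define h where "h = min (e/2) (s - t)"
    have "0 < h" "h < e" "t + h \<le> s" "t + h \<in> {a..b}" using e ts t s by (auto simp: h_def Z_def)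
    then show False using e(2)[of h] below[of "t + h"] \<open>f t = 0\<close> by auto
  qed
  \<comment> \<open>A zero with positive derivative would be preceded by negative values, which are
    already excluded.\<close>
  have "f s \<noteq> 0"
  proof
    assume "f s = 0"
    then have "f' s > 0" using up s by auto
    then obtain e where e: "e > 0" "\<And>h. h > 0 \<Longrightarrow> s - h \<in> {a..b} \<Longrightarrow> h < e \<Longrightarrow> f (s - h) < f s"
      using has_real_derivative_pos_inc_left[OF der[of s]] s by auto
    define h where "h = min (e/2) (s - a)"
    have "0 < h" "h < e" "s - h \<in> {a..b}" using e s by (auto simp: h_def)
    then show False using e(2)[of h] nonneg[of "s - h"] \<open>f s = 0\<close> by auto
  qed
  then show ?thesis using nonneg[of s] s by auto
qed

text \<open>Used for functions whose formula is singular at 0 and whose value there is prescribed as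
  the limit.\<close>

lemma continuous_on_Icc_at_right:
  fixes f :: "real \<Rightarrow> real"
  assumes c: "continuous_on {0<..L} f" and lim: "(f \<longlongrightarrow> f 0) (at_right 0)" and L: "0 < L"
  shows "continuous_on {0..L} f"
  unfolding continuous_on_def
proof
  fix s assume s: "s \<in> {0..L}"
  show "(f \<longlongrightarrow> f s) (at s within {0..L})"
  proof (cases "s = 0")
    case True
    then show ?thesis using lim L by (simp add: at_within_Icc_at_right)
  next
    case False
    then have "(f \<longlongrightarrow> f s) (at s within {0<..L})" using c s by (auto simp: continuous_on_def)
    moreover have "at s within {0<..L} = at s within {0..L}"
      using False s by (intro at_within_nhd[of _ "{0<..}"]) auto
    ultimately show ?thesis by simp
  qed
qed

text \<open>A solution \<open>y\<close> of the Riccati equation is the logarithmic derivative of a positive ground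
  state; the inequality comes from differentiating \<open>\<rho> g^2 y\<close>.\<close>

lemma riccati_poincare:
  fixes g g' y \<rho> V :: "real \<Rightarrow> real"
  assumes L: "0 < L"
    and g: "\<And>s. s \<in> {0..L} \<Longrightarrow> (g has_real_derivative g' s) (at s within {0..L})"
    and g': "continuous_on {0..L} g'" and g0: "g 0 = 0"
    and \<rho>: "\<And>s. s \<in> {0<..<L} \<Longrightarrow> (\<rho> has_real_derivative - V s * \<rho> s) (at s)"
    and \<rho>c: "continuous_on {0..L} \<rho>" and \<rho>0: "\<And>s. s \<in> {0..L} \<Longrightarrow> \<rho> s \<ge> 0"
    and y: "\<And>s. s \<in> {0<..<L} \<Longrightarrow> (y has_real_derivative V s * y s - k - (y s)\<^sup>2) (at s)"
    and yc: "continuous_on {0<..L} y" and yL: "y L \<ge> 0"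
    and y0: "((\<lambda>s. s * y s) \<longlongrightarrow> l) (at_right 0)"
  shows "k * integral {0..L} (\<lambda>s. (g s)\<^sup>2 * \<rho> s) \<le> integral {0..L} (\<lambda>s. (g' s)\<^sup>2 * \<rho> s)"
proof -
  \<comment> \<open>Near 0, \<open>g\<close> vanishes to first order while \<open>s * y s\<close>
    stays bounded, so \<open>\<rho> g^2 y\<close> tends to 0 and the boundary term there is
    lost.\<close>
  define F where "F s = (if s = 0 then 0 else \<rho> s * (g s)\<^sup>2 * y s)" for s
  define F' where "F' s = \<rho> s * (2 * g s * g' s * y s - (g s)\<^sup>2 * (y s)\<^sup>2 - k * (g s)\<^sup>2)" for s
  have gc: "continuous_on {0..L} g"
    using g by (meson DERIV_continuous continuous_on_eq_continuous_within)
  have lim: "(F \<longlongrightarrow> 0) (at_right 0)"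
  proof -
    have "((\<lambda>s. (g s - g 0) / (s - 0)) \<longlongrightarrow> g' 0) (at 0 within {0..L})"
      using g[of 0] L by (simp add: has_field_derivative_iff)
    then have "((\<lambda>s. g s / s) \<longlongrightarrow> g' 0) (at_right 0)"
      using L g0 by (simp add: at_within_Icc_at_right)
    moreover have "(\<rho> \<longlongrightarrow> \<rho> 0) (at_right 0)"
      using \<rho>c L by (metis at_within_Icc_at_right atLeastAtMost_iff continuous_on_def less_eq_real_def)
    moreover have "((\<lambda>s. s) \<longlongrightarrow> 0) (at_right (0::real))" by (rule tendsto_ident_at)
    ultimately have "((\<lambda>s. \<rho> s * (g s / s)\<^sup>2 * s * (s * y s)) \<longlongrightarrow> \<rho> 0 * (g' 0)\<^sup>2 * 0 * l) (at_right 0)"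
      using y0 by (intro tendsto_intros)
    moreover have "\<forall>\<^sub>F s in at_right 0. \<rho> s * (g s / s)\<^sup>2 * s * (s * y s) = F s"
      by (auto simp: eventually_at_filter F_def field_simps power2_eq_square)
    ultimately show ?thesis by (simp add: filterlim_cong)
  qed
  have Fc: "continuous_on {0..L} F"
  proof (rule continuous_on_Icc_at_right)
    have "continuous_on {0<..L} (\<lambda>s. \<rho> s * (g s)\<^sup>2 * y s)"
      by (intro continuous_intros yc continuous_on_subset[OF \<rho>c] continuous_on_subset[OF gc]) auto
    then show "continuous_on {0<..L} F"
      by (subst continuous_on_cong[OF refl]) (auto simp: F_def)
  qed (use lim L in \<open>simp_all add: F_def\<close>)
  have "(F' has_integral (F L - F 0)) {0..L}"
  proof (rule fundamental_theorem_of_calculus_interior)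
    fix s assume s: "s \<in> {0<..<L}"
    have g_at: "(g has_real_derivative g' s) (at s)"
      using g[of s] s at_within_Icc_at[of 0 s L] by auto
    have "((\<lambda>s. \<rho> s * (g s)\<^sup>2 * y s) has_real_derivative F' s) (at s)"
      unfolding F'_def
      by (rule derivative_eq_intros \<rho> y g_at s refl)+ (auto simp: algebra_simps power2_eq_square)
    then have "(F has_real_derivative F' s) (at s)"
      by (rule has_field_derivative_transform_within_open[where S = "{0<..}"]) (use s in \<open>auto simp: F_def\<close>)
    then show "(F has_vector_derivative F' s) (at s)"
      by (simp add: has_real_derivative_iff_has_vector_derivative)
  qed (use L Fc in auto)
  then have F'_int: "F' integrable_on {0..L}" "integral {0..L} F' = F L"
    by (auto simp: F_def has_integral_integrable_integral)
  have i1: "(\<lambda>s. (g' s)\<^sup>2 * \<rho> s) integrable_on {0..L}" "(\<lambda>s. (g s)\<^sup>2 * \<rho> s) integrable_on {0..L}"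
    by (intro integrable_continuous_real continuous_intros g' gc \<rho>c)+
  \<comment> \<open>The sign of \<open>y L\<close> lets the boundary term at \<open>L\<close> be
    dropped; no condition on \<open>g\<close> is imposed at that end.\<close>
  have "0 \<le> F L" using \<rho>0[of L] yL L by (auto simp: F_def)
  also have "\<dots> = integral {0..L} F'" using F'_int by simp
  also have "\<dots> \<le> integral {0..L} (\<lambda>s. (g' s)\<^sup>2 * \<rho> s - k * ((g s)\<^sup>2 * \<rho> s))"
  proof (intro integral_le integrable_diff i1 F'_int integrable_on_mult_right)
    fix s assume "s \<in> {0..L}"
    \<comment> \<open>Completing the square: equality would hold for \<open>g' = g y\<close>, the
      ground state.\<close>
    have "F' s = (g' s)\<^sup>2 * \<rho> s - k * ((g s)\<^sup>2 * \<rho> s) - \<rho> s * (g' s - g s * y s)\<^sup>2"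
      by (simp add: F'_def algebra_simps power2_eq_square)
    then show "F' s \<le> (g' s)\<^sup>2 * \<rho> s - k * ((g s)\<^sup>2 * \<rho> s)"
      using \<rho>0[OF \<open>s \<in> _\<close>] by simp
  qed
  also have "\<dots> = integral {0..L} (\<lambda>s. (g' s)\<^sup>2 * \<rho> s) - k * integral {0..L} (\<lambda>s. (g s)\<^sup>2 * \<rho> s)"
    using i1 by (subst integral_diff) (auto intro: integrable_on_mult_right)
  finally show ?thesis by simp
qed

section \<open>The Pruefer angle and the half-line inequality\<close>

lemma abs_sin_diff_le: "\<bar>sin x - sin y\<bar> \<le> \<bar>x - y\<bar>" for x y :: real
proof -
  have "\<bar>sin x - sin y\<bar> = 2 * \<bar>sin ((x - y) / 2)\<bar> * \<bar>cos ((x + y) / 2)\<bar>"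
    by (simp add: sin_diff_sin abs_mult)
  also have "\<dots> \<le> 2 * \<bar>(x - y) / 2\<bar> * 1"
    by (intro mult_mono abs_sin_x_le_abs_x) auto
  finally show ?thesis by simp
qed

text \<open>The right-hand side is globally Lipschitz in the angle with constant \<open>K\<close>.
  In the supremum norm weighted by \<open>exp (-2 K s)\<close>, the Picard map contracts by 1/2 on
  the whole interval, so no continuation of local solutions is needed.\<close>

lemma prufer_exists:
  fixes V :: "real \<Rightarrow> real"
  assumes V: "continuous_on {0..L} V" and L: "0 < L"
  shows "\<exists>\<psi>. \<psi> 0 = 0 \<and> (\<forall>s\<in>{0..L}. (\<psi> has_real_derivative \<kappa> - V s * sin (\<psi> s)) (at s within {0..L}))"
proof -
  obtain K where K: "K > 0" "\<And>s. s \<in> {0..L} \<Longrightarrow> \<bar>V s\<bar> \<le> K"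
    using compact_imp_bounded[OF compact_continuous_image[OF V compact_Icc]]
    unfolding bounded_pos by auto
  \<comment> \<open>Bounded continuous functions live on the whole line here; clamping to
    \<open>{0..L}\<close> extends a function from the interval.\<close>
  define c where "c s = max 0 (min L s)" for s
  have c: "c s \<in> {0..L}" for s using L by (auto simp: c_def)
  have c_id: "c s = s" if "s \<in> {0..L}" for s using that by (auto simp: c_def)
  have cc: "continuous_on UNIV c" unfolding c_def by (intro continuous_intros)
  \<comment> \<open>The unknown \<open>q\<close> is the angle times \<open>exp (-2 K t)\<close>, so
    that the ordinary supremum norm of \<open>q\<close> is the weighted norm of the angle.\<close>
  define w where "w q t = \<kappa> - V t * sin (exp (2 * K * t) * apply_bcontfun q t)" for q :: "real \<Rightarrow>\<^sub>C real" and t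
  have wc: "continuous_on {0..L} (w q)" for q
    unfolding w_def by (intro continuous_intros V continuous_on_apply_bcontfun)
  have wi: "w q integrable_on {0..s}" if "s \<in> {0..L}" for q s
    using that by (intro integrable_continuous_real continuous_on_subset[OF wc]) auto
  define T0 where "T0 q s = exp (- (2 * K * s)) * integral {0..s} (w q)" for q s
  have T0c: "continuous_on {0..L} (T0 q)" for q
    unfolding T0_def by (intro continuous_intros indefinite_integral_continuous_1 wi) (use L in auto)
  have Tb: "(\<lambda>s. T0 q (c s)) \<in> bcontfun" for q
  proof -
    obtain B where "\<forall>s\<in>{0..L}. norm (T0 q s) \<le> B"
      using compact_imp_bounded[OF compact_continuous_image[OF T0c[of q] compact_Icc]]
      unfolding bounded_iff by auto
    then show ?thesis
      using c by (intro bcontfun_normI[of _ B] continuous_on_compose2[OF T0c cc]) auto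
  qed
  define T where "T q = Bcontfun (\<lambda>s. T0 q (c s))" for q
  have T: "apply_bcontfun (T q) s = T0 q (c s)" for q s
    unfolding T_def using Tb by (simp add: Bcontfun_inverse)
  have "dist (T q1) (T q2) \<le> 1/2 * dist q1 q2" for q1 q2
  proof (rule dist_bound)
    fix s
    define D where "D = dist q1 q2"
    define t where "t = c s"
    have t: "t \<in> {0..L}" using c by (simp add: t_def)
    \<comment> \<open>Integrating \<open>K * D * exp (2 K x)\<close> divides by \<open>2 K\<close>;
      this is where the contraction factor 1/2 arises.\<close>
    have e: "((\<lambda>x. K * D * exp (2 * K * x)) has_integral (D / 2 * exp (2 * K * t) - D / 2 * exp (2 * K * 0))) {0..t}"
      using t K
      by (intro fundamental_theorem_of_calculus)
         (auto intro!: derivative_eq_intros simp flip: has_real_derivative_iff_has_vector_derivative)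
    have "\<bar>integral {0..t} (w q1) - integral {0..t} (w q2)\<bar> = \<bar>integral {0..t} (\<lambda>x. w q1 x - w q2 x)\<bar>"
      by (simp add: integral_diff wi[OF t])
    also have "\<dots> \<le> integral {0..t} (\<lambda>x. K * D * exp (2 * K * x))"
    proof (rule integral_norm_bound_integral[where 'a=real, unfolded real_norm_def])
      show "(\<lambda>x. w q1 x - w q2 x) integrable_on {0..t}" by (intro integrable_diff wi t)
      show "(\<lambda>x. K * D * exp (2 * K * x)) integrable_on {0..t}" using e by blast
      fix x assume x: "x \<in> {0..t}"
      have "\<bar>w q1 x - w q2 x\<bar> = \<bar>V x\<bar> * \<bar>sin (exp (2 * K * x) * q1 x) - sin (exp (2 * K * x) * q2 x)\<bar>"
        by (simp add: w_def flip: abs_mult) (simp add: algebra_simps abs_minus_commute)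
      also have "\<dots> \<le> K * \<bar>exp (2 * K * x) * q1 x - exp (2 * K * x) * q2 x\<bar>"
        using K(2)[of x] x t K(1) by (intro mult_mono abs_sin_diff_le) auto
      also have "\<dots> = K * (exp (2 * K * x) * dist (q1 x) (q2 x))"
        by (simp add: dist_real_def abs_mult flip: right_diff_distrib)
      also have "\<dots> \<le> K * (exp (2 * K * x) * D)"
        unfolding D_def using K by (intro mult_left_mono dist_bounded) auto
      finally show "\<bar>w q1 x - w q2 x\<bar> \<le> K * D * exp (2 * K * x)" by (simp add: mult_ac)
    qed
    also have "\<dots> = D / 2 * exp (2 * K * t) - D / 2"
      using integral_unique[OF e] by simp
    also have "\<dots> \<le> D / 2 * exp (2 * K * t)" by (simp add: D_def)
    finally have *: "\<bar>integral {0..t} (w q1) - integral {0..t} (w q2)\<bar> \<le> D / 2 * exp (2 * K * t)" .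
    have "dist (T q1 s) (T q2 s) = exp (- (2 * K * t)) * \<bar>integral {0..t} (w q1) - integral {0..t} (w q2)\<bar>"
      by (simp add: T T0_def dist_real_def abs_mult t_def flip: right_diff_distrib)
    also have "\<dots> \<le> exp (- (2 * K * t)) * (D / 2 * exp (2 * K * t))"
      by (intro mult_left_mono *) auto
    also have "\<dots> = D / 2" by (simp add: exp_minus field_simps)
    finally show "dist (T q1 s) (T q2 s) \<le> 1/2 * dist q1 q2" by (simp add: D_def)
  qed
  then obtain q where q: "T q = q"
    using banach_fix_type[of "1/2" T] by auto
  define \<psi> where "\<psi> s = integral {0..s} (w q)" for s
  have w: "w q s = \<kappa> - V s * sin (\<psi> s)" if "s \<in> {0..L}" for s
  proof -
    have "q s = exp (- (2 * K * s)) * \<psi> s"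
      using T[of q s] that by (simp add: q c_id T0_def \<psi>_def)
    then show ?thesis by (simp add: w_def exp_minus field_simps)
  qed
  have "(\<psi> has_real_derivative \<kappa> - V s * sin (\<psi> s)) (at s within {0..L})" if "s \<in> {0..L}" for s
    using integral_has_real_derivative[OF wc that, of q] w[OF that] by (simp add: \<psi>_def[abs_def])
  moreover have "\<psi> 0 = 0" by (simp add: \<psi>_def)
  ultimately show ?thesis by blast
qed

text \<open>If the angle reached \<open>\<pi>\<close> at \<open>b\<close>, then monotonicity of \<open>V\<close> would force \<open>V sin \<psi> \<le> \<kappa>\<close> up to \<open>b\<close>.
  With \<open>\<sigma> = \<kappa> s\<close>, the functions \<open>\<sigma>^2 + 2\<sigma>\<close> (for \<open>\<psi> \<le> \<pi>/2\<close>) and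
  \<open>sin \<psi> (\<sigma>^2 - 2) + 2 (1 + cos \<psi>) \<sigma> + 2 sin \<psi> (1 + cos \<psi>)\<close> (for \<open>\<psi> \<ge> \<pi>/2\<close>) are then lower bounds
  for the tail integral of \<open>(\<sigma>^2 - 2) \<rho>\<close>; they agree at \<open>\<pi>/2\<close> and the second vanishes at \<open>\<pi>\<close>.\<close>

lemma prufer_below_pi:
  fixes V \<rho> \<psi> :: "real \<Rightarrow> real"
  assumes L: "0 < L" and \<kappa>: "0 < \<kappa>"
    and V: "mono_on {0..L} V" "V 0 \<ge> 0"
    and \<rho>: "\<And>s. s \<in> {0..L} \<Longrightarrow> (\<rho> has_real_derivative - V s * \<rho> s) (at s within {0..L})"
    and \<rho>0: "\<And>s. s \<in> {0..L} \<Longrightarrow> \<rho> s > 0"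
    and \<psi>0: "\<psi> 0 = 0"
    and \<psi>: "\<And>s. s \<in> {0..L} \<Longrightarrow> (\<psi> has_real_derivative \<kappa> - V s * sin (\<psi> s)) (at s within {0..L})"
    and moment: "integral {0..L} (\<lambda>s. ((\<kappa> * s)\<^sup>2 - 2) * \<rho> s) < 0"
    and s: "s \<in> {0<..L}"
  shows "0 < \<psi> s" "\<psi> s < pi"
proof -
  have pos: "0 < \<psi> s" if "s \<in> {0<..L}" for s
    by (rule barrier_pos[of 0 L \<psi>, OF \<psi>]) (use that \<kappa> \<psi>0 in auto)
  have \<psi>c: "continuous_on {0..L} \<psi>" and \<rho>c: "continuous_on {0..L} \<rho>"
    using \<psi> \<rho> by (meson DERIV_continuous continuous_on_eq_continuous_within)+
  have Vpos: "V s \<ge> 0" if "s \<in> {0..L}" for s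
    using monotone_onD[OF V(1), of 0 s] V(2) that by auto
  have nonneg: "0 \<le> \<psi> s" if "s \<in> {0..L}" for s
    using pos[of s] that \<psi>0 by (cases "s = 0") auto
  have at: "at s within {0..L} = at s" if "0 < s" "s < L" for s
    using that by (intro at_within_Icc_at)
  show "0 < \<psi> s" using pos s .
  show "\<psi> s < pi"
  proof (rule ccontr)
    assume ns: "\<not> \<psi> s < pi"
    define Z where "Z = {0..L} \<inter> \<psi> -` {pi..}"
    have "closed Z"
      unfolding Z_def by (intro continuous_closed_preimage \<psi>c) auto
    then have "compact Z"
      by (auto simp: Z_def compact_eq_bounded_closed intro: bounded_subset[OF bounded_closed_interval[of 0 L]])
    moreover have "s \<in> Z" using s ns by (auto simp: Z_def)
    ultimately obtain b where b: "b \<in> Z" "\<And>x. x \<in> Z \<Longrightarrow> b \<le> x"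
      by (metis compact_attains_inf empty_iff)
    have bL: "0 < b" "b \<le> L" using b \<psi>0 by (auto simp: Z_def) (metis less_eq_real_def not_less pi_gt_zero)
    have before: "\<psi> x < pi" if "0 \<le> x" "x < b" for x
      using b(2)[of x] that bL by (cases "\<psi> x < pi") (auto simp: Z_def)
    have "\<psi> b = pi"
    proof (rule ccontr)
      assume ne: "\<psi> b \<noteq> pi"
      have "\<exists>x\<ge>0. x \<le> b \<and> \<psi> x = pi"
        by (rule IVT') (use b bL \<psi>0 continuous_on_subset[OF \<psi>c, of "{0..b}"] in \<open>auto simp: Z_def\<close>)
      then obtain x where "0 \<le> x" "x \<le> b" "\<psi> x = pi" by auto
      then show False using before[of x] ne by (cases "x = b") auto
    qed
    \<comment> \<open>If \<open>V s * sin m > \<kappa>\<close> for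
      \<open>m = max (\<psi> s) (pi/2)\<close>, then, as \<open>V\<close> increases, the angle has
      negative speed whenever it meets the level \<open>m\<close> later on. It would stay below
      \<open>m < pi\<close> and never reach \<pi> at \<open>b\<close>. The maximum with
      \<open>pi/2\<close> makes the bound read \<open>V s <= \<kappa>\<close> on the first
      half.\<close>
    have key: "V s * sin (max (\<psi> s) (pi/2)) \<le> \<kappa>" if s: "0 \<le> s" "s < b" for s
    proof (rule ccontr)
      define m where "m = max (\<psi> s) (pi/2)"
      assume "\<not> V s * sin (max (\<psi> s) (pi/2)) \<le> \<kappa>"
      then have *: "V s * sin m > \<kappa>" by (simp add: m_def)
      have m: "m < pi" "m > 0" using before[of s] s pi_half_gt_zero pi_gt_zero by (auto simp: m_def less_max_iff_disj)
      have "m - \<psi> b > 0"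
      proof (rule barrier_pos[of s b "\<lambda>s. m - \<psi> s" "\<lambda>s. - (\<kappa> - V s * sin (\<psi> s))"])
        fix t assume t: "t \<in> {s..b}"
        show "((\<lambda>s. m - \<psi> s) has_real_derivative - (\<kappa> - V t * sin (\<psi> t))) (at t within {s..b})"
          by (rule derivative_eq_intros DERIV_subset[OF \<psi>] refl)+ (use t s bL in auto)
        assume "m - \<psi> t = 0"
        then have "V t * sin (\<psi> t) \<ge> V s * sin m"
          using m t s bL monotone_onD[OF V(1), of s t] by (auto intro!: mult_right_mono sin_ge_zero)
        then show "- (\<kappa> - V t * sin (\<psi> t)) > 0" using * by auto
      qed (use s in \<open>auto simp: m_def\<close>)
      then show False using \<open>\<psi> b = pi\<close> m by auto
    qed
    have V\<kappa>: "V s \<le> \<kappa>" if "0 \<le> s" "s < b" "\<psi> s \<le> pi/2" for s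
      using key[OF that(1,2)] that(3) by (simp add: max_absorb2)
    have V\<kappa>': "V s * sin (\<psi> s) \<le> \<kappa>" if "0 \<le> s" "s < b" for s
    proof (cases "\<psi> s \<le> pi/2")
      case True
      have "V s * sin (\<psi> s) \<le> V s * 1"
        using that bL by (intro mult_left_mono Vpos) auto
      then show ?thesis using V\<kappa>[OF that True] by simp
    next
      case False
      then show ?thesis using key[OF that] by (simp add: max_absorb1)
    qed
    have \<psi>_at: "(\<psi> has_real_derivative \<kappa> - V s * sin (\<psi> s)) (at s)" if "0 < s" "s < L" for s
      using \<psi>[of s] at[OF that] that by auto
    have \<rho>_at: "(\<rho> has_real_derivative - V s * \<rho> s) (at s)" if "0 < s" "s < L" for s
      using \<rho>[of s] at[OF that] that by auto
    have mono: "\<psi> s \<le> \<psi> t" if "0 \<le> s" "s \<le> t" "t \<le> b" for s t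
      using that(2)
    proof (rule DERIV_nonneg_imp_increasing_open)
      fix x assume "s < x" "x < t"
      then show "\<exists>y. (\<psi> has_real_derivative y) (at x) \<and> 0 \<le> y"
        using \<psi>_at[of x] V\<kappa>'[of x] that bL by auto
    qed (use that bL in \<open>auto intro: continuous_on_subset[OF \<psi>c]\<close>)
    \<comment> \<open>The angle moves at speed at most \<kappa>, since
      \<open>V sin \<psi> >= 0\<close>. At \<open>b\<close> this yields
      \<open>\<kappa> b >= pi\<close>.\<close>
    have le: "\<psi> s \<le> \<kappa> * s" if "0 \<le> s" "s \<le> b" for s
    proof -
      have "\<kappa> * 0 - \<psi> 0 \<le> \<kappa> * s - \<psi> s"
        using that(1)
      proof (rule DERIV_nonneg_imp_increasing_open)
        fix x assume x: "0 < x" "x < s"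
        have "((\<lambda>s. \<kappa> * s - \<psi> s) has_real_derivative V x * sin (\<psi> x)) (at x)"
          by (rule derivative_eq_intros \<psi>_at refl)+ (use x that bL in auto)
        moreover have "0 \<le> V x * sin (\<psi> x)"
          using x that bL before[of x] nonneg[of x] by (intro mult_nonneg_nonneg Vpos sin_ge_zero) auto
        ultimately show "\<exists>y. ((\<lambda>s. \<kappa> * s - \<psi> s) has_real_derivative y) (at x) \<and> 0 \<le> y" by auto
      qed (use that bL in \<open>auto intro!: continuous_intros continuous_on_subset[OF \<psi>c]\<close>)
      then show ?thesis using \<psi>0 by simp
    qed
    obtain \<tau> where \<tau>: "0 \<le> \<tau>" "\<tau> \<le> b" "\<psi> \<tau> = pi/2"
      using IVT'[of \<psi> 0 "pi/2" b] \<psi>0 \<open>\<psi> b = pi\<close> bL continuous_on_subset[OF \<psi>c, of "{0..b}"] by auto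
    define I where "I s = integral {0..s} (\<lambda>s. ((\<kappa> * s)\<^sup>2 - 2) * \<rho> s)" for s
    have ic: "continuous_on {0..L} (\<lambda>s. ((\<kappa> * s)\<^sup>2 - 2) * \<rho> s)"
      by (intro continuous_intros \<rho>c)
    have I: "(I has_real_derivative ((\<kappa> * s)\<^sup>2 - 2) * \<rho> s) (at s)" if "0 < s" "s < L" for s
      using integral_has_real_derivative[OF ic, of s] that at[of s] by (auto simp: I_def[abs_def])
    have Ic: "continuous_on {0..L} I"
      unfolding I_def by (intro indefinite_integral_continuous_1 integrable_continuous_real ic)
    \<comment> \<open>For \<open>V = \<kappa>\<close> this is constant:
      \<open>(\<sigma>^2 + 2\<sigma>) exp (-\<sigma>)\<close> has derivative
      \<open>-(\<sigma>^2 - 2) exp (-\<sigma>)\<close> with respect to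
      \<open>\<sigma> = \<kappa> s\<close>. In general the derivative picks up the factor
      \<open>\<kappa> - V\<close>, nonnegative while \<open>\<psi> <= pi/2\<close>.\<close>
    define H1 where "H1 s = \<rho> s * ((\<kappa> * s)\<^sup>2 + 2 * (\<kappa> * s)) + \<kappa> * I s" for s
    define H2 where "H2 s = \<rho> s * (sin (\<psi> s) * ((\<kappa> * s)\<^sup>2 - 2) + 2 * (1 + cos (\<psi> s)) * (\<kappa> * s)
        + 2 * sin (\<psi> s) * (1 + cos (\<psi> s))) + \<kappa> * I s" for s
    have "H1 0 \<le> H1 \<tau>"
      using \<tau>(1)
    proof (rule DERIV_nonneg_imp_increasing_open)
      fix x assume x: "0 < x" "x < \<tau>"
      note d = \<rho>_at[of x] I[of x]
      have "(H1 has_real_derivative \<rho> x * (\<kappa> - V x) * ((\<kappa> * x)\<^sup>2 + 2 * (\<kappa> * x))) (at x)"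
        unfolding H1_def
        using x \<tau> bL
        by - (rule derivative_eq_intros d refl | simp add: algebra_simps power2_eq_square)+
      moreover have "0 \<le> \<rho> x * (\<kappa> - V x) * ((\<kappa> * x)\<^sup>2 + 2 * (\<kappa> * x))"
        using V\<kappa>[of x] mono[of x \<tau>] x \<tau> bL \<rho>0[of x] \<kappa> by (intro mult_nonneg_nonneg add_nonneg_nonneg) auto
      ultimately show "\<exists>y. (H1 has_real_derivative y) (at x) \<and> 0 \<le> y" by blast
    next
      show "continuous_on {0..\<tau>} H1"
        unfolding H1_def using \<tau> bL
        by (intro continuous_intros continuous_on_subset[OF \<rho>c] continuous_on_subset[OF Ic]) auto
    qed
    moreover have "H2 \<tau> \<le> H2 b"
      using \<tau>(2)
    proof (rule DERIV_nonneg_imp_increasing_open)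
      fix x assume x: "\<tau> < x" "x < b"
      define S c \<sigma> where "S = sin (\<psi> x)" and "c = cos (\<psi> x)" and "\<sigma> = \<kappa> * x"
      have \<psi>x: "pi/2 \<le> \<psi> x" "\<psi> x < pi" using mono[of \<tau> x] before[of x] x \<tau> by auto
      have S0: "S \<ge> 0" unfolding S_def using \<psi>x pi_gt_zero by (intro sin_ge_zero) auto
      have c0: "c \<le> 0" using \<psi>x cos_monotone_0_pi_le[of "pi/2" "\<psi> x"] by (auto simp: c_def)
      have c1: "1 + c \<ge> 0" using cos_ge_minus_one[of "\<psi> x"] unfolding c_def by linarith
      have Sc: "S\<^sup>2 = 1 - c\<^sup>2" by (simp add: S_def c_def sin_squared_eq)
      have \<sigma>: "\<psi> x \<le> \<sigma>" using le[of x] x \<tau> by (auto simp: \<sigma>_def)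
      \<comment> \<open>With \<open>t = \<psi> - pi/2\<close>, we have
        \<open>c = - sin t >= - t\<close> and \<sigma> is at least \<open>t + 3/2\<close>. The bound
        is then the identity \<open>(t + 3/2)^2 - 2 - 4 t = (t - 1/2)^2\<close>.\<close>
      have \<sigma>c: "\<sigma>\<^sup>2 - 2 + 4 * c \<ge> 0"
      proof -
        define t where "t = \<psi> x - pi/2"
        have "c = - sin t" by (simp add: c_def t_def sin_diff)
        moreover have t: "t \<ge> 0" "sin t \<le> t" using \<psi>x by (auto simp: t_def intro: sin_x_le_x)
        moreover have "(t + 3/2)\<^sup>2 \<le> \<sigma>\<^sup>2"
          using \<sigma> pi_gt3 t by (intro power_mono) (auto simp: t_def)
        moreover have "0 \<le> (t - 1/2)\<^sup>2" by simp
        ultimately show ?thesis by (simp add: power2_eq_square algebra_simps)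
      qed
      have \<sigma>0: "\<sigma> \<ge> 0" using x \<tau> \<kappa> by (auto simp: \<sigma>_def)
      note d = \<rho>_at[of x] I[of x] \<psi>_at[of x]
      have "(H2 has_real_derivative
          - V x * \<rho> x * (S * (\<sigma>\<^sup>2 - 2) + 2 * (1 + c) * \<sigma> + 2 * S * (1 + c))
          + \<rho> x * ((2 * S * \<sigma> + 2 * (1 + c)) * \<kappa>
            + (c * (\<sigma>\<^sup>2 - 2) - 2 * S * \<sigma> + 2 * c * (1 + c) - 2 * S\<^sup>2) * (\<kappa> - V x * S))
          + \<kappa> * ((\<sigma>\<^sup>2 - 2) * \<rho> x)) (at x)" (is "(_ has_real_derivative ?D) _")
        unfolding H2_def using x \<tau> bL
        by - (rule derivative_eq_intros d refl | simp add: algebra_simps power2_eq_square flip: S_def c_def \<sigma>_def)+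
      \<comment> \<open>Regrouped by \<open>S^2 + c^2 = 1\<close> so that each summand is a product
        of factors of known sign: \<open>V\<kappa>'\<close> and \<open>\<sigma>c\<close> for the
        first, \<open>c <= 0\<close> for the second.\<close>
      also have "?D = \<rho> x * ((\<kappa> - V x * S) * ((1 + c) * (\<sigma>\<^sup>2 - 2 + 4 * c)) + V x * (2 * \<sigma> * (1 + c) * (- c)))"
        using Sc by algebra
      finally have "(H2 has_real_derivative \<rho> x * ((\<kappa> - V x * S) * ((1 + c) * (\<sigma>\<^sup>2 - 2 + 4 * c)) + V x * (2 * \<sigma> * (1 + c) * (- c)))) (at x)" .
      moreover have "0 \<le> \<rho> x * ((\<kappa> - V x * S) * ((1 + c) * (\<sigma>\<^sup>2 - 2 + 4 * c)) + V x * (2 * \<sigma> * (1 + c) * (- c)))"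
      proof -
        have "0 \<le> (\<kappa> - V x * S) * ((1 + c) * (\<sigma>\<^sup>2 - 2 + 4 * c))"
          using V\<kappa>'[of x] x \<tau> c1 \<sigma>c by (intro mult_nonneg_nonneg) (auto simp: S_def)
        moreover have "0 \<le> V x * (2 * \<sigma> * (1 + c) * (- c))"
          using Vpos[of x] x \<tau> bL c0 c1 \<sigma>0 by (intro mult_nonneg_nonneg) auto
        moreover have "0 \<le> \<rho> x" using \<rho>0[of x] x \<tau> bL by simp
        ultimately show ?thesis by (metis add_nonneg_nonneg mult_nonneg_nonneg)
      qed
      ultimately show "\<exists>y. (H2 has_real_derivative y) (at x) \<and> 0 \<le> y" by blast
    next
      show "continuous_on {\<tau>..b} H2"
        unfolding H2_def using \<tau> bL
        by (intro continuous_intros continuous_on_subset[OF \<rho>c] continuous_on_subset[OF Ic] continuous_on_subset[OF \<psi>c]) auto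
    qed
    moreover have "H1 0 = 0" "H1 \<tau> = H2 \<tau>" "H2 b = \<kappa> * I b"
      by (simp_all add: H1_def H2_def I_def \<tau> \<open>\<psi> b = pi\<close> algebra_simps)
    ultimately have "0 \<le> \<kappa> * I b" by linarith
    then have Ib: "0 \<le> I b" using \<kappa> by (simp add: zero_le_mult_iff)
    \<comment> \<open>Beyond \<open>b\<close> one has \<open>\<kappa> s >= pi > 3\<close>, so the
      integrand is positive there. Hence the full integral is nonnegative too, against
      \<open>moment\<close>.\<close>
    have "I L = I b + integral {b..L} (\<lambda>s. ((\<kappa> * s)\<^sup>2 - 2) * \<rho> s)"
      unfolding I_def using bL
      by (intro Henstock_Kurzweil_Integration.integral_combine[symmetric] integrable_continuous_real ic) auto
    moreover have "0 \<le> integral {b..L} (\<lambda>s. ((\<kappa> * s)\<^sup>2 - 2) * \<rho> s)"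
    proof (rule integral_nonneg)
      show "(\<lambda>s. ((\<kappa> * s)\<^sup>2 - 2) * \<rho> s) integrable_on {b..L}"
        using bL by (intro integrable_continuous_real continuous_on_subset[OF ic]) auto
      fix x assume x: "x \<in> {b..L}"
      have "3 \<le> \<kappa> * b" using le[of b] bL \<open>\<psi> b = pi\<close> pi_gt3 by auto
      also have "\<dots> \<le> \<kappa> * x" using x \<kappa> by auto
      finally have "3\<^sup>2 \<le> (\<kappa> * x)\<^sup>2" by (intro power_mono) auto
      then show "0 \<le> ((\<kappa> * x)\<^sup>2 - 2) * \<rho> x" using \<rho>0[of x] x bL by auto
    qed
    ultimately show False using Ib moment by (simp add: I_def)
  qed
qed

text \<open>The substitution \<open>y = \<kappa>/2 * cot (\<psi>/2)\<close> turns the angle equation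
  into the Riccati equation with \<open>k = \<kappa>^2/4\<close>, and an angle in
  \<open>(0, pi)\<close> keeps \<open>y\<close> finite and nonnegative. The factor 1/2 is the right
  one: the rate-one exponential law on the whole half-line has second moment 2 and best Dirichlet
  constant 4.\<close>

lemma halfline_poincare:
  fixes V \<rho> g g' :: "real \<Rightarrow> real"
  assumes L: "0 < L" and C: "0 < C"
    and V: "continuous_on {0..L} V" "mono_on {0..L} V" "V 0 \<ge> 0"
    and \<rho>: "\<And>s. s \<in> {0..L} \<Longrightarrow> (\<rho> has_real_derivative - V s * \<rho> s) (at s within {0..L})"
    and \<rho>0: "\<And>s. s \<in> {0..L} \<Longrightarrow> \<rho> s > 0"
    and moment: "integral {0..L} (\<lambda>s. s\<^sup>2 * \<rho> s) < C / 2 * integral {0..L} \<rho>"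
    and g: "\<And>s. s \<in> {0..L} \<Longrightarrow> (g has_real_derivative g' s) (at s within {0..L})"
    and g': "continuous_on {0..L} g'" and g0: "g 0 = 0"
  shows "integral {0..L} (\<lambda>s. (g s)\<^sup>2 * \<rho> s) \<le> C * integral {0..L} (\<lambda>s. (g' s)\<^sup>2 * \<rho> s)"
proof -
  \<comment> \<open>Chosen so that \<open>\<kappa>^2/4 = 1/C\<close>; the second moment hypothesis
    then says exactly that \<open>(\<kappa> s)^2 - 2\<close> has negative integral.\<close>
  define \<kappa> where "\<kappa> = 2 / sqrt C"
  have \<kappa>: "\<kappa> > 0" "\<kappa>\<^sup>2 = 4 / C" using C by (simp_all add: \<kappa>_def power_divide)
  have \<rho>c: "continuous_on {0..L} \<rho>"
    using \<rho> by (meson DERIV_continuous continuous_on_eq_continuous_within)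
  obtain \<psi> where \<psi>0: "\<psi> 0 = 0"
    and \<psi>: "\<And>s. s \<in> {0..L} \<Longrightarrow> (\<psi> has_real_derivative \<kappa> - V s * sin (\<psi> s)) (at s within {0..L})"
    using prufer_exists[OF V(1) L] by metis
  have \<psi>c: "continuous_on {0..L} \<psi>"
    using \<psi> by (meson DERIV_continuous continuous_on_eq_continuous_within)
  have "integral {0..L} (\<lambda>s. ((\<kappa> * s)\<^sup>2 - 2) * \<rho> s)
      = integral {0..L} (\<lambda>s. \<kappa>\<^sup>2 * (s\<^sup>2 * \<rho> s) - 2 * \<rho> s)"
    by (simp add: algebra_simps power_mult_distrib)
  also have "\<dots> = \<kappa>\<^sup>2 * integral {0..L} (\<lambda>s. s\<^sup>2 * \<rho> s) - 2 * integral {0..L} \<rho>"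
    by (subst integral_diff) (auto intro!: integrable_continuous_real continuous_intros \<rho>c)
  also have "\<dots> < 0" using moment C by (simp add: \<kappa> field_simps)
  finally have m: "integral {0..L} (\<lambda>s. ((\<kappa> * s)\<^sup>2 - 2) * \<rho> s) < 0" .
  have range: "0 < \<psi> s" "\<psi> s < pi" if "s \<in> {0<..L}" for s
    using prufer_below_pi[OF L \<kappa>(1) V(2,3) \<rho> \<rho>0 \<psi>0 \<psi> m that] by auto
  define y where "y s = \<kappa> / 2 * (cos (\<psi> s / 2) / sin (\<psi> s / 2))" for s
  have sin_pos: "sin (\<psi> s / 2) > 0" if "s \<in> {0<..L}" for s
    using range[OF that] by (intro sin_gt_zero) auto
  have "1 / C * integral {0..L} (\<lambda>s. (g s)\<^sup>2 * \<rho> s) \<le> integral {0..L} (\<lambda>s. (g' s)\<^sup>2 * \<rho> s)"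
  proof (rule riccati_poincare[where V = V and y = y and l = 1, OF L g g' g0 _ \<rho>c])
    fix s assume s: "s \<in> {0<..<L}"
    have at: "at s within {0..L} = at s" using s by (intro at_within_Icc_at) auto
    show "(\<rho> has_real_derivative - V s * \<rho> s) (at s)" using \<rho>[of s] at s by simp
    have d: "(\<psi> has_real_derivative \<kappa> - V s * sin (\<psi> s)) (at s)" using \<psi>[of s] at s by simp
    define S c where "S = sin (\<psi> s / 2)" and "c = cos (\<psi> s / 2)"
    have S: "S > 0" using sin_pos[of s] s by (simp add: S_def)
    have c: "c\<^sup>2 = 1 - S\<^sup>2" by (simp add: S_def c_def cos_squared_eq)
    have sc: "sin (\<psi> s) = 2 * S * c" using sin_double[of "\<psi> s / 2"] by (simp add: S_def c_def)
    have "(y has_real_derivative \<kappa> / 2 * (((- S * ((\<kappa> - V s * (2 * S * c)) / 2)) * S - c * (c * ((\<kappa> - V s * (2 * S * c)) / 2))) / (S * S))) (at s)"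
      unfolding y_def using S
      by - (rule derivative_eq_intros d refl | simp add: sc flip: S_def c_def | simp add: field_simps)+
    also have "\<kappa> / 2 * (((- S * ((\<kappa> - V s * (2 * S * c)) / 2)) * S - c * (c * ((\<kappa> - V s * (2 * S * c)) / 2))) / (S * S))
       = V s * (\<kappa> / 2 * (c / S)) - \<kappa>\<^sup>2 / 4 - (\<kappa> / 2 * (c / S))\<^sup>2"
    proof -
      have sc1: "S\<^sup>2 + c\<^sup>2 = 1" using c by simp
      have e1: "\<kappa> / 2 * (((- S * ((\<kappa> - V s * (2 * S * c)) / 2)) * S - c * (c * ((\<kappa> - V s * (2 * S * c)) / 2))) / (S * S))
          = - \<kappa> / 4 * (\<kappa> - V s * (2 * S * c)) * (S\<^sup>2 + c\<^sup>2) / S\<^sup>2"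
        using S by (simp add: field_simps power2_eq_square)
      have e2: "V s * (\<kappa> / 2 * (c / S)) - \<kappa>\<^sup>2 / 4 - (\<kappa> / 2 * (c / S))\<^sup>2
          = V s * (\<kappa> / 2 * (c / S)) - \<kappa>\<^sup>2 / 4 * (S\<^sup>2 + c\<^sup>2) / S\<^sup>2"
        using S by (simp add: field_simps power2_eq_square)
      show ?thesis unfolding e1 e2 sc1 using S by (simp add: field_simps power2_eq_square)
    qed
    finally show "(y has_real_derivative V s * y s - 1 / C - (y s)\<^sup>2) (at s)"
      by (simp add: y_def[abs_def] S_def c_def \<kappa>)
  next
    show "continuous_on {0<..L} y"
      unfolding y_def by (intro continuous_intros continuous_on_subset[OF \<psi>c]) (use sin_pos in force)+
    have "cos (\<psi> L / 2) \<ge> 0" using range[of L] L by (intro cos_ge_zero) auto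
    then show "y L \<ge> 0" using sin_pos[of L] L \<kappa>(1) by (auto simp: y_def)
    \<comment> \<open>Since \<open>\<psi>\<close> starts at 0 with speed \<kappa>, the function
      \<open>y\<close> behaves like \<open>1/s\<close> at 0, the singularity of a Dirichlet ground
      state.\<close>
    have "((\<lambda>s. sin (\<psi> s / 2)) has_real_derivative \<kappa> / 2) (at 0 within {0..L})"
      by (rule derivative_eq_intros \<psi> refl | use L \<psi>0 in simp)+
    then have "((\<lambda>s. sin (\<psi> s / 2) / s) \<longlongrightarrow> \<kappa> / 2) (at_right 0)"
      using L \<psi>0 by (simp add: has_field_derivative_iff at_within_Icc_at_right)
    moreover have "((\<lambda>s. cos (\<psi> s / 2)) \<longlongrightarrow> cos (0 / 2)) (at_right 0)"
    proof (intro tendsto_intros)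
      show "(\<psi> \<longlongrightarrow> 0) (at_right 0)"
        using \<psi>c L \<psi>0 by (metis at_within_Icc_at_right atLeastAtMost_iff continuous_on_def less_eq_real_def)
    qed simp
    ultimately have "((\<lambda>s. \<kappa> / 2 * (cos (\<psi> s / 2) / (sin (\<psi> s / 2) / s))) \<longlongrightarrow> \<kappa> / 2 * (cos (0 / 2) / (\<kappa> / 2))) (at_right 0)"
      using \<kappa> by (intro tendsto_mult[OF tendsto_const tendsto_divide]) auto
    moreover have "(\<lambda>s. \<kappa> / 2 * (cos (\<psi> s / 2) / (sin (\<psi> s / 2) / s))) = (\<lambda>s. s * y s)"
      by (auto simp: y_def fun_eq_iff)
    ultimately show "((\<lambda>s. s * y s) \<longlongrightarrow> 1) (at_right 0)" using \<kappa> by simp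
  qed (use \<rho>0 in \<open>auto intro: less_imp_le\<close>)
  then show ?thesis using C by (simp add: field_simps)
qed

section \<open>A one-dimensional Neumann problem\<close>

text \<open>The function \<open>r h(r)\<close> solves \<open>(\<rho> u)' = \<rho> g\<close>. Writing \<open>h = u/r\<close> keeps everything continuous at 0.\<close>

lemma neumann_dual:
  fixes \<phi> \<phi>' \<phi>'' g g' :: "real \<Rightarrow> real" and n :: nat
  assumes R: "0 < R" and n: "n \<ge> 1"
    and \<phi>: "\<And>r. r \<in> {0..R} \<Longrightarrow> (\<phi> has_real_derivative \<phi>' r) (at r within {0..R})"
    and \<phi>': "continuous_on {0..R} \<phi>'"
    and \<phi>'': "\<And>r. r \<in> {0<..<R} \<Longrightarrow> (\<phi>' has_real_derivative \<phi>'' r) (at r)" "\<And>r. r \<in> {0<..<R} \<Longrightarrow> \<phi>'' r \<ge> 0"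
    and g: "\<And>r. r \<in> {0..R} \<Longrightarrow> (g has_real_derivative g' r) (at r within {0..R})"
    and g': "continuous_on {0..R} g'"
    and mean: "integral {0..R} (\<lambda>r. g r * (r ^ n * exp (- \<phi> r))) = 0"
  obtains h u' where "continuous_on {0..R} h" "continuous_on {0..R} u'"
    "\<And>r. r \<in> {0..R} \<Longrightarrow> ((\<lambda>r. r * h r) has_real_derivative u' r) (at r within {0..R})"
    "integral {0..R} (\<lambda>r. (u' r)\<^sup>2 * (r ^ n * exp (- \<phi> r))) + n * integral {0..R} (\<lambda>r. (h r)\<^sup>2 * (r ^ n * exp (- \<phi> r)))
       \<le> integral {0..R} (\<lambda>r. (g r)\<^sup>2 * (r ^ n * exp (- \<phi> r)))"
    "integral {0..R} (\<lambda>r. (g r)\<^sup>2 * (r ^ n * exp (- \<phi> r)))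
       = - integral {0..R} (\<lambda>r. g' r * (r * h r) * (r ^ n * exp (- \<phi> r)))"
proof -
  define \<rho> where "\<rho> r = r ^ n * exp (- \<phi> r)" for r
  have gc: "continuous_on {0..R} g" and \<phi>c: "continuous_on {0..R} \<phi>"
    using g \<phi> by (meson DERIV_continuous continuous_on_eq_continuous_within)+
  have \<rho>c: "continuous_on {0..R} \<rho>" unfolding \<rho>_def by (intro continuous_intros \<phi>c)
  have at: "at r within {0..R} = at r" if "r \<in> {0<..<R}" for r
    using that by (intro at_within_Icc_at) auto
  have \<phi>_at: "(\<phi> has_real_derivative \<phi>' r) (at r)" if "r \<in> {0<..<R}" for r
    using \<phi>[of r] at[OF that] that by auto
  have g_at: "(g has_real_derivative g' r) (at r)" if "r \<in> {0<..<R}" for r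
    using g[of r] at[OF that] that by auto
  have lim: "(f \<longlongrightarrow> f 0) (at_right 0)" if "continuous_on {0..R} f" for f :: "real \<Rightarrow> real"
    using that R by (metis at_within_Icc_at_right atLeastAtMost_iff continuous_on_def less_eq_real_def)
  \<comment> \<open>\<open>N\<close> is the flux \<open>\<rho> u\<close>. It vanishes at 0 by
    construction and at \<open>R\<close> because \<open>g\<close> has mean zero, so later
    integrations by parts have no boundary terms.\<close>
  define N where "N r = integral {0..r} (\<lambda>r. g r * \<rho> r)" for r
  have Nd: "(N has_real_derivative g r * \<rho> r) (at r within {0..R})" if "r \<in> {0..R}" for r
    unfolding N_def using that by (intro integral_has_real_derivative continuous_intros gc \<rho>c)
  have N_at: "(N has_real_derivative g r * \<rho> r) (at r)" if "r \<in> {0<..<R}" for r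
    using Nd[of r] at[OF that] that by auto
  have Nc: "continuous_on {0..R} N"
    using Nd by (meson DERIV_continuous continuous_on_eq_continuous_within)
  have N0: "N 0 = 0" "N R = 0" using mean by (auto simp: N_def \<rho>_def)
  define Q where "Q r = r * \<rho> r" for r
  define Q' where "Q' r = \<rho> r * (1 + real n - r * \<phi>' r)" for r
  have n1: "r ^ (n - Suc 0) = r ^ n / r" if "r > 0" for r :: real
    using n that by (cases n) auto
  have \<rho>_at: "(\<rho> has_real_derivative \<rho> r * (n / r - \<phi>' r)) (at r)" if "r \<in> {0<..<R}" for r
    unfolding \<rho>_def using that
    by (auto intro!: derivative_eq_intros \<phi>_at simp: field_simps n1)
  have Q_at: "(Q has_real_derivative Q' r) (at r)" if "r \<in> {0<..<R}" for r
    unfolding Q_def Q'_def using that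
    by (auto intro!: derivative_eq_intros \<rho>_at simp: field_simps)
  have ev: "\<forall>\<^sub>F r in at_right 0. r \<in> {0<..<R}"
    using R eventually_at_right_less[of 0] eventually_at_right_field by (auto simp: eventually_at_right_field)
  have lim1: "((\<lambda>r. 1 + real n - r * \<phi>' r) \<longlongrightarrow> 1 + real n - 0 * \<phi>' 0) (at_right 0)"
    by (intro tendsto_intros lim[OF \<phi>'])
  have pos1: "\<forall>\<^sub>F r in at_right 0. 1 + real n - r * \<phi>' r > 0"
    using order_tendstoD(1)[OF lim1, of 0] by simp
  \<comment> \<open>Both \<open>N\<close> and \<open>Q = r \<rho>\<close> vanish at 0, and
    \<open>N'/Q' = g / (1 + n - r \<phi>')\<close>. The limit is the value given to \<open>h\<close>
    at 0.\<close>
  have hlim: "((\<lambda>r. N r / Q r) \<longlongrightarrow> g 0 / (1 + real n)) (at_right 0)"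
  proof (rule lhopital_right_0[where f' = "\<lambda>r. g r * \<rho> r" and g' = Q'])
    show "(N \<longlongrightarrow> 0) (at_right 0)" using lim[OF Nc] N0 by simp
    have "continuous_on {0..R} Q" unfolding Q_def by (intro continuous_intros \<rho>c)
    from lim[OF this] show "(Q \<longlongrightarrow> 0) (at_right 0)" by (simp add: Q_def)
    show "\<forall>\<^sub>F x in at_right 0. Q x \<noteq> 0"
      using ev by eventually_elim (auto simp: Q_def \<rho>_def)
    show "\<forall>\<^sub>F x in at_right 0. Q' x \<noteq> 0"
      using ev pos1 by eventually_elim (auto simp: Q'_def \<rho>_def)
    show "\<forall>\<^sub>F x in at_right 0. (N has_real_derivative g x * \<rho> x) (at x)"
      using ev by eventually_elim (rule N_at)
    show "\<forall>\<^sub>F x in at_right 0. (Q has_real_derivative Q' x) (at x)"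
      using ev by eventually_elim (rule Q_at)
    have "((\<lambda>r. g r / (1 + real n - r * \<phi>' r)) \<longlongrightarrow> g 0 / (1 + real n - 0 * \<phi>' 0)) (at_right 0)"
      by (intro tendsto_divide lim1 lim gc) auto
    moreover have "\<forall>\<^sub>F r in at_right 0. g r / (1 + real n - r * \<phi>' r) = g r * \<rho> r / Q' r"
      using ev pos1 by eventually_elim (auto simp: Q'_def \<rho>_def)
    ultimately show "((\<lambda>x. g x * \<rho> x / Q' x) \<longlongrightarrow> g 0 / (1 + real n)) (at_right 0)"
      by (simp add: filterlim_cong)
  qed
  define h where "h r = (if r = 0 then g 0 / (1 + real n) else N r / Q r)" for r
  have Nh: "N r = \<rho> r * (r * h r)" if "r \<in> {0..R}" for r
    using that N0 n by (auto simp: h_def Q_def \<rho>_def)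
  have hc: "continuous_on {0..R} h"
  proof (rule continuous_on_Icc_at_right)
    have "continuous_on {0<..R} (\<lambda>s. N s / Q s)"
      unfolding Q_def
      by (intro continuous_intros continuous_on_subset[OF Nc] continuous_on_subset[OF \<rho>c]) (auto simp: \<rho>_def)
    then show "continuous_on {0<..R} h"
      by (subst continuous_on_cong[OF refl]) (auto simp: h_def)
    have "\<forall>\<^sub>F r in at_right 0. N r / Q r = h r" by (auto simp: eventually_at_filter h_def)
    with hlim have "(h \<longlongrightarrow> g 0 / (1 + real n)) (at_right 0)" by (rule Lim_transform_eventually)
    then show "(h \<longlongrightarrow> h 0) (at_right 0)" by (simp add: h_def)
  qed (rule R)
  \<comment> \<open>Read off from \<open>(\<rho> u)' = \<rho> g\<close> with
    \<open>\<rho>'/\<rho> = n/r - \<phi>'\<close> and \<open>u = r h\<close>; in terms of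
    \<open>h\<close> no division by \<open>r\<close> remains.\<close>
  define u' where "u' r = g r - (n - r * \<phi>' r) * h r" for r
  have u'c: "continuous_on {0..R} u'" unfolding u'_def by (intro continuous_intros gc \<phi>' hc)
  have ud: "((\<lambda>r. r * h r) has_real_derivative u' r) (at r within {0..R})" if r: "r \<in> {0..R}" for r
  proof (cases "r = 0")
    case True
    have "(h \<longlongrightarrow> h 0) (at 0 within {0..R})" using hc R by (auto simp: continuous_on_def)
    \<comment> \<open>At 0 the derivative of \<open>r h(r)\<close> is \<open>h 0\<close>, and
      \<open>g 0 - n * h 0\<close> equals it because \<open>g 0 = (1 + n) * h 0\<close>.\<close>
    moreover have "u' 0 = h 0" using n by (simp add: u'_def h_def field_simps)
    ultimately have lim_h: "(h \<longlongrightarrow> u' 0) (at 0 within {0..R})" by simp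
    have "\<forall>\<^sub>F y in at 0 within {0..R}. h y = (y * h y - 0 * h 0) / (y - 0)"
      by (auto simp: eventually_at_filter)
    with lim_h have "((\<lambda>y. (y * h y - 0 * h 0) / (y - 0)) \<longlongrightarrow> u' 0) (at 0 within {0..R})"
      by (rule Lim_transform_eventually)
    then show ?thesis using True by (simp add: has_field_derivative_iff)
  next
    case False
    then have r0: "r > 0" "\<rho> r > 0" using r by (auto simp: \<rho>_def)
    have \<rho>d: "(\<rho> has_real_derivative \<rho> r * (n / r - \<phi>' r)) (at r within {0..R})"
      unfolding \<rho>_def using r0 r
      by (auto intro!: derivative_eq_intros \<phi> simp: field_simps n1)
    have "((\<lambda>r. N r / \<rho> r) has_real_derivative (g r * \<rho> r * \<rho> r - N r * (\<rho> r * (n / r - \<phi>' r))) / (\<rho> r * \<rho> r)) (at r within {0..R})"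
      using r0 by (intro DERIV_divide Nd \<rho>d r) auto
    also have "(g r * \<rho> r * \<rho> r - N r * (\<rho> r * (n / r - \<phi>' r))) / (\<rho> r * \<rho> r) = u' r"
    proof -
      have "(g r * \<rho> r * \<rho> r - \<rho> r * (r * h r) * (\<rho> r * (n / r - \<phi>' r))) / (\<rho> r * \<rho> r)
          = g r - r * h r * (n / r - \<phi>' r)"
        using r0 by (simp add: diff_divide_distrib)
      also have "\<dots> = u' r" using r0 by (simp add: u'_def algebra_simps)
      finally show ?thesis by (simp add: Nh[OF r])
    qed
    finally have "((\<lambda>r. N r / \<rho> r) has_real_derivative u' r) (at r within {0..R})" .
    then show ?thesis
    proof (rule has_field_derivative_transform_within[where d = r])
      fix x assume "x \<in> {0..R}" "dist x r < r"
      then have "x > 0" "x \<in> {0..R}" by (auto simp: dist_real_def)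
      then show "N x / \<rho> x = x * h x" using Nh[of x] by (auto simp: \<rho>_def)
    qed (use r r0 in auto)
  qed
  have u_at: "((\<lambda>r. r * h r) has_real_derivative u' r) (at r)" if "r \<in> {0<..<R}" for r
    using ud[of r] at[OF that] that by auto
  have hR: "h R = 0" using R N0 by (simp add: h_def)
  have h_at: "(h has_real_derivative (u' r - h r) / r) (at r)" if r: "r \<in> {0<..<R}" for r
  proof -
    have "((\<lambda>r. (r * h r) / r) has_real_derivative (u' r * r - (r * h r) * 1) / (r * r)) (at r)"
      using r by (intro DERIV_divide u_at DERIV_ident) auto
    also have "(u' r * r - (r * h r) * 1) / (r * r) = (u' r - h r) / r"
      using r by (simp add: divide_simps) (simp add: algebra_simps)
    finally have "((\<lambda>r. (r * h r) / r) has_real_derivative (u' r - h r) / r) (at r)" .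
    then show ?thesis
      by (rule has_field_derivative_transform_within_open[where S = "{0<..}"]) (use r in auto)
  qed
  have i1: "(\<lambda>r. (g r)\<^sup>2 * \<rho> r) integrable_on {0..R}"
    and i2: "(\<lambda>r. (u' r)\<^sup>2 * \<rho> r) integrable_on {0..R}"
    and i3: "(\<lambda>r. (h r)\<^sup>2 * \<rho> r) integrable_on {0..R}"
    and i4: "(\<lambda>r. g' r * (r * h r) * \<rho> r) integrable_on {0..R}"
    by (intro integrable_continuous_real continuous_intros gc u'c hc g' \<rho>c)+
  \<comment> \<open>Integration by parts of \<open>g N\<close>, with
    \<open>N' = g \<rho>\<close>.\<close>
  have "((\<lambda>r. g' r * (r * h r) * \<rho> r + (g r)\<^sup>2 * \<rho> r) has_integral (g R * N R - g 0 * N 0)) {0..R}"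
  proof (rule fundamental_theorem_of_calculus)
    fix r assume r: "r \<in> {0..R}"
    have "((\<lambda>r. g r * N r) has_real_derivative g' r * (r * h r) * \<rho> r + (g r)\<^sup>2 * \<rho> r) (at r within {0..R})"
      by (rule derivative_eq_intros g Nd r refl)+ (simp add: Nh[OF r] power2_eq_square)
    then show "((\<lambda>r. g r * N r) has_vector_derivative g' r * (r * h r) * \<rho> r + (g r)\<^sup>2 * \<rho> r) (at r within {0..R})"
      by (simp add: has_real_derivative_iff_has_vector_derivative)
  qed (use R in simp)
  then have "integral {0..R} (\<lambda>r. g' r * (r * h r) * \<rho> r + (g r)\<^sup>2 * \<rho> r) = 0"
    by (simp add: N0 integral_unique)
  then have second: "integral {0..R} (\<lambda>r. (g r)\<^sup>2 * \<rho> r) = - integral {0..R} (\<lambda>r. g' r * (r * h r) * \<rho> r)"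
    using i1 i4 by (simp add: integral_add)
  \<comment> \<open>This is \<open>\<rho> (n/r - \<phi>') u^2\<close>. Its derivative is the
    integrated Bochner identity: expanding \<open>g = u' + (n/r - \<phi>') u\<close> leaves
    \<open>u'^2\<close> and the curvature term \<open>(n/r^2 + \<phi>'') u^2\<close>, whose first
    part is \<open>n h^2\<close>. The boundary values vanish by the factor \<open>r\<close> at 0 and
    by \<open>h R = 0\<close>.\<close>
  define F where "F r = (\<rho> r * r) * (n - r * \<phi>' r) * (h r)\<^sup>2" for r
  define F' where "F' r = \<rho> r * ((g r)\<^sup>2 - (u' r)\<^sup>2 - n * (h r)\<^sup>2 - \<phi>'' r * (r * h r)\<^sup>2)" for r
  have "(F' has_integral (F R - F 0)) {0..R}"
  proof (rule fundamental_theorem_of_calculus_interior)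
    show "continuous_on {0..R} F" unfolding F_def by (intro continuous_intros \<rho>c \<phi>' hc)
    fix r assume r: "r \<in> {0<..<R}"
    note d = Q_at[OF r, unfolded Q_def] \<phi>''(1)[OF r] h_at[OF r]
    have "((\<lambda>r. (r * \<rho> r) * (n - r * \<phi>' r) * (h r)\<^sup>2) has_real_derivative
       Q' r * (n - r * \<phi>' r) * (h r)\<^sup>2 + (r * \<rho> r) * (- (\<phi>' r + r * \<phi>'' r)) * (h r)\<^sup>2
         + (r * \<rho> r) * (n - r * \<phi>' r) * (2 * h r * ((u' r - h r) / r))) (at r)"
      by (rule derivative_eq_intros d refl)+ (simp add: algebra_simps)
    also have "Q' r * (n - r * \<phi>' r) * (h r)\<^sup>2 + (r * \<rho> r) * (- (\<phi>' r + r * \<phi>'' r)) * (h r)\<^sup>2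
         + (r * \<rho> r) * (n - r * \<phi>' r) * (2 * h r * ((u' r - h r) / r))
       = Q' r * (n - r * \<phi>' r) * (h r)\<^sup>2 + (r * \<rho> r) * (- (\<phi>' r + r * \<phi>'' r)) * (h r)\<^sup>2
         + \<rho> r * (n - r * \<phi>' r) * (2 * h r * (u' r - h r))"
      using r by simp
    also have "\<dots> = F' r"
      unfolding Q'_def F'_def u'_def by (simp add: power2_eq_square algebra_simps)
    finally have "(F has_real_derivative F' r) (at r)" by (simp add: F_def[abs_def] mult_ac)
    then show "(F has_vector_derivative F' r) (at r)"
      by (simp add: has_real_derivative_iff_has_vector_derivative)
  qed (use R in simp)
  then have F': "(F' has_integral 0) {0..R}" by (simp add: F_def hR)
  \<comment> \<open>The sign of \<open>\<phi>''\<close> is known only in the open interval, so the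
    integrand is reset at both endpoints before comparing.\<close>
  have "((\<lambda>r. if r \<in> {0, R} then 0 else F' r) has_integral 0) {0..R}"
    by (rule has_integral_spike_finite[OF _ _ F', of "{0,R}"]) auto
  then have "0 = integral {0..R} (\<lambda>r. if r \<in> {0, R} then 0 else F' r)" by (simp add: integral_unique)
  also have "\<dots> \<le> integral {0..R} (\<lambda>r. if r \<in> {0, R} then 0 else (g r)\<^sup>2 * \<rho> r - ((u' r)\<^sup>2 * \<rho> r + n * ((h r)\<^sup>2 * \<rho> r)))"
  proof (rule integral_le)
    have "(\<lambda>r. (g r)\<^sup>2 * \<rho> r - ((u' r)\<^sup>2 * \<rho> r + n * ((h r)\<^sup>2 * \<rho> r))) integrable_on {0..R}"
      by (intro integrable_diff integrable_add integrable_on_mult_right i1 i2 i3)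
    then show "(\<lambda>r. if r \<in> {0, R} then 0 else (g r)\<^sup>2 * \<rho> r - ((u' r)\<^sup>2 * \<rho> r + n * ((h r)\<^sup>2 * \<rho> r))) integrable_on {0..R}"
      by (rule integrable_spike_finite[of "{0,R}", rotated 2]) auto
    show "(\<lambda>r. if r \<in> {0, R} then 0 else F' r) integrable_on {0..R}"
      using \<open>((\<lambda>r. if r \<in> {0, R} then 0 else F' r) has_integral 0) {0..R}\<close> by blast
    fix r assume r: "r \<in> {0..R}"
    show "(if r \<in> {0, R} then 0 else F' r) \<le> (if r \<in> {0, R} then 0 else (g r)\<^sup>2 * \<rho> r - ((u' r)\<^sup>2 * \<rho> r + n * ((h r)\<^sup>2 * \<rho> r)))"
    proof (cases "r \<in> {0, R}")
      case False
      then have r: "r \<in> {0<..<R}" using r by auto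
      have "0 \<le> \<rho> r * (\<phi>'' r * (r * h r)\<^sup>2)"
        using \<phi>''(2)[OF r] r by (intro mult_nonneg_nonneg) (auto simp: \<rho>_def)
      then show ?thesis using False by (simp add: F'_def algebra_simps)
    qed simp
  qed
  also have "\<dots> = integral {0..R} (\<lambda>r. (g r)\<^sup>2 * \<rho> r - ((u' r)\<^sup>2 * \<rho> r + n * ((h r)\<^sup>2 * \<rho> r)))"
    by (rule integral_spike[of "{0,R}"]) auto
  also have "\<dots> = integral {0..R} (\<lambda>r. (g r)\<^sup>2 * \<rho> r)
      - (integral {0..R} (\<lambda>r. (u' r)\<^sup>2 * \<rho> r) + n * integral {0..R} (\<lambda>r. (h r)\<^sup>2 * \<rho> r))"
    by (subst integral_diff integral_add; (intro i1 i2 i3 integrable_on_mult_right integrable_add)?)+ simp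
  finally have first: "integral {0..R} (\<lambda>r. (u' r)\<^sup>2 * \<rho> r) + n * integral {0..R} (\<lambda>r. (h r)\<^sup>2 * \<rho> r)
      \<le> integral {0..R} (\<lambda>r. (g r)\<^sup>2 * \<rho> r)" by simp
  show thesis
    by (rule that[OF hc u'c ud]) (use first second in \<open>simp_all add: \<rho>_def\<close>)
qed

text \<open>For an admissible constant \<open>C\<close> above the claimed value \<open>K\<close>, applying the inequality to the
  dual function \<open>u\<close> and the Cauchy--Schwarz inequality to its mean yields a smaller admissible
  constant; hence the least one is at most \<open>K\<close>.\<close>

lemma neumann_poincare:
  fixes \<phi> \<phi>' \<phi>'' :: "real \<Rightarrow> real" and n :: nat and R :: real
  defines "\<rho> \<equiv> \<lambda>r. r ^ n * exp (- \<phi> r)"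
  assumes R: "0 < R" and n: "n \<ge> 1"
    and \<phi>: "\<And>r. r \<in> {0..R} \<Longrightarrow> (\<phi> has_real_derivative \<phi>' r) (at r within {0..R})"
    and \<phi>': "continuous_on {0..R} \<phi>'"
    and \<phi>'': "\<And>r. r \<in> {0<..<R} \<Longrightarrow> (\<phi>' has_real_derivative \<phi>'' r) (at r)" "\<And>r. r \<in> {0<..<R} \<Longrightarrow> \<phi>'' r \<ge> 0"
    and f: "\<And>r. r \<in> {0..R} \<Longrightarrow> (f has_real_derivative f' r) (at r within {0..R})"
    and f': "continuous_on {0..R} f'"
  shows "integral {0..R} (\<lambda>r. (f r - integral {0..R} (\<lambda>r. f r * \<rho> r) / integral {0..R} \<rho>)\<^sup>2 * \<rho> r)
    \<le> integral {0..R} (\<lambda>r. r\<^sup>2 * \<rho> r) / (n * integral {0..R} \<rho>) * integral {0..R} (\<lambda>r. (f' r)\<^sup>2 * \<rho> r)"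
proof -
  define I where "I F = integral {0..R} (\<lambda>r. F r * \<rho> r)" for F
  define M where "M = integral {0..R} \<rho>"
  define K where "K = I power2 / (n * M)"
  have \<phi>c: "continuous_on {0..R} \<phi>"
    using \<phi> by (meson DERIV_continuous continuous_on_eq_continuous_within)
  have \<rho>c: "continuous_on {0..R} \<rho>" unfolding \<rho>_def by (intro continuous_intros \<phi>c)
  have \<rho>0: "\<rho> r \<ge> 0" if "r \<in> {0..R}" for r using that by (simp add: \<rho>_def)
  have int: "(\<lambda>r. F r * \<rho> r) integrable_on {0..R}" if "continuous_on {0..R} F" for F
    by (intro integrable_continuous_real continuous_intros that \<rho>c)
  have I_nonneg: "I F \<ge> 0" if "continuous_on {0..R} F" "\<And>r. r \<in> {0..R} \<Longrightarrow> F r \<ge> 0" for F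
    unfolding I_def using that \<rho>0 by (intro integral_nonneg int mult_nonneg_nonneg) auto
  have I_mono: "I F \<le> I G" if "continuous_on {0..R} F" "continuous_on {0..R} G" "\<And>r. r \<in> {0..R} \<Longrightarrow> F r \<le> G r" for F G
    unfolding I_def using that \<rho>0 by (intro integral_le int mult_right_mono) auto
  have I_add: "I (\<lambda>r. F r + G r) = I F + I G" if "continuous_on {0..R} F" "continuous_on {0..R} G" for F G
    unfolding I_def distrib_right using that by (intro integral_add int)
  have I_scale: "I (\<lambda>r. a * F r) = a * I F" for F a
    unfolding I_def by (simp add: mult.assoc)
  have I_const: "I (\<lambda>r. a) = a * M" for a
    unfolding I_def M_def by simp
  have I_lin: "I (\<lambda>r. F r + a * G r + b * H r) = I F + a * I G + b * I H"
    if "continuous_on {0..R} F" "continuous_on {0..R} G" "continuous_on {0..R} H" for F G H a b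
  proof -
    have "I (\<lambda>r. (F r + a * G r) + b * H r) = I (\<lambda>r. F r + a * G r) + I (\<lambda>r. b * H r)"
      using that by (intro I_add continuous_intros)
    moreover have "I (\<lambda>r. F r + a * G r) = I F + I (\<lambda>r. a * G r)"
      using that by (intro I_add continuous_intros)
    ultimately show ?thesis by (simp add: I_scale)
  qed
  have M: "M > 0"
  proof -
    have "M \<noteq> 0"
    proof
      assume "M = 0"
      then have "\<forall>r\<in>{0..R}. \<rho> r = 0" unfolding M_def
        using integral_eq_0_iff[OF \<rho>c] R \<rho>0 by auto
      from bspec[OF this, of "R/2"] show False using R by (simp add: \<rho>_def)
    qed
    moreover have "M \<ge> 0" unfolding M_def using \<rho>0 by (intro integral_nonneg integrable_continuous_real \<rho>c) auto
    ultimately show ?thesis by simp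
  qed
  have S: "I power2 > 0"
  proof -
    have "I power2 \<noteq> 0"
    proof
      assume "I power2 = 0"
      moreover have "continuous_on {0..R} (\<lambda>r. r\<^sup>2 * \<rho> r)" by (intro continuous_intros \<rho>c)
      ultimately have "\<forall>r\<in>{0..R}. r\<^sup>2 * \<rho> r = 0" unfolding I_def
        using integral_eq_0_iff[of 0 R "\<lambda>r. r\<^sup>2 * \<rho> r"] R \<rho>0 by auto
      from bspec[OF this, of "R/2"] show False using R by (simp add: \<rho>_def)
    qed
    moreover have "I power2 \<ge> 0" by (intro I_nonneg continuous_intros) auto
    ultimately show ?thesis by simp
  qed
  have K: "K > 0" using S M n by (simp add: K_def)
  define C1 where "C1 f f' \<longleftrightarrow> (\<forall>r\<in>{0..R}. (f has_real_derivative f' r) (at r within {0..R})) \<and> continuous_on {0..R} f'" for f f'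
  have C1c: "continuous_on {0..R} f" if "C1 f f'" for f f'
    using that unfolding C1_def by (meson DERIV_continuous continuous_on_eq_continuous_within)
  define adm where "adm C \<longleftrightarrow> (\<forall>f f'. C1 f f' \<longrightarrow> I (\<lambda>r. (f r - I f / M)\<^sup>2) \<le> C * I (\<lambda>r. (f' r)\<^sup>2))" for C
  have variance: "I (\<lambda>r. (F r - I F / M)\<^sup>2) = I (\<lambda>r. (F r)\<^sup>2) - (I F)\<^sup>2 / M" if F: "continuous_on {0..R} F" for F
  proof -
    have "I (\<lambda>r. (F r - I F / M)\<^sup>2) = I (\<lambda>r. (F r)\<^sup>2 + (- 2 * (I F / M)) * F r + (I F / M)\<^sup>2 * 1)"
      by (simp add: power2_diff algebra_simps)
    also have "\<dots> = I (\<lambda>r. (F r)\<^sup>2) + (- 2 * (I F / M)) * I F + (I F / M)\<^sup>2 * I (\<lambda>r. 1)"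
      using F by (intro I_lin continuous_intros)
    also have "I (\<lambda>r. 1) = M" using I_const[of 1] by simp
    finally show ?thesis using M by (simp add: field_simps power2_eq_square)
  qed
  \<comment> \<open>Duality: since \<open>I (g^2) = - I (f' u)\<close>, a bound
    \<open>I (u^2) <= X * I (g^2)\<close> on the dual functions yields the constant \<open>X\<close>
    by Young's inequality with weight \<open>X\<close>, half of \<open>I (g^2)\<close> being
    absorbed. The estimate may use only the energy bound of \<open>neumann_dual\<close>, whence the
    quantification over \<open>G\<close>.\<close>
  have dual: "adm X" if X: "X > 0"
    and bound: "\<And>h u' G. continuous_on {0..R} h \<Longrightarrow> C1 (\<lambda>r. r * h r) u' \<Longrightarrow>
        I (\<lambda>r. (u' r)\<^sup>2) + n * I (\<lambda>r. (h r)\<^sup>2) \<le> G \<Longrightarrow> I (\<lambda>r. (r * h r)\<^sup>2) \<le> X * G" for X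
    unfolding adm_def
  proof (intro allI impI)
    fix f f' assume f: "C1 f f'"
    define g where "g r = f r - I f / M" for r
    have fc: "continuous_on {0..R} f" using C1c[OF f] .
    have g: "(g has_real_derivative f' r) (at r within {0..R})" if "r \<in> {0..R}" for r
      using f that unfolding g_def C1_def by (auto intro!: derivative_eq_intros)
    have f'c: "continuous_on {0..R} f'" using f by (simp add: C1_def)
    have "I g = I (\<lambda>r. f r + - (I f / M))" by (simp add: g_def[abs_def])
    also have "\<dots> = 0" using fc M by (subst I_add) (auto simp: I_const simp del: add_uminus_conv_diff)
    finally have mean: "I g = 0" .
    obtain h u' where h: "continuous_on {0..R} h" "continuous_on {0..R} u'"
      "\<And>r. r \<in> {0..R} \<Longrightarrow> ((\<lambda>r. r * h r) has_real_derivative u' r) (at r within {0..R})"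
      "I (\<lambda>r. (u' r)\<^sup>2) + n * I (\<lambda>r. (h r)\<^sup>2) \<le> I (\<lambda>r. (g r)\<^sup>2)"
      "I (\<lambda>r. (g r)\<^sup>2) = - I (\<lambda>r. f' r * (r * h r))"
      using neumann_dual[OF R n \<phi> \<phi>' \<phi>'' g f'c] mean unfolding I_def \<rho>_def by blast
    have "I (\<lambda>r. (r * h r)\<^sup>2) \<le> X * I (\<lambda>r. (g r)\<^sup>2)"
      by (rule bound[OF h(1) _ h(4)]) (use h in \<open>auto simp: C1_def\<close>)
    have "I (\<lambda>r. (g r)\<^sup>2) = I (\<lambda>r. - 1 * (f' r * (r * h r)))"
      using h(5) by (subst I_scale) simp
    also have "\<dots> \<le> I (\<lambda>r. X / 2 * (f' r)\<^sup>2 + 1 / (2 * X) * (r * h r)\<^sup>2)"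
    proof (rule I_mono)
      fix r
      have "0 \<le> (X * f' r + r * h r)\<^sup>2 / (2 * X)" using X by simp
      also have "\<dots> = X / 2 * (f' r)\<^sup>2 + 1 / (2 * X) * (r * h r)\<^sup>2 + f' r * (r * h r)"
        using X by (simp add: field_simps power2_eq_square)
      finally show "- 1 * (f' r * (r * h r)) \<le> X / 2 * (f' r)\<^sup>2 + 1 / (2 * X) * (r * h r)\<^sup>2" by simp
    qed (intro continuous_intros f'c h)+
    also have "\<dots> = X / 2 * I (\<lambda>r. (f' r)\<^sup>2) + 1 / (2 * X) * I (\<lambda>r. (r * h r)\<^sup>2)"
      by (subst I_add; (intro continuous_intros f'c h)?) (simp only: I_scale)
    also have "1 / (2 * X) * I (\<lambda>r. (r * h r)\<^sup>2) \<le> 1 / (2 * X) * (X * I (\<lambda>r. (g r)\<^sup>2))"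
      using X \<open>I (\<lambda>r. (r * h r)\<^sup>2) \<le> _\<close> by (intro mult_left_mono) auto
    finally have "I (\<lambda>r. (g r)\<^sup>2) \<le> X * I (\<lambda>r. (f' r)\<^sup>2)" using X by simp
    then show "I (\<lambda>r. (f r - I f / M)\<^sup>2) \<le> X * I (\<lambda>r. (f' r)\<^sup>2)" by (simp add: g_def)
  qed
  have hR: "I (\<lambda>r. (r * h r)\<^sup>2) \<le> R\<^sup>2 * I (\<lambda>r. (h r)\<^sup>2)" if "continuous_on {0..R} h" for h
    unfolding I_scale[symmetric] power_mult_distrib
    by (intro I_mono continuous_intros that mult_right_mono power_mono) auto
  \<comment> \<open>The crude constant from \<open>r <= R\<close>; it is needed only to have some
    admissible constant to improve.\<close>
  have base: "adm (R\<^sup>2 / n)"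
  proof (rule dual)
    fix h u' G assume h: "continuous_on {0..R} h" "C1 (\<lambda>r. r * h r) u'"
      and G: "I (\<lambda>r. (u' r)\<^sup>2) + n * I (\<lambda>r. (h r)\<^sup>2) \<le> G"
    have "0 \<le> I (\<lambda>r. (u' r)\<^sup>2)" using h by (intro I_nonneg continuous_intros) (auto simp: C1_def)
    then have "I (\<lambda>r. (h r)\<^sup>2) \<le> G / n" using G n by (simp add: field_simps)
    then have "R\<^sup>2 * I (\<lambda>r. (h r)\<^sup>2) \<le> R\<^sup>2 * (G / n)" by (intro mult_left_mono) auto
    then show "I (\<lambda>r. (r * h r)\<^sup>2) \<le> R\<^sup>2 / n * G" using hR[OF h(1)] by simp
  qed (use R n in simp)
  \<comment> \<open>In \<open>step\<close>, the energy bound is used with factor \<open>C\<close>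
    while the mean consumes only \<open>K\<close>. The surplus \<open>(C - K) n I (h^2)\<close>
    dominates \<open>\<delta> C\<close> times \<open>I ((r h)^2)\<close>, again by
    \<open>r <= R\<close>, and so improves \<open>C\<close>.\<close>
  define \<delta> where "\<delta> C = (C - K) * n / R\<^sup>2" for C
  have step: "adm (C / (1 + \<delta> C))" if C: "adm C" "C > K" for C
  proof (rule dual)
    have \<delta>: "\<delta> C > 0" using C R n by (simp add: \<delta>_def)
    show "C / (1 + \<delta> C) > 0" using \<delta> C K by simp
    fix h u' G assume h: "continuous_on {0..R} h" "C1 (\<lambda>r. r * h r) u'"
      and G: "I (\<lambda>r. (u' r)\<^sup>2) + n * I (\<lambda>r. (h r)\<^sup>2) \<le> G"
    let ?A = "I (\<lambda>r. (r * h r)\<^sup>2)" and ?H = "I (\<lambda>r. (h r)\<^sup>2)" and ?D = "I (\<lambda>r. (u' r)\<^sup>2)" and ?m = "I (\<lambda>r. r * h r)"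
    let ?S = "I power2"
    have "?A - ?m\<^sup>2 / M \<le> C * ?D"
      using C(1) h by (subst variance[symmetric]) (auto intro!: continuous_intros simp: adm_def)
    \<comment> \<open>Cauchy-Schwarz for the mean of \<open>u = r h\<close>, pairing
      \<open>r\<close> with \<open>h\<close>; it is what brings in the second moment.\<close>
    moreover have "?m\<^sup>2 \<le> ?S * ?H"
    proof -
      have "0 \<le> I (\<lambda>r. (h r - ?m / ?S * r)\<^sup>2)" using h by (intro I_nonneg continuous_intros) auto
      also have "I (\<lambda>r. (h r - ?m / ?S * r)\<^sup>2) = I (\<lambda>r. (h r)\<^sup>2 + (- 2 * (?m / ?S)) * (r * h r) + (?m / ?S)\<^sup>2 * r\<^sup>2)"
        by (simp add: power2_diff power_mult_distrib power_divide algebra_simps)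
      also have "\<dots> = ?H + (- 2 * (?m / ?S)) * ?m + (?m / ?S)\<^sup>2 * ?S"
        using h by (intro I_lin continuous_intros)
      also have "\<dots> = ?H - ?m\<^sup>2 / ?S" using S by (simp add: field_simps power2_eq_square)
      finally show ?thesis using S by (simp add: field_simps)
    qed
    then have "?m\<^sup>2 / M \<le> K * (n * ?H)" using M n by (simp add: K_def field_simps)
    moreover have "C * ?D + C * (n * ?H) \<le> C * G"
      using mult_left_mono[OF G, of C] C K by (simp add: algebra_simps)
    moreover have "\<delta> C * ?A \<le> \<delta> C * (R\<^sup>2 * ?H)" using \<delta> hR[OF h(1)] by (intro mult_left_mono) auto
    moreover have "\<delta> C * (R\<^sup>2 * ?H) = (C - K) * (n * ?H)" using R by (simp add: \<delta>_def)
    ultimately have "?A * (1 + \<delta> C) \<le> C * G" by (simp add: algebra_simps)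
    then show "?A \<le> C / (1 + \<delta> C) * G" using \<delta> by (simp add: field_simps)
  qed
  define C\<^sub>0 where "C\<^sub>0 = Inf {C. 0 < C \<and> adm C}"
  have ne: "R\<^sup>2 / n \<in> {C. 0 < C \<and> adm C}" using base R n by simp
  \<comment> \<open>Each single inequality passes to the infimum. When the energy \<open>b\<close>
    is 0, dividing is impossible, and any admissible constant already gives
    \<open>a <= 0\<close>.\<close>
  have C\<^sub>0: "adm C\<^sub>0"
    unfolding adm_def
  proof (intro allI impI)
    fix f f' assume f: "C1 f f'"
    define a b where "a = I (\<lambda>r. (f r - I f / M)\<^sup>2)" and "b = I (\<lambda>r. (f' r)\<^sup>2)"
    have b: "b \<ge> 0" unfolding b_def using f by (intro I_nonneg continuous_intros) (auto simp: C1_def)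
    have ab: "a \<le> C * b" if "adm C" for C using that f by (auto simp: adm_def a_def b_def)
    have "a \<le> C\<^sub>0 * b"
    proof (cases "b = 0")
      case False
      then have "a / b \<le> C\<^sub>0" unfolding C\<^sub>0_def using ne b ab
        by (intro cInf_greatest) (auto simp: field_simps)
      then show ?thesis using False b by (simp add: field_simps)
    qed (use ab[OF base] in simp)
    then show "I (\<lambda>r. (f r - I f / M)\<^sup>2) \<le> C\<^sub>0 * I (\<lambda>r. (f' r)\<^sup>2)" by (simp add: a_def b_def)
  qed
  have "C\<^sub>0 \<le> K"
  proof (rule ccontr)
    assume "\<not> C\<^sub>0 \<le> K"
    then have *: "C\<^sub>0 > K" by simp
    then have \<delta>: "\<delta> C\<^sub>0 > 0" using R n by (simp add: \<delta>_def)
    have "C\<^sub>0 \<le> C\<^sub>0 / (1 + \<delta> C\<^sub>0)"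
      unfolding C\<^sub>0_def using step[OF C\<^sub>0 *] * K \<delta>
      by (intro cInf_lower bdd_belowI[of _ 0]) (auto simp flip: C\<^sub>0_def)
    moreover have "0 < C\<^sub>0 * \<delta> C\<^sub>0" using \<delta> * K by (intro mult_pos_pos) auto
    ultimately show False using \<delta> by (simp add: field_simps)
  qed
  moreover have f: "C1 f f'" using f f' by (simp add: C1_def)
  moreover have "0 \<le> I (\<lambda>r. (f' r)\<^sup>2)" using f by (intro I_nonneg continuous_intros) (auto simp: C1_def)
  ultimately have "I (\<lambda>r. (f r - I f / M)\<^sup>2) \<le> K * I (\<lambda>r. (f' r)\<^sup>2)"
    using C\<^sub>0 unfolding adm_def by (meson mult_right_mono order_trans)
  then show ?thesis by (simp add: I_def M_def K_def)
qed

section \<open>Polar coordinates\<close>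

text \<open>The surface measure of the unit sphere, without charts: a set of directions is measured
  by the volume of the cone over it in the unit ball. The factor \<open>d\<close> cancels the
  integral \<open>1/d\<close> of \<open>r^(d-1)\<close> over \<open>[0,1]\<close>. In dimension one
  it is counting measure on 1 and -1.\<close>

definition cone_measure :: "'a::euclidean_space measure" where
  "cone_measure = distr (density lborel (\<lambda>x. ennreal DIM('a) * indicator (cball 0 1) x)) borel sgn"

lemma borel_measurable_sgn [measurable]:
  "sgn \<in> borel_measurable (borel :: 'a::euclidean_space measure)"
  unfolding sgn_div_norm[abs_def] by measurable

lemma cball_in_borel [measurable]: "cball (0 :: 'a::euclidean_space) r \<in> sets borel"
  by simp

lemma sets_cone_measure [measurable_cong, simp]: "sets cone_measure = sets borel"
  and space_cone_measure [simp]: "space cone_measure = UNIV"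
  by (simp_all add: cone_measure_def)

lemma emeasure_cone_measure:
  assumes [measurable]: "B \<in> sets borel"
  shows "emeasure (cone_measure :: 'a::euclidean_space measure) B
    = ennreal DIM('a) * emeasure lborel {x \<in> cball 0 1. sgn x \<in> B}"
proof -
  have sB [measurable]: "sgn -` B \<in> sets (borel :: 'a measure)"
    using measurable_sets_borel[OF borel_measurable_sgn assms] .
  have m: "(\<lambda>x :: 'a. ennreal DIM('a) * indicator (cball 0 1) x) \<in> borel_measurable lborel" by measurable
  have "emeasure (cone_measure :: 'a measure) B
      = (\<integral>\<^sup>+ x. ennreal DIM('a) * indicator (cball 0 1) x * indicator (sgn -` B) x \<partial>lborel)"
    by (simp add: cone_measure_def emeasure_distr emeasure_density[OF m] sB assms)
  also have "\<dots> = (\<integral>\<^sup>+ x. ennreal DIM('a) * indicator {x \<in> cball 0 1. sgn x \<in> B} x \<partial>lborel)"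
    by (intro nn_integral_cong) (auto split: split_indicator)
  finally show ?thesis by (simp add: nn_integral_cmult)
qed

lemma finite_cone_measure: "finite_measure (cone_measure :: 'a::euclidean_space measure)"
proof
  have "emeasure lborel {x :: 'a. x \<in> cball 0 1 \<and> sgn x \<in> UNIV} \<noteq> \<infinity>"
    using emeasure_lborel_cball_finite[of "0 :: 'a" 1] by (simp add: cball_def)
  then show "emeasure (cone_measure :: 'a measure) (space cone_measure) \<noteq> \<infinity>"
    by (simp add: emeasure_cone_measure ennreal_mult_eq_top_iff)
qed

lemma AE_cone_measure_norm: "AE \<theta> in (cone_measure :: 'a::euclidean_space measure). norm \<theta> = 1"
proof (rule AE_I)
  let ?N = "{\<theta> :: 'a. norm \<theta> \<noteq> 1}"
  show [measurable]: "?N \<in> sets cone_measure" by simp measurable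
  have "{x :: 'a. x \<in> cball 0 1 \<and> sgn x \<in> ?N} = {0}"
    by (auto simp: norm_sgn)
  then show "emeasure cone_measure ?N = 0"
    by (subst emeasure_cone_measure) (simp_all only: sets_cone_measure, simp_all)
qed auto

lemma emeasure_lborel_scale:
  fixes X :: "'a::euclidean_space set"
  assumes t: "t > 0" and [measurable]: "X \<in> sets borel"
  shows "emeasure lborel X = ennreal (t ^ DIM('a)) * emeasure lborel ((\<lambda>x. t *\<^sub>R x) -` X)"
proof -
  have "emeasure lborel X = emeasure (density (distr lborel borel (\<lambda>x. 0 + t *\<^sub>R x)) (\<lambda>_. \<bar>t\<bar> ^ DIM('a))) X"
    using t by (subst lborel_affine[of t 0]) auto
  also have "\<dots> = ennreal (t ^ DIM('a)) * emeasure (distr lborel borel (\<lambda>x. t *\<^sub>R x)) X"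
    using t by (simp add: emeasure_density nn_integral_cmult)
  also have "emeasure (distr lborel borel (\<lambda>x. t *\<^sub>R x)) X = emeasure lborel ((\<lambda>x. t *\<^sub>R x) -` X)"
    by (subst emeasure_distr) auto
  finally show ?thesis .
qed

text \<open>The image of Lebesgue measure under \<open>x \<mapsto> (sgn x, norm x)\<close> is a
  product, because Lebesgue measure of a cone scales like \<open>t^d\<close>. The point 0 does no
  harm, since \<open>norm 0 *\<^sub>R sgn 0 = 0\<close>.\<close>

lemma nn_integral_polar:
  fixes F :: "'a::euclidean_space \<Rightarrow> ennreal"
  assumes [measurable]: "F \<in> borel_measurable borel"
  shows "(\<integral>\<^sup>+ x. F x \<partial>lborel)
    = (\<integral>\<^sup>+ \<theta>. (\<integral>\<^sup>+ r. ennreal (r ^ (DIM('a) - 1)) * indicator {0..} r * F (r *\<^sub>R \<theta>) \<partial>lborel) \<partial>cone_measure)"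
proof -
  let ?d = "DIM('a)"
  define w :: "real \<Rightarrow> ennreal" where "w r = ennreal (r ^ (?d - 1)) * indicator {0..} r" for r
  have [measurable]: "w \<in> borel_measurable borel" unfolding w_def by measurable
  define D where "D = density lborel w"
  have sD: "sets D = sets borel" by (simp add: D_def)
  interpret C: finite_measure "cone_measure :: 'a measure" by (rule finite_cone_measure)
  interpret D: sigma_finite_measure D
    unfolding D_def by (subst sigma_finite_measure.sigma_finite_iff_density_finite[OF sigma_finite_lborel]) (auto simp: w_def ennreal_mult_eq_top_iff split: split_indicator)
  have w_int: "emeasure D {..t} = ennreal (t ^ ?d / ?d)" if "t \<ge> 0" for t
  proof -
    have "emeasure D {..t} = (\<integral>\<^sup>+ r. ennreal (r ^ (?d - 1)) * indicator {0..t} r \<partial>lborel)"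
      unfolding D_def by (subst emeasure_density) (auto intro!: nn_integral_cong simp: w_def split: split_indicator)
    also have "\<dots> = ennreal (t ^ ?d / ?d - 0 ^ ?d / ?d)"
      using that by (intro nn_integral_FTC_Icc) (auto intro!: derivative_eq_intros)
    finally show ?thesis by (simp add: power_0_left)
  qed
  have "cone_measure \<Otimes>\<^sub>M D = distr lborel (borel \<Otimes>\<^sub>M borel) (\<lambda>x :: 'a. (sgn x, norm x))"
  proof (rule pair_measure_eqI)
    show "sigma_finite_measure (cone_measure :: 'a measure)" by (rule C.sigma_finite_measure_axioms)
    show "sigma_finite_measure D" by (rule D.sigma_finite_measure_axioms)
    show "sets (cone_measure \<Otimes>\<^sub>M D) = sets (distr lborel (borel \<Otimes>\<^sub>M borel) (\<lambda>x :: 'a. (sgn x, norm x)))"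
      using sD by (simp cong: sets_pair_measure_cong)
    fix B :: "'a set" and A :: "real set"
    assume "B \<in> sets cone_measure" "A \<in> sets D"
    then have [measurable]: "B \<in> sets borel" "A \<in> sets borel" using sD by auto
    let ?L = "density D (\<lambda>_. emeasure cone_measure B)"
    let ?R = "distr (density lborel (indicator (sgn -` B))) borel (norm :: 'a \<Rightarrow> real)"
    have sB [measurable]: "sgn -` B \<in> sets (borel :: 'a measure)"
      using measurable_sets_borel[OF borel_measurable_sgn \<open>B \<in> sets borel\<close>] .
    have R: "emeasure ?R X = emeasure lborel {x. sgn x \<in> B \<and> norm x \<in> X}" if [measurable]: "X \<in> sets borel" for X
    proof -
      have nX: "norm -` X \<in> sets (borel :: 'a measure)"
        using measurable_sets_borel[OF borel_measurable_continuous_onI[OF continuous_on_norm_id] that] .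
      have m: "(indicator (sgn -` B) :: 'a \<Rightarrow> ennreal) \<in> borel_measurable lborel" by measurable
      have "emeasure ?R X = (\<integral>\<^sup>+ x. indicator (sgn -` B) x * indicator (norm -` X) x \<partial>lborel)"
        by (simp add: emeasure_distr emeasure_density[OF m] nX)
      also have "\<dots> = (\<integral>\<^sup>+ x. indicator {x. sgn x \<in> B \<and> norm x \<in> X} x \<partial>lborel)"
        by (intro nn_integral_cong) (auto split: split_indicator)
      finally show ?thesis by simp
    qed
    have L: "emeasure ?L X = emeasure cone_measure B * emeasure D X" if "X \<in> sets borel" for X
      using that sD by (simp add: emeasure_density nn_integral_cmult)
    \<comment> \<open>For a fixed set \<open>B\<close> of directions, two measures of the radius are
      compared on the half-lines \<open>{..t}\<close>, which generate the Borel sets and have finite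
      measure.\<close>
    have "?L = ?R"
    proof (rule measure_eqI_generator_eq[where E = "range atMost" and \<Omega> = UNIV and A = "\<lambda>i. {..real i}"])
      show "Int_stable (range atMost :: real set set)"
      proof -
        have "{..a} \<inter> {..b} = {..min a b}" for a b :: real by auto
        then show ?thesis by (auto simp: Int_stable_def)
      qed
      show "sets ?L = sigma_sets UNIV (range atMost)" "sets ?R = sigma_sets UNIV (range atMost)"
        using sD by (simp_all add: borel_eq_atMost)
      show "(\<Union>i. {..real i}) = UNIV" using real_arch_simple by auto
      show "emeasure ?L {..real i} \<noteq> \<infinity>" for i
        by (subst L) (auto simp: w_int ennreal_mult_eq_top_iff)
      fix X :: "real set" assume "X \<in> range atMost"
      then obtain t where X: "X = {..t}" by auto
      show "emeasure ?L X = emeasure ?R X"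
      proof (cases "t > 0")
        case True
        \<comment> \<open>The truncated cone of radius \<open>t\<close> is the
          \<open>t\<close>-dilate of the one in the unit ball.\<close>
        have "emeasure lborel {x. sgn x \<in> B \<and> norm x \<le> t}
            = ennreal (t ^ ?d) * emeasure lborel ((\<lambda>x. t *\<^sub>R x) -` {x. sgn x \<in> B \<and> norm x \<le> t})"
          using True by (intro emeasure_lborel_scale) auto
        also have "(\<lambda>x. t *\<^sub>R x) -` {x. sgn x \<in> B \<and> norm x \<le> t} = {x \<in> cball 0 1. sgn x \<in> B}"
          using True by (auto simp: sgn_scaleR)
        finally have "emeasure ?R X = ennreal (t ^ ?d) * emeasure lborel {x \<in> cball 0 1. sgn x \<in> B}"
          by (simp add: X R)
        moreover have "emeasure ?L X = emeasure cone_measure B * ennreal (t ^ ?d / ?d)"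
          using True unfolding X by (subst L) (simp_all add: w_int)
        moreover have "emeasure cone_measure B * ennreal (t ^ ?d / ?d)
            = (ennreal ?d * ennreal (t ^ ?d / ?d)) * emeasure lborel {x \<in> cball 0 1. sgn x \<in> B}"
          by (subst emeasure_cone_measure) (simp_all only: mult_ac \<open>B \<in> sets borel\<close>)
        moreover have "ennreal ?d * ennreal (t ^ ?d / ?d) = ennreal (t ^ ?d)"
          by (subst ennreal_mult'[symmetric]) simp_all
        ultimately show ?thesis by (simp only:)
      next
        case False
        have "emeasure D X \<le> emeasure D {..0}" using False sD by (intro emeasure_mono) (auto simp: X)
        then have "emeasure D X = 0" by (simp add: w_int power_0_left)
        moreover have "emeasure lborel {x :: 'a. sgn x \<in> B \<and> norm x \<in> X} \<le> emeasure lborel {0 :: 'a}"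
          using False by (intro emeasure_mono) (auto simp: X simp flip: norm_le_zero_iff)
        ultimately show ?thesis by (simp add: L R X)
      qed
    qed auto
    then have "emeasure ?L A = emeasure ?R A" by simp
    also have "\<dots> = emeasure lborel {x. sgn x \<in> B \<and> norm x \<in> A}"
      by (rule R) simp
    also have "{x. sgn x \<in> B \<and> norm x \<in> A} = (\<lambda>x :: 'a. (sgn x, norm x)) -` (B \<times> A)"
      by auto
    finally show "emeasure cone_measure B * emeasure D A
        = emeasure (distr lborel (borel \<Otimes>\<^sub>M borel) (\<lambda>x :: 'a. (sgn x, norm x))) (B \<times> A)"
      by (subst emeasure_distr) (simp_all add: L)
  qed
  then have "(\<integral>\<^sup>+ (\<theta>, r). F (r *\<^sub>R \<theta>) \<partial>(cone_measure \<Otimes>\<^sub>M D)) = (\<integral>\<^sup>+ x. F (norm x *\<^sub>R sgn x) \<partial>lborel)"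
    by (simp add: nn_integral_distr)
  also have "\<dots> = (\<integral>\<^sup>+ x. F x \<partial>lborel)"
  proof (intro nn_integral_cong)
    show "F (norm x *\<^sub>R sgn x) = F x" for x by (cases "x = 0") (simp_all add: sgn_div_norm)
  qed
  finally have polar: "(\<integral>\<^sup>+ (\<theta>, r). F (r *\<^sub>R \<theta>) \<partial>(cone_measure \<Otimes>\<^sub>M D)) = (\<integral>\<^sup>+ x. F x \<partial>lborel)" .
  have "sets (cone_measure \<Otimes>\<^sub>M D) = sets ((borel :: 'a measure) \<Otimes>\<^sub>M borel)"
    by (intro sets_pair_measure_cong sD sets_cone_measure)
  then have "(\<lambda>(\<theta>, r). F (r *\<^sub>R \<theta>)) \<in> borel_measurable (cone_measure \<Otimes>\<^sub>M D)"
    by (subst measurable_cong_sets[OF _ refl]) measurable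
  from D.nn_integral_fst[OF this] polar
  have "(\<integral>\<^sup>+ x. F x \<partial>lborel) = (\<integral>\<^sup>+ \<theta>. \<integral>\<^sup>+ r. F (r *\<^sub>R \<theta>) \<partial>D \<partial>cone_measure)" by simp
  then show ?thesis by (simp add: D_def nn_integral_density w_def)
qed

section \<open>Tensorization of the variance\<close>

text \<open>Twice the variance, in a form that needs no integrability.\<close>

definition pvar :: "'a measure \<Rightarrow> ('a \<Rightarrow> real) \<Rightarrow> ennreal" where
  "pvar M F = (\<integral>\<^sup>+ x. \<integral>\<^sup>+ y. ennreal ((F x - F y)\<^sup>2) \<partial>M \<partial>M)"

text \<open>Pointwise this is the quadrilateral inequality: the squared diagonals do not exceed the squared
  sides.\<close>

lemma pvar_pair_measure:
  assumes "prob_space M" "prob_space N" and F [measurable]: "F \<in> borel_measurable (M \<Otimes>\<^sub>M N)"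
  shows "pvar (M \<Otimes>\<^sub>M N) F
    \<le> (\<integral>\<^sup>+ y. pvar M (\<lambda>x. F (x, y)) \<partial>N) + (\<integral>\<^sup>+ x. pvar N (\<lambda>y. F (x, y)) \<partial>M)"
proof -
  interpret M: prob_space M by fact
  interpret N: prob_space N by fact
  interpret MN: pair_sigma_finite M N ..
  interpret MM: pair_sigma_finite M M ..
  define G where "G x x' = (\<integral>\<^sup>+ y. \<integral>\<^sup>+ y'. ennreal ((F (x, y) - F (x', y'))\<^sup>2) \<partial>N \<partial>N)" for x x'
  have mG [measurable]: "(\<lambda>(x, x'). G x x') \<in> borel_measurable (M \<Otimes>\<^sub>M M)"
    unfolding G_def by measurable
  have mG': "(\<lambda>(x, x'). G x' x) \<in> borel_measurable (M \<Otimes>\<^sub>M M)"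
    unfolding G_def by measurable
  have m1: "(\<lambda>x. \<integral>\<^sup>+ x'. G x x' \<partial>M) \<in> borel_measurable M"
    and m2: "(\<lambda>x. \<integral>\<^sup>+ x'. G x' x \<partial>M) \<in> borel_measurable M"
    using M.borel_measurable_nn_integral[OF mG] M.borel_measurable_nn_integral[OF mG'] by simp_all
  have m3: "(\<lambda>x'. G x x') \<in> borel_measurable M" and m4: "(\<lambda>x'. G x' x) \<in> borel_measurable M"
    if [measurable]: "x \<in> space M" for x
    unfolding G_def by measurable
  define A where "A = (\<integral>\<^sup>+ x. \<integral>\<^sup>+ x'. G x x' \<partial>M \<partial>M)"
  have "pvar (M \<Otimes>\<^sub>M N) F = (\<integral>\<^sup>+ x. \<integral>\<^sup>+ y. \<integral>\<^sup>+ x'. \<integral>\<^sup>+ y'. ennreal ((F (x, y) - F (x', y'))\<^sup>2) \<partial>N \<partial>M \<partial>N \<partial>M)"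
    unfolding pvar_def by (subst N.nn_integral_fst[symmetric], measurable)+
  also have "\<dots> = A"
    unfolding A_def G_def
  proof (intro nn_integral_cong)
    fix x assume [measurable]: "x \<in> space M"
    show "(\<integral>\<^sup>+ y. \<integral>\<^sup>+ x'. \<integral>\<^sup>+ y'. ennreal ((F (x, y) - F (x', y'))\<^sup>2) \<partial>N \<partial>M \<partial>N)
      = (\<integral>\<^sup>+ x'. \<integral>\<^sup>+ y. \<integral>\<^sup>+ y'. ennreal ((F (x, y) - F (x', y'))\<^sup>2) \<partial>N \<partial>N \<partial>M)"
      by (rule MN.Fubini') measurable
  qed
  finally have A: "pvar (M \<Otimes>\<^sub>M N) F = A" .
  have swap: "(\<integral>\<^sup>+ x. \<integral>\<^sup>+ x'. G x' x \<partial>M \<partial>M) = A"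
    unfolding A_def by (rule MM.Fubini') measurable
  define V where "V = (\<integral>\<^sup>+ y. pvar M (\<lambda>x. F (x, y)) \<partial>N)"
  define W where "W = (\<integral>\<^sup>+ x. pvar N (\<lambda>y. F (x, y)) \<partial>M)"
  define g where "g x x' = (\<integral>\<^sup>+ y. ennreal ((F (x, y) - F (x', y))\<^sup>2) \<partial>N)" for x x'
  have [measurable]: "(\<lambda>(x, x'). g x x') \<in> borel_measurable (M \<Otimes>\<^sub>M M)"
    unfolding g_def by measurable
  have [measurable]: "(\<lambda>x. pvar N (\<lambda>y. F (x, y))) \<in> borel_measurable M"
    unfolding pvar_def by measurable
  have V: "(\<integral>\<^sup>+ x. \<integral>\<^sup>+ x'. g x x' \<partial>M \<partial>M) = V"
  proof -
    have "(\<integral>\<^sup>+ x. \<integral>\<^sup>+ x'. g x x' \<partial>M \<partial>M)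
        = (\<integral>\<^sup>+ x. \<integral>\<^sup>+ y. \<integral>\<^sup>+ x'. ennreal ((F (x, y) - F (x', y))\<^sup>2) \<partial>M \<partial>N \<partial>M)"
      unfolding g_def
    proof (intro nn_integral_cong)
      fix x assume [measurable]: "x \<in> space M"
      show "(\<integral>\<^sup>+ x'. \<integral>\<^sup>+ y. ennreal ((F (x, y) - F (x', y))\<^sup>2) \<partial>N \<partial>M)
        = (\<integral>\<^sup>+ y. \<integral>\<^sup>+ x'. ennreal ((F (x, y) - F (x', y))\<^sup>2) \<partial>M \<partial>N)"
        by (rule MN.Fubini'[symmetric]) measurable
    qed
    also have "\<dots> = V"
      unfolding V_def pvar_def by (rule MN.Fubini'[symmetric]) measurable
    finally show ?thesis .
  qed
  have main: "G x x' + G x' x \<le> 2 * g x x' + pvar N (\<lambda>y. F (x, y)) + pvar N (\<lambda>y. F (x', y))"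
    if [measurable]: "x \<in> space M" "x' \<in> space M" for x x'
  proof -
    let ?f = "\<lambda>x y. F (x, y)"
    have "G x x' + G x' x = (\<integral>\<^sup>+ y. \<integral>\<^sup>+ y'. ennreal ((?f x y - ?f x' y')\<^sup>2) + ennreal ((?f x' y - ?f x y')\<^sup>2) \<partial>N \<partial>N)"
      unfolding G_def by (simp add: nn_integral_add)
    also have "\<dots> \<le> (\<integral>\<^sup>+ y. \<integral>\<^sup>+ y'. (ennreal ((?f x y - ?f x' y)\<^sup>2) + ennreal ((?f x y' - ?f x' y')\<^sup>2))
        + (ennreal ((?f x y - ?f x y')\<^sup>2) + ennreal ((?f x' y - ?f x' y')\<^sup>2)) \<partial>N \<partial>N)"
    proof (intro nn_integral_mono)
      fix y y'
      have "(a - d)\<^sup>2 + (b - c)\<^sup>2 \<le> ((a - b)\<^sup>2 + (c - d)\<^sup>2) + ((a - c)\<^sup>2 + (b - d)\<^sup>2)" for a b c d :: real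
        using zero_le_power2[of "a - b - c + d"] by (simp add: power2_eq_square algebra_simps)
      from ennreal_leI[OF this] show "ennreal ((?f x y - ?f x' y')\<^sup>2) + ennreal ((?f x' y - ?f x y')\<^sup>2)
        \<le> (ennreal ((?f x y - ?f x' y)\<^sup>2) + ennreal ((?f x y' - ?f x' y')\<^sup>2))
        + (ennreal ((?f x y - ?f x y')\<^sup>2) + ennreal ((?f x' y - ?f x' y')\<^sup>2))"
        by simp
    qed
    also have "\<dots> = (g x x' + g x x') + (pvar N (\<lambda>y. F (x, y)) + pvar N (\<lambda>y. F (x', y)))"
      unfolding g_def pvar_def by (simp add: nn_integral_add N.emeasure_space_1)
    finally show ?thesis by (simp add: mult_2 add.assoc)
  qed
  \<comment> \<open>The pointwise inequality bounds the two diagonals together, so the integral is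
    doubled by exchanging \<open>x\<close> and \<open>x'\<close> until both occur.\<close>
  have "A + A = (\<integral>\<^sup>+ x. (\<integral>\<^sup>+ x'. G x x' \<partial>M) + (\<integral>\<^sup>+ x'. G x' x \<partial>M) \<partial>M)"
    using swap unfolding A_def by (subst nn_integral_add[OF m1 m2]) simp
  also have "\<dots> = (\<integral>\<^sup>+ x. \<integral>\<^sup>+ x'. G x x' + G x' x \<partial>M \<partial>M)"
    by (intro nn_integral_cong nn_integral_add[symmetric] m3 m4)
  also have "\<dots> \<le> (\<integral>\<^sup>+ x. \<integral>\<^sup>+ x'. 2 * g x x' + pvar N (\<lambda>y. F (x, y)) + pvar N (\<lambda>y. F (x', y)) \<partial>M \<partial>M)"
    by (intro nn_integral_mono main)
  also have "\<dots> = 2 * V + W + W"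
  proof -
    have "(\<integral>\<^sup>+ x. \<integral>\<^sup>+ x'. 2 * g x x' + pvar N (\<lambda>y. F (x, y)) + pvar N (\<lambda>y. F (x', y)) \<partial>M \<partial>M)
        = (\<integral>\<^sup>+ x. 2 * (\<integral>\<^sup>+ x'. g x x' \<partial>M) + pvar N (\<lambda>y. F (x, y)) + W \<partial>M)"
    proof (intro nn_integral_cong)
      fix x assume [measurable]: "x \<in> space M"
      show "(\<integral>\<^sup>+ x'. 2 * g x x' + pvar N (\<lambda>y. F (x, y)) + pvar N (\<lambda>y. F (x', y)) \<partial>M)
        = 2 * (\<integral>\<^sup>+ x'. g x x' \<partial>M) + pvar N (\<lambda>y. F (x, y)) + W"
        unfolding W_def
        by (subst nn_integral_add, measurable)+ (subst nn_integral_cmult, measurable, simp add: M.emeasure_space_1)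
    qed
    also have "\<dots> = 2 * (\<integral>\<^sup>+ x. \<integral>\<^sup>+ x'. g x x' \<partial>M \<partial>M) + W + W"
      by (subst nn_integral_add, measurable)+
        (subst nn_integral_cmult, measurable, simp add: M.emeasure_space_1 W_def)
    finally show ?thesis using V by simp
  qed
  finally have "2 * A \<le> 2 * (V + W)" by (simp add: mult_2 mult_2_right distrib_left ac_simps)
  then have "A \<le> V + W" by (subst (asm) ennreal_mult_le_mult_iff) auto
  then show ?thesis using A by (simp add: V_def W_def)
qed

text \<open>Induction on the index set, splitting off one coordinate by
  \<open>pvar_pair_measure\<close>. The hypothesis concerns coordinate lines only, so it survives
  freezing a coordinate. The energies \<open>D i\<close> are abstract and may be infinite, which
  later hides points without differentiability.\<close>

lemma pvar_PiM:
  fixes M :: "'i \<Rightarrow> 'a measure"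
  assumes M: "\<And>i. prob_space (M i)" and I: "finite I"
    and "F \<in> borel_measurable (PiM I M)"
    and "\<And>i. i \<in> I \<Longrightarrow> D i \<in> borel_measurable (PiM I M)"
    and "\<And>i x. i \<in> I \<Longrightarrow> x \<in> space (PiM I M) \<Longrightarrow>
      pvar (M i) (\<lambda>t. F (x(i := t))) \<le> (\<integral>\<^sup>+ t. D i (x(i := t)) \<partial>M i)"
  shows "pvar (PiM I M) F \<le> (\<Sum>i\<in>I. \<integral>\<^sup>+ x. D i x \<partial>PiM I M)"
  using I assms(3-)
proof (induction I arbitrary: F D)
  case empty
  interpret product_sigma_finite M
    by (intro product_sigma_finite.intro prob_space_imp_sigma_finite M)
  show ?case by (simp add: pvar_def nn_integral_empty)
next
  case (insert j I)
  interpret product_prob_space M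
    by (intro product_prob_space.intro product_prob_space_axioms.intro product_sigma_finite.intro prob_space_imp_sigma_finite M)
  interpret Q: prob_space "PiM I M" by (intro prob_space_PiM M)
  note [measurable] = insert.prems(1) insert.prems(2)
  have upd [measurable]: "(\<lambda>(x, t). x(j := t)) \<in> measurable (PiM I M \<Otimes>\<^sub>M M j) (PiM (insert j I) M)"
    by (rule measurable_add_dim)
  have [measurable]: "(\<lambda>(x, t). F (x(j := t))) \<in> borel_measurable (PiM I M \<Otimes>\<^sub>M M j)"
    using measurable_compose[OF upd insert.prems(1)] by (simp add: split_beta')
  have "pvar (PiM (insert j I) M) F = pvar (PiM I M \<Otimes>\<^sub>M M j) (\<lambda>(x, t). F (x(j := t)))"
    unfolding pvar_def using insert.hyps
    by (simp add: product_nn_integral_insert M.nn_integral_fst[symmetric])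
  also have "\<dots> \<le> (\<integral>\<^sup>+ t. pvar (PiM I M) (\<lambda>x. F (x(j := t))) \<partial>M j) + (\<integral>\<^sup>+ x. pvar (M j) (\<lambda>t. F (x(j := t))) \<partial>PiM I M)"
    using pvar_pair_measure[OF Q.prob_space_axioms M[of j], of "\<lambda>(x, t). F (x(j := t))"] by simp
  also have "(\<integral>\<^sup>+ x. pvar (M j) (\<lambda>t. F (x(j := t))) \<partial>PiM I M) \<le> (\<integral>\<^sup>+ x. D j x \<partial>PiM (insert j I) M)"
  proof -
    have "pvar (M j) (\<lambda>t. F (x(j := t))) \<le> (\<integral>\<^sup>+ t. D j (x(j := t)) \<partial>M j)" if x: "x \<in> space (PiM I M)" for x
    proof -
      \<comment> \<open>The line hypothesis speaks of points with a \<open>j\<close>-coordinate; any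
        \<open>s\<close> serves, since it is overwritten by \<open>t\<close>.\<close>
      obtain s where s: "s \<in> space (M j)" using prob_space.not_empty[OF M] by blast
      then have "x(j := s) \<in> space (PiM (insert j I) M)"
        using x by (auto simp: space_PiM PiE_def extensional_def)
      from insert.prems(3)[OF insertI1 this] show ?thesis by (simp only: fun_upd_upd)
    qed
    then have "(\<integral>\<^sup>+ x. pvar (M j) (\<lambda>t. F (x(j := t))) \<partial>PiM I M) \<le> (\<integral>\<^sup>+ x. \<integral>\<^sup>+ t. D j (x(j := t)) \<partial>M j \<partial>PiM I M)"
      by (intro nn_integral_mono)
    also have "\<dots> = (\<integral>\<^sup>+ x. D j x \<partial>PiM (insert j I) M)"
      using insert.hyps insert.prems(2)[of j] by (simp add: product_nn_integral_insert)
    finally show ?thesis .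
  qed
  also have "(\<integral>\<^sup>+ t. pvar (PiM I M) (\<lambda>x. F (x(j := t))) \<partial>M j)
      \<le> (\<integral>\<^sup>+ t. (\<Sum>i\<in>I. \<integral>\<^sup>+ x. D i (x(j := t)) \<partial>PiM I M) \<partial>M j)"
  proof (intro nn_integral_mono)
    fix t assume t: "t \<in> space (M j)"
    have ut: "(\<lambda>x. x(j := t)) \<in> measurable (PiM I M) (PiM (insert j I) M)"
      using measurable_Pair2[OF upd, of _] t by simp measurable
    show "pvar (PiM I M) (\<lambda>x. F (x(j := t))) \<le> (\<Sum>i\<in>I. \<integral>\<^sup>+ x. D i (x(j := t)) \<partial>PiM I M)"
    proof (rule insert.IH)
      show "(\<lambda>x. F (x(j := t))) \<in> borel_measurable (PiM I M)"
        using measurable_compose[OF ut insert.prems(1)] .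
      fix i assume i: "i \<in> I"
      show "(\<lambda>x. D i (x(j := t))) \<in> borel_measurable (PiM I M)"
        using measurable_compose[OF ut insert.prems(2)[OF insertI2[OF i]]] .
      fix x assume x: "x \<in> space (PiM I M)"
      have "x(j := t) \<in> space (PiM (insert j I) M)"
        using x t by (auto simp: space_PiM PiE_def extensional_def)
      note upd_space = this
      have "i \<noteq> j" using i insert.hyps by auto
      then have twist: "(x(i := s))(j := t) = (x(j := t))(i := s)" for s by (rule fun_upd_twist)
      show "pvar (M i) (\<lambda>s. F ((x(i := s))(j := t))) \<le> (\<integral>\<^sup>+ s. D i ((x(i := s))(j := t)) \<partial>M i)"
        unfolding twist by (rule insert.prems(3)[OF insertI2[OF i] upd_space])
    qed
  qed
  also have "\<dots> = (\<Sum>i\<in>I. \<integral>\<^sup>+ x. D i x \<partial>PiM (insert j I) M)"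
  proof -
    have [measurable]: "(\<lambda>(x, t). D i (x(j := t))) \<in> borel_measurable (PiM I M \<Otimes>\<^sub>M M j)" if "i \<in> I" for i
      using measurable_compose[OF upd insert.prems(2)[of i]] that by (simp add: split_beta')
    have "(\<integral>\<^sup>+ t. (\<Sum>i\<in>I. \<integral>\<^sup>+ x. D i (x(j := t)) \<partial>PiM I M) \<partial>M j) = (\<Sum>i\<in>I. \<integral>\<^sup>+ t. \<integral>\<^sup>+ x. D i (x(j := t)) \<partial>PiM I M \<partial>M j)"
      by (rule nn_integral_sum) measurable
    also have "\<dots> = (\<Sum>i\<in>I. \<integral>\<^sup>+ x. D i x \<partial>PiM (insert j I) M)"
      using insert.hyps insert.prems(2) by (intro sum.cong refl product_nn_integral_insert_rev[symmetric]) auto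
    finally show ?thesis .
  qed
  finally show ?case using insert.hyps by (simp add: add.commute add_mono)
qed

section \<open>Integrals over intervals, and \<open>pvar\<close> through moments\<close>

lemma nn_integral_Icc:
  fixes f :: "real \<Rightarrow> real"
  assumes f: "continuous_on {a..b} f" and nonneg: "\<And>x. x \<in> {a..b} \<Longrightarrow> 0 \<le> f x"
  shows "(\<integral>\<^sup>+ x. ennreal (f x) * indicator {a..b} x \<partial>lborel) = ennreal (integral {a..b} f)"
proof -
  have si: "set_integrable lborel {a..b} f" by (rule borel_integrable_atLeastAtMost'[OF f])
  have "(\<integral>\<^sup>+ x. ennreal (f x) * indicator {a..b} x \<partial>lborel) = (\<integral>\<^sup>+ x. ennreal (indicator {a..b} x *\<^sub>R f x) \<partial>lborel)"
    by (intro nn_integral_cong) (auto split: split_indicator)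
  also have "\<dots> = ennreal (\<integral>x. indicator {a..b} x *\<^sub>R f x \<partial>lborel)"
    using si nonneg by (intro nn_integral_eq_integral) (auto simp: set_integrable_def split: split_indicator)
  also have "(\<integral>x. indicator {a..b} x *\<^sub>R f x \<partial>lborel) = integral {a..b} f"
    using set_borel_integral_eq_integral(2)[OF si] by (simp add: set_lebesgue_integral_def)
  finally show ?thesis .
qed

lemma pvar_eq:
  assumes "prob_space M" and int: "integrable M F" "integrable M (\<lambda>x. (F x)\<^sup>2)"
  shows "pvar M F = ennreal (2 * ((\<integral>x. (F x)\<^sup>2 \<partial>M) - (\<integral>x. F x \<partial>M)\<^sup>2))"
proof -
  interpret prob_space M by fact
  define q m where "q = (\<integral>x. (F x)\<^sup>2 \<partial>M)" and "m = (\<integral>x. F x \<partial>M)"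
  have exp: "(F x - F y)\<^sup>2 = (F x)\<^sup>2 - 2 * F x * F y + (F y)\<^sup>2" for x y by (simp add: power2_diff)
  have in1: "(\<integral>y. (F x - F y)\<^sup>2 \<partial>M) = (F x)\<^sup>2 - 2 * m * F x + q" for x
    unfolding exp using int by (simp add: q_def m_def prob_space)
  have in2: "integrable M (\<lambda>y. (F x - F y)\<^sup>2)" for x
    unfolding exp using int by simp
  have "pvar M F = (\<integral>\<^sup>+ x. ennreal ((F x)\<^sup>2 - 2 * m * F x + q) \<partial>M)"
    unfolding pvar_def by (simp add: nn_integral_eq_integral in2 in1)
  also have "\<dots> = ennreal (\<integral>x. (F x)\<^sup>2 - 2 * m * F x + q \<partial>M)"
  proof (rule nn_integral_eq_integral)
    show "integrable M (\<lambda>x. (F x)\<^sup>2 - 2 * m * F x + q)" using int by simp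
    have "0 \<le> (\<integral>y. (F x - F y)\<^sup>2 \<partial>M)" for x by simp
    then show "AE x in M. 0 \<le> (F x)\<^sup>2 - 2 * m * F x + q" by (simp add: in1)
  qed
  also have "(\<integral>x. (F x)\<^sup>2 - 2 * m * F x + q \<partial>M) = q - 2 * m * m + q"
    using int by (simp add: prob_space flip: q_def m_def)
  also have "\<dots> = 2 * (q - m\<^sup>2)" by (simp add: power2_eq_square)
  finally show ?thesis by (simp add: q_def m_def)
qed

text \<open>Differences ignore the shift by \<open>a\<close>. An infinite second moment makes the
  bound trivial, and a finite one provides the integrability that \<open>pvar_eq\<close>
  needs.\<close>

lemma pvar_le:
  assumes "prob_space M" and [measurable]: "F \<in> borel_measurable M"
  shows "pvar M F \<le> 2 * (\<integral>\<^sup>+ x. ennreal ((F x - a)\<^sup>2) \<partial>M)"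
proof (cases "(\<integral>\<^sup>+ x. ennreal ((F x - a)\<^sup>2) \<partial>M) = \<infinity>")
  case False
  interpret prob_space M by fact
  let ?G = "\<lambda>x. F x - a"
  have i2: "integrable M (\<lambda>x. (?G x)\<^sup>2)"
    using False by (intro integrableI_nonneg) (auto simp: less_top)
  have i1: "integrable M ?G" by (rule square_integrable_imp_integrable[OF _ i2]) simp
  have "pvar M F = pvar M ?G" by (simp add: pvar_def)
  also have "\<dots> = ennreal (2 * ((\<integral>x. (?G x)\<^sup>2 \<partial>M) - (\<integral>x. ?G x \<partial>M)\<^sup>2))"
    by (rule pvar_eq[OF _ i1 i2]) fact
  also have "\<dots> \<le> ennreal (2 * (\<integral>x. (?G x)\<^sup>2 \<partial>M))" by (intro ennreal_leI) simp
  also have "\<dots> = 2 * (\<integral>\<^sup>+ x. ennreal ((F x - a)\<^sup>2) \<partial>M)"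
    using i2 by (simp add: ennreal_mult nn_integral_eq_integral)
  finally show ?thesis .
qed (simp add: ennreal_mult_top)

section \<open>The Gaussian inequality on the line\<close>

lemma AE_cone_measure_real: "AE \<theta> in (cone_measure :: real measure). \<theta> = 1 \<or> \<theta> = -1"
  using AE_cone_measure_norm[where 'a = real] by eventually_elim auto

text \<open>The Dirichlet ground state is the first Hermite polynomial \<open>t\<close>, with
  eigenvalue 1; its logarithmic derivative \<open>1/t\<close> solves the Riccati equation for
  \<open>V t = t\<close>. Intervals \<open>[0,n]\<close> exhaust the half-line by monotone
  convergence.\<close>

lemma gaussian_halfline:
  fixes g g' :: "real \<Rightarrow> real"
  assumes g: "\<And>t. (g has_real_derivative g' t) (at t)" and g': "continuous_on UNIV g'"
  shows "(\<integral>\<^sup>+ t. indicator {0..} t * ennreal ((g t - g 0)\<^sup>2 * exp (- t\<^sup>2 / 2)) \<partial>lborel)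
    \<le> (\<integral>\<^sup>+ t. indicator {0..} t * ennreal ((g' t)\<^sup>2 * exp (- t\<^sup>2 / 2)) \<partial>lborel)"
proof -
  have gc: "continuous_on UNIV g"
    using g by (meson DERIV_isCont continuous_at_imp_continuous_on)
  have [measurable]: "g \<in> borel_measurable borel" "g' \<in> borel_measurable borel"
    using gc g' by (auto intro: borel_measurable_continuous_onI)
  let ?l = "\<lambda>t. (g t - g 0)\<^sup>2 * exp (- t\<^sup>2 / 2)" and ?r = "\<lambda>t. (g' t)\<^sup>2 * exp (- t\<^sup>2 / 2)"
  have le: "(\<integral>\<^sup>+ t. ennreal (?l t) * indicator {0..real n} t \<partial>lborel) \<le> (\<integral>\<^sup>+ t. indicator {0..} t * ennreal (?r t) \<partial>lborel)" for n
  proof (cases "n = 0")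
    case True
    have "(\<integral>\<^sup>+ t. ennreal (?l t) * indicator {0..real n} t \<partial>lborel) = ennreal (integral {0..real n} ?l)"
      by (intro nn_integral_Icc continuous_intros continuous_on_subset[OF gc]) auto
    then show ?thesis using True by simp
  next
    case False
    let ?L = "real n"
    have "1 * integral {0..?L} ?l \<le> integral {0..?L} ?r"
    proof (rule riccati_poincare[where V = "\<lambda>t. t" and y = "\<lambda>t. 1 / t" and l = 1 and \<rho> = "\<lambda>t. exp (- t\<^sup>2 / 2)"])
      show "((\<lambda>t. g t - g 0) has_real_derivative g' s) (at s within {0..?L})" for s
        using g[of s] by (auto intro!: derivative_eq_intros intro: has_field_derivative_at_within)
      show "continuous_on {0..?L} g'" using g' continuous_on_subset by blast
      show "((\<lambda>t. exp (- t\<^sup>2 / 2)) has_real_derivative - s * exp (- s\<^sup>2 / 2)) (at s)" for s :: real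
        by (auto intro!: derivative_eq_intros)
      show "((\<lambda>t. 1 / t) has_real_derivative s * (1 / s) - 1 - (1 / s)\<^sup>2) (at s)" if "s \<in> {0<..<?L}" for s
        using that by (auto intro!: derivative_eq_intros simp: power2_eq_square)
      have "\<forall>\<^sub>F s in at_right 0. 1 = s * (1 / s :: real)" by (auto simp: eventually_at_filter)
      then show "((\<lambda>s. s * (1 / s :: real)) \<longlongrightarrow> 1) (at_right 0)"
        by (rule Lim_transform_eventually[OF tendsto_const])
    qed (use False in \<open>auto intro!: continuous_intros\<close>)
    then have "ennreal (integral {0..?L} ?l) \<le> ennreal (integral {0..?L} ?r)" by (intro ennreal_leI) simp
    also have "ennreal (integral {0..?L} ?l) = (\<integral>\<^sup>+ t. ennreal (?l t) * indicator {0..?L} t \<partial>lborel)"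
      by (intro nn_integral_Icc[symmetric] continuous_intros continuous_on_subset[OF gc]) auto
    also have "ennreal (integral {0..?L} ?r) = (\<integral>\<^sup>+ t. ennreal (?r t) * indicator {0..?L} t \<partial>lborel)"
      by (intro nn_integral_Icc[symmetric] continuous_intros continuous_on_subset[OF g']) auto
    also have "\<dots> \<le> (\<integral>\<^sup>+ t. indicator {0..} t * ennreal (?r t) \<partial>lborel)"
      by (intro nn_integral_mono) (auto split: split_indicator)
    finally show ?thesis .
  qed
  have "(\<integral>\<^sup>+ t. indicator {0..} t * ennreal (?l t) \<partial>lborel) = (\<integral>\<^sup>+ t. (SUP n. ennreal (?l t) * indicator {0..real n} t) \<partial>lborel)"
  proof (intro nn_integral_cong)
    fix t :: real
    show "indicator {0..} t * ennreal (?l t) = (SUP n. ennreal (?l t) * indicator {0..real n} t)"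
    proof (rule antisym)
      obtain n where "t \<le> real n" using real_arch_simple by blast
      then have "indicator {0..} t * ennreal (?l t) \<le> ennreal (?l t) * indicator {0..real n} t"
        by (auto split: split_indicator)
      then show "indicator {0..} t * ennreal (?l t) \<le> (SUP n. ennreal (?l t) * indicator {0..real n} t)"
        by (rule order_trans[OF _ SUP_upper]) simp
    qed (auto intro!: SUP_least split: split_indicator)
  qed
  also have "\<dots> = (SUP n. \<integral>\<^sup>+ t. ennreal (?l t) * indicator {0..real n} t \<partial>lborel)"
    by (intro nn_integral_monotone_convergence_SUP) (auto simp: incseq_def le_fun_def split: split_indicator)
  also have "\<dots> \<le> (\<integral>\<^sup>+ t. indicator {0..} t * ennreal (?r t) \<partial>lborel)"
    by (intro SUP_least le)
  finally show ?thesis .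
qed

text \<open>Polar coordinates on the line produce the two half-lines. Centering at
  \<open>g 0\<close> instead of the mean costs nothing, as \<open>pvar_le\<close> accepts any
  center.\<close>

lemma gaussian_line:
  fixes g g' :: "real \<Rightarrow> real"
  assumes g: "\<And>t. (g has_real_derivative g' t) (at t)" and g': "continuous_on UNIV g'"
  shows "(\<integral>\<^sup>+ t. ennreal ((g t - g 0)\<^sup>2) \<partial>density lborel std_normal_density)
    \<le> (\<integral>\<^sup>+ t. ennreal ((g' t)\<^sup>2) \<partial>density lborel std_normal_density)"
proof -
  have gc: "continuous_on UNIV g"
    using g by (meson DERIV_isCont continuous_at_imp_continuous_on)
  have [measurable]: "g \<in> borel_measurable borel" "g' \<in> borel_measurable borel"
    using gc g' by (auto intro: borel_measurable_continuous_onI)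
  let ?q = "\<lambda>t :: real. exp (- t\<^sup>2 / 2)" and ?c = "1 / sqrt (2 * pi)"
  have dens: "(\<integral>\<^sup>+ t. ennreal (f t) \<partial>density lborel std_normal_density)
     = ennreal ?c * (\<integral>\<^sup>+ \<theta>. (\<integral>\<^sup>+ r. indicator {0..} r * ennreal (f (r * \<theta>) * ?q (r * \<theta>)) \<partial>lborel) \<partial>cone_measure)"
    if [measurable]: "f \<in> borel_measurable borel" and f: "\<And>t. f t \<ge> 0" for f :: "real \<Rightarrow> real"
  proof -
    have "(\<integral>\<^sup>+ t. ennreal (f t) \<partial>density lborel std_normal_density) = (\<integral>\<^sup>+ t. ennreal ?c * ennreal (f t * ?q t) \<partial>lborel)"
      using f by (subst nn_integral_density)
        (auto intro!: nn_integral_cong simp: std_normal_density_def mult_ac simp flip: ennreal_mult)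
    also have "\<dots> = ennreal ?c * (\<integral>\<^sup>+ t. ennreal (f t * ?q t) \<partial>lborel)"
      by (rule nn_integral_cmult) measurable
    finally show ?thesis by (subst (asm) nn_integral_polar) simp_all
  qed
  have "(\<integral>\<^sup>+ \<theta>. (\<integral>\<^sup>+ r. indicator {0..} r * ennreal ((g (r * \<theta>) - g 0)\<^sup>2 * ?q (r * \<theta>)) \<partial>lborel) \<partial>cone_measure)
      \<le> (\<integral>\<^sup>+ \<theta>. (\<integral>\<^sup>+ r. indicator {0..} r * ennreal ((g' (r * \<theta>))\<^sup>2 * ?q (r * \<theta>)) \<partial>lborel) \<partial>cone_measure)"
  proof (rule nn_integral_mono_AE)
    show "AE \<theta> in cone_measure. (\<integral>\<^sup>+ r. indicator {0..} r * ennreal ((g (r * \<theta>) - g 0)\<^sup>2 * ?q (r * \<theta>)) \<partial>lborel)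
        \<le> (\<integral>\<^sup>+ r. indicator {0..} r * ennreal ((g' (r * \<theta>))\<^sup>2 * ?q (r * \<theta>)) \<partial>lborel)"
      using AE_cone_measure_real
    proof eventually_elim
      case (elim \<theta>)
      have "((\<lambda>t. g (t * \<theta>)) has_real_derivative g' (t * \<theta>) * \<theta>) (at t)" for t
        by (rule DERIV_chain2[OF g]) (auto intro!: derivative_eq_intros)
      moreover have "continuous_on UNIV (\<lambda>t. g' (t * \<theta>) * \<theta>)"
        by (intro continuous_intros continuous_on_compose2[OF g']) auto
      ultimately show ?case
        using gaussian_halfline[of "\<lambda>t. g (t * \<theta>)" "\<lambda>t. g' (t * \<theta>) * \<theta>"] elim by auto
    qed
  qed
  then have "ennreal ?c * (\<integral>\<^sup>+ \<theta>. (\<integral>\<^sup>+ r. indicator {0..} r * ennreal ((g (r * \<theta>) - g 0)\<^sup>2 * ?q (r * \<theta>)) \<partial>lborel) \<partial>cone_measure)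
      \<le> ennreal ?c * (\<integral>\<^sup>+ \<theta>. (\<integral>\<^sup>+ r. indicator {0..} r * ennreal ((g' (r * \<theta>))\<^sup>2 * ?q (r * \<theta>)) \<partial>lborel) \<partial>cone_measure)"
    by (rule mult_left_mono) simp
  moreover have "(\<lambda>t. (g t - g 0)\<^sup>2) \<in> borel_measurable borel" "(\<lambda>t. (g' t)\<^sup>2) \<in> borel_measurable borel"
    by measurable
  ultimately show ?thesis by (simp only: dens zero_le_power2)
qed

section \<open>Gaussian and spherical Poincare inequalities\<close>

abbreviation "std_gauss \<equiv> density lborel (\<lambda>t. ennreal (std_normal_density t))"

lemma prob_space_std_gauss: "prob_space std_gauss"
  using prob_space_normal_density[of 1 0] by simp

text \<open>Given by its density so that polar coordinates apply directly;
  \<open>gauss_eq_distr\<close> recovers the product structure needed for tensorization.\<close>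

definition gauss :: "'a::euclidean_space measure" where
  "gauss = density lborel (\<lambda>x. ennreal ((1 / sqrt (2 * pi)) ^ DIM('a) * exp (- (norm x)\<^sup>2 / 2)))"

lemma power2_norm_eq_sum_Basis:
  fixes x :: "'a::euclidean_space"
  shows "(norm x)\<^sup>2 = (\<Sum>b\<in>Basis. (x \<bullet> b)\<^sup>2)"
  unfolding power2_norm_eq_inner by (subst euclidean_inner) (simp only: power2_eq_square)

lemma gauss_density_eq:
  fixes x :: "'a::euclidean_space"
  shows "(1 / sqrt (2 * pi)) ^ DIM('a) * exp (- (norm x)\<^sup>2 / 2) = (\<Prod>b\<in>Basis. std_normal_density (x \<bullet> b))"
proof -
  have "exp (- (norm x)\<^sup>2 / 2) = (\<Prod>b\<in>Basis. exp (- (x \<bullet> b)\<^sup>2 / 2))"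
    by (simp add: power2_norm_eq_sum_Basis exp_sum[symmetric] sum_negf sum_divide_distrib)
  then show ?thesis
    unfolding std_normal_density_def prod.distrib by simp
qed

lemma PiM_density_std_gauss:
  fixes I :: "'i set"
  assumes I: "finite I"
  shows "PiM I (\<lambda>_. std_gauss) = density (PiM I (\<lambda>_. lborel)) (\<lambda>f. \<Prod>i\<in>I. ennreal (std_normal_density (f i)))"
proof -
  interpret N: product_sigma_finite "\<lambda>_ :: 'i. std_gauss"
    by (intro product_sigma_finite.intro prob_space_imp_sigma_finite prob_space_std_gauss)
  interpret L: product_sigma_finite "\<lambda>_ :: 'i. lborel :: real measure" ..
  show ?thesis
  proof (rule N.PiM_eqI[OF I, symmetric])
    show "sets (density (PiM I (\<lambda>_. lborel)) (\<lambda>f. \<Prod>i\<in>I. ennreal (std_normal_density (f i)))) = PiM I (\<lambda>_. std_gauss)"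
      by (simp cong: sets_PiM_cong)
    fix A :: "'i \<Rightarrow> real set" assume "\<And>i. i \<in> I \<Longrightarrow> A i \<in> sets std_gauss"
    then have A [measurable]: "\<And>i. i \<in> I \<Longrightarrow> A i \<in> sets borel" by simp
    have PA: "Pi\<^sub>E I A \<in> sets (PiM I (\<lambda>_. lborel))"
      using A I by (intro sets_PiM_I_finite) auto
    have "emeasure (density (PiM I (\<lambda>_. lborel)) (\<lambda>f. \<Prod>i\<in>I. ennreal (std_normal_density (f i)))) (Pi\<^sub>E I A)
        = (\<integral>\<^sup>+ f. (\<Prod>i\<in>I. ennreal (std_normal_density (f i))) * indicator (Pi\<^sub>E I A) f \<partial>PiM I (\<lambda>_. lborel))"
      by (intro emeasure_density PA) measurable
    also have "\<dots> = (\<integral>\<^sup>+ f. (\<Prod>i\<in>I. ennreal (std_normal_density (f i)) * indicator (A i) (f i)) \<partial>PiM I (\<lambda>_. lborel))"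
    proof (intro nn_integral_cong)
      fix f :: "'i \<Rightarrow> real" assume "f \<in> space (PiM I (\<lambda>_. lborel))"
      then have "indicator (Pi\<^sub>E I A) f = (\<Prod>i\<in>I. indicator (A i) (f i) :: ennreal)"
        using I by (auto simp: space_PiM PiE_iff indicator_def prod_zero_iff)
      then show "(\<Prod>i\<in>I. ennreal (std_normal_density (f i))) * indicator (Pi\<^sub>E I A) f
        = (\<Prod>i\<in>I. ennreal (std_normal_density (f i)) * indicator (A i) (f i))"
        by (simp add: prod.distrib)
    qed
    also have "\<dots> = (\<Prod>i\<in>I. \<integral>\<^sup>+ t. ennreal (std_normal_density t) * indicator (A i) t \<partial>lborel)"
      by (rule L.product_nn_integral_prod[OF I]) measurable
    also have "\<dots> = (\<Prod>i\<in>I. emeasure std_gauss (A i))"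
      by (intro prod.cong refl emeasure_density[symmetric]) measurable
    finally show "emeasure (density (PiM I (\<lambda>_. lborel)) (\<lambda>f. \<Prod>i\<in>I. ennreal (std_normal_density (f i)))) (Pi\<^sub>E I A)
        = (\<Prod>i\<in>I. emeasure std_gauss (A i))" .
  qed
qed

lemma inner_sum_scaleR_Basis:
  fixes f :: "'a::euclidean_space \<Rightarrow> real"
  assumes "b \<in> Basis"
  shows "(\<Sum>i\<in>Basis. f i *\<^sub>R i) \<bullet> b = f b"
  using assms by (simp add: inner_sum_left inner_Basis if_distrib cong: if_cong)

lemma measurable_sum_scaleR_Basis [measurable]:
  "(\<lambda>f. \<Sum>b\<in>Basis. f b *\<^sub>R b) \<in> measurable (PiM Basis (\<lambda>_. std_gauss)) (borel :: 'a::euclidean_space measure)"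
  "(\<lambda>f. \<Sum>b\<in>Basis. f b *\<^sub>R b) \<in> measurable (PiM Basis (\<lambda>_. lborel)) (borel :: 'a::euclidean_space measure)"
  by measurable

lemma gauss_eq_distr:
  "(gauss :: 'a::euclidean_space measure) = distr (PiM Basis (\<lambda>_. std_gauss)) borel (\<lambda>f. \<Sum>b\<in>Basis. f b *\<^sub>R b)"
proof (rule measure_eqI)
  fix A assume "A \<in> sets (gauss :: 'a measure)"
  then have [measurable]: "A \<in> sets borel" by (simp add: gauss_def)
  let ?T = "\<lambda>f :: 'a \<Rightarrow> real. \<Sum>b\<in>Basis. f b *\<^sub>R b"
  let ?P = "PiM Basis (\<lambda>_ :: 'a. lborel :: real measure)"
  have TA: "?T -` A \<inter> space ?P \<in> sets ?P"
    by (rule measurable_sets[OF measurable_sum_scaleR_Basis(2)]) measurable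
  have "emeasure gauss A = (\<integral>\<^sup>+ x. (\<Prod>b\<in>Basis. ennreal (std_normal_density (x \<bullet> b))) * indicator A x \<partial>(lborel :: 'a measure))"
    unfolding gauss_def gauss_density_eq by (simp add: emeasure_density prod_ennreal)
  also have "\<dots> = (\<integral>\<^sup>+ f. (\<Prod>b\<in>Basis. ennreal (std_normal_density (?T f \<bullet> b))) * indicator A (?T f) \<partial>?P)"
    by (subst lborel_eq) (simp add: nn_integral_distr)
  also have "\<dots> = (\<integral>\<^sup>+ f. (\<Prod>b\<in>Basis. ennreal (std_normal_density (f b))) * indicator (?T -` A \<inter> space ?P) f \<partial>?P)"
    by (intro nn_integral_cong arg_cong2[where f = "(*)"] prod.cong refl)
      (auto simp: inner_sum_scaleR_Basis split: split_indicator)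
  also have "\<dots> = emeasure (density ?P (\<lambda>f. \<Prod>b\<in>Basis. ennreal (std_normal_density (f b)))) (?T -` A \<inter> space ?P)"
    by (intro emeasure_density[symmetric] TA) measurable
  also have "\<dots> = emeasure (PiM Basis (\<lambda>_. std_gauss)) (?T -` A \<inter> space (PiM Basis (\<lambda>_. std_gauss)))"
    by (simp add: PiM_density_std_gauss)
  also have "\<dots> = emeasure (distr (PiM Basis (\<lambda>_. std_gauss)) borel ?T) A"
    by (rule emeasure_distr[symmetric]) measurable
  finally show "emeasure gauss A = emeasure (distr (PiM Basis (\<lambda>_. std_gauss)) borel ?T) A" .
qed (simp add: gauss_def)

lemma sets_gauss [measurable_cong, simp]: "sets gauss = sets borel"
  by (simp add: gauss_def)

lemma prob_space_gauss: "prob_space gauss"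
  unfolding gauss_eq_distr
  by (intro prob_space.prob_space_distr prob_space_PiM prob_space_std_gauss measurable_sum_scaleR_Basis)

lemma nn_integral_gauss:
  fixes F :: "'a::euclidean_space \<Rightarrow> ennreal"
  assumes [measurable]: "F \<in> borel_measurable borel"
  shows "(\<integral>\<^sup>+ x. F x \<partial>gauss) = (\<integral>\<^sup>+ f. F (\<Sum>b\<in>Basis. f b *\<^sub>R b) \<partial>PiM Basis (\<lambda>_. std_gauss))"
  unfolding gauss_eq_distr by (subst nn_integral_distr) measurable

text \<open>Against total mass 1 this gives the ratio \<open>d\<close> of the radial moments of
  order 2 and 0, the source of the spherical constant.\<close>

lemma gauss_second_moment: "(\<integral>\<^sup>+ x. ennreal ((norm x)\<^sup>2) \<partial>(gauss :: 'a::euclidean_space measure)) = ennreal DIM('a)"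
proof -
  let ?P = "PiM (Basis :: 'a set) (\<lambda>_. std_gauss)"
  have one: "(\<integral>\<^sup>+ t. ennreal (t\<^sup>2) \<partial>std_gauss) = 1"
  proof -
    have "(\<integral>\<^sup>+ t. ennreal (t\<^sup>2) \<partial>std_gauss) = (\<integral>\<^sup>+ t. ennreal (std_normal_density t * t ^ (2 * 1)) \<partial>lborel)"
      by (subst nn_integral_density) (auto intro!: nn_integral_cong simp: ennreal_mult)
    also have "\<dots> = ennreal (\<integral>t. std_normal_density t * t ^ (2 * 1) \<partial>lborel)"
      by (intro nn_integral_eq_integral integrable_std_normal_moment) auto
    also have "\<dots> = 1" by (subst integral_std_normal_moment_even) simp
    finally show ?thesis .
  qed
  have "(\<integral>\<^sup>+ x. ennreal ((norm x)\<^sup>2) \<partial>(gauss :: 'a measure)) = (\<integral>\<^sup>+ f. (\<Sum>b\<in>Basis. ennreal ((f b)\<^sup>2)) \<partial>?P)"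
  proof (subst nn_integral_gauss; (intro nn_integral_cong)?)
    fix f :: "'a \<Rightarrow> real"
    show "ennreal ((norm (\<Sum>b\<in>Basis. f b *\<^sub>R b))\<^sup>2) = (\<Sum>b\<in>Basis. ennreal ((f b)\<^sup>2))"
      by (simp add: power2_norm_eq_sum_Basis inner_sum_scaleR_Basis sum_ennreal)
  qed measurable
  also have "\<dots> = (\<Sum>b\<in>Basis. \<integral>\<^sup>+ f. ennreal ((f b)\<^sup>2) \<partial>?P)"
    by (rule nn_integral_sum) measurable
  also have "\<dots> = (\<Sum>b\<in>(Basis :: 'a set). 1)"
  proof (intro sum.cong refl)
    fix b :: 'a assume b: "b \<in> Basis"
    have "(\<integral>\<^sup>+ f. ennreal ((f b)\<^sup>2) \<partial>?P) = (\<integral>\<^sup>+ t. ennreal (t\<^sup>2) \<partial>distr ?P std_gauss (\<lambda>f. f b))"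
      using b by (subst nn_integral_distr) measurable
    also have "distr ?P std_gauss (\<lambda>f. f b) = std_gauss"
      using b by (intro distr_PiM_component prob_space_std_gauss)
    finally show "(\<integral>\<^sup>+ f. ennreal ((f b)\<^sup>2) \<partial>?P) = 1" by (simp add: one)
  qed
  finally show ?thesis by (simp add: ennreal_of_nat_eq_real_of_nat)
qed

text \<open>The inequality is asked for line by line, with no regularity of \<open>F\<close> across
  lines. A line on which \<open>F\<close> fails to be differentiable can be given infinite energy
  \<open>D b\<close>.\<close>

lemma gauss_poincare_lines:
  fixes F :: "'a::euclidean_space \<Rightarrow> real" and D :: "'a \<Rightarrow> 'a \<Rightarrow> ennreal"
  assumes F: "F \<in> borel_measurable borel" and D: "\<And>b. b \<in> Basis \<Longrightarrow> D b \<in> borel_measurable borel"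
    and line: "\<And>b x. b \<in> Basis \<Longrightarrow> x \<bullet> b = 0 \<Longrightarrow>
      pvar std_gauss (\<lambda>t. F (x + t *\<^sub>R b)) \<le> (\<integral>\<^sup>+ t. D b (x + t *\<^sub>R b) \<partial>std_gauss)"
  shows "pvar gauss F \<le> (\<integral>\<^sup>+ x. (\<Sum>b\<in>Basis. D b x) \<partial>gauss)"
proof -
  let ?T = "\<lambda>f :: 'a \<Rightarrow> real. \<Sum>b\<in>Basis. f b *\<^sub>R b"
  let ?P = "PiM (Basis :: 'a set) (\<lambda>_. std_gauss)"
  note [measurable] = F D
  interpret G: prob_space gauss by (rule prob_space_gauss)
  have upd: "?T (f(b := t)) = ?T (f(b := 0)) + t *\<^sub>R b" if "b \<in> Basis" for f b t
    using that by (simp add: sum.remove[of Basis b])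
  have "pvar gauss F = (\<integral>\<^sup>+ f. \<integral>\<^sup>+ y. ennreal ((F (?T f) - F y)\<^sup>2) \<partial>gauss \<partial>?P)"
    unfolding pvar_def by (rule nn_integral_gauss) measurable
  also have "\<dots> = pvar ?P (\<lambda>f. F (?T f))"
    unfolding pvar_def by (intro nn_integral_cong nn_integral_gauss) measurable
  also have "\<dots> \<le> (\<Sum>b\<in>Basis. \<integral>\<^sup>+ f. D b (?T f) \<partial>?P)"
  proof (rule pvar_PiM)
    fix b :: 'a and f assume b: "b \<in> Basis"
    define z where "z = ?T (f(b := 0))"
    have z: "?T (f(b := t)) = z + t *\<^sub>R b" for t unfolding z_def by (rule upd[OF b])
    have "z \<bullet> b = 0" unfolding z_def by (subst inner_sum_scaleR_Basis[OF b]) simp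
    from line[OF b this] show "pvar std_gauss (\<lambda>t. F (?T (f(b := t)))) \<le> (\<integral>\<^sup>+ t. D b (?T (f(b := t))) \<partial>std_gauss)"
      unfolding z .
  qed (auto intro: prob_space_std_gauss)
  also have "\<dots> = (\<Sum>b\<in>Basis. \<integral>\<^sup>+ x. D b x \<partial>gauss)"
    by (intro sum.cong refl nn_integral_gauss[symmetric] D)
  also have "\<dots> = (\<integral>\<^sup>+ x. (\<Sum>b\<in>Basis. D b x) \<partial>gauss)"
    by (rule nn_integral_sum[symmetric]) measurable
  finally show ?thesis .
qed

text \<open>Radius and direction separate for functions homogeneous of degree \<open>j\<close>. The
  degrees 0, 1 and 2 serve for the gradient, the mean and the square of a one-homogeneous
  function.\<close>

lemma gauss_polar:
  fixes u :: "'a::euclidean_space \<Rightarrow> ennreal"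
  assumes [measurable]: "u \<in> borel_measurable borel"
  shows "(\<integral>\<^sup>+ x. ennreal (norm x ^ j) * u (sgn x) \<partial>gauss)
    = ennreal ((1 / sqrt (2 * pi)) ^ DIM('a))
      * (\<integral>\<^sup>+ r. indicator {0..} r * ennreal (r ^ (DIM('a) - 1 + j) * exp (- r\<^sup>2 / 2)) \<partial>lborel)
      * (\<integral>\<^sup>+ \<theta>. u \<theta> \<partial>cone_measure)"
proof -
  let ?q = "(1 / sqrt (2 * pi)) ^ DIM('a)"
  let ?A = "\<integral>\<^sup>+ r. indicator {0..} r * ennreal (r ^ (DIM('a) - 1 + j) * exp (- r\<^sup>2 / 2)) \<partial>lborel"
  let ?F = "\<lambda>\<theta> r. ennreal (r ^ (DIM('a) - 1)) * indicator {0..} r *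
      (ennreal (?q * exp (- (norm (r *\<^sub>R \<theta>))\<^sup>2 / 2)) * (ennreal (norm (r *\<^sub>R \<theta>) ^ j) * u (sgn (r *\<^sub>R \<theta>))))"
  have "(\<integral>\<^sup>+ x. ennreal (norm x ^ j) * u (sgn x) \<partial>gauss)
      = (\<integral>\<^sup>+ x. ennreal (?q * exp (- (norm x)\<^sup>2 / 2)) * (ennreal (norm x ^ j) * u (sgn x)) \<partial>(lborel :: 'a measure))"
    unfolding gauss_def by (rule nn_integral_density) measurable
  also have "\<dots> = (\<integral>\<^sup>+ \<theta>. (\<integral>\<^sup>+ r. ?F \<theta> r \<partial>lborel) \<partial>(cone_measure :: 'a measure))"
    by (rule nn_integral_polar) measurable
  also have "\<dots> = (\<integral>\<^sup>+ \<theta>. ennreal ?q * ?A * u \<theta> \<partial>cone_measure)"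
  proof (rule nn_integral_cong_AE)
    show "AE \<theta> in (cone_measure :: 'a measure). (\<integral>\<^sup>+ r. ?F \<theta> r \<partial>lborel)
      = ennreal ?q * ?A * u \<theta>"
      using AE_cone_measure_norm
    proof eventually_elim
      case (elim \<theta>)
      have "(\<integral>\<^sup>+ r. ?F \<theta> r \<partial>lborel)
        = (\<integral>\<^sup>+ r. ennreal ?q * (indicator {0..} r * ennreal (r ^ (DIM('a) - 1 + j) * exp (- r\<^sup>2 / 2))) * u \<theta> \<partial>lborel)"
      proof (rule nn_integral_cong_AE)
        show "AE r in lborel. ?F \<theta> r
          = ennreal ?q * (indicator {0..} r * ennreal (r ^ (DIM('a) - 1 + j) * exp (- r\<^sup>2 / 2))) * u \<theta>"
          using AE_lborel_singleton[of "0 :: real"]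
        proof eventually_elim
          case (elim r)
          show ?case
          proof (cases "r > 0")
            case True
            have "sgn (r *\<^sub>R \<theta>) = \<theta>" using True \<open>norm \<theta> = 1\<close> by (simp add: sgn_scaleR sgn_div_norm)
            moreover have "ennreal (r ^ (DIM('a) - 1)) * (ennreal (?q * exp (- r\<^sup>2 / 2)) * ennreal (r ^ j))
                = ennreal ?q * ennreal (r ^ (DIM('a) - 1 + j) * exp (- r\<^sup>2 / 2))"
              unfolding power_add using True by (simp add: mult_ac flip: ennreal_mult')
            ultimately show ?thesis using True \<open>norm \<theta> = 1\<close> by (simp add: mult.assoc[symmetric])
          qed (use elim in simp)
        qed
      qed
      also have "\<dots> = (\<integral>\<^sup>+ r. ennreal ?q * (indicator {0..} r * ennreal (r ^ (DIM('a) - 1 + j) * exp (- r\<^sup>2 / 2))) \<partial>lborel) * u \<theta>"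
        by (rule nn_integral_multc) measurable
      also have "(\<integral>\<^sup>+ r. ennreal ?q * (indicator {0..} r * ennreal (r ^ (DIM('a) - 1 + j) * exp (- r\<^sup>2 / 2))) \<partial>lborel) = ennreal ?q * ?A"
        by (rule nn_integral_cmult) measurable
      finally show ?case .
    qed
  qed
  also have "\<dots> = ennreal ?q * ?A * (\<integral>\<^sup>+ \<theta>. u \<theta> \<partial>cone_measure)"
    by (rule nn_integral_cmult) measurable
  finally show ?thesis .
qed

text \<open>The excluded points lie on the line spanned by \<open>b\<close>, a null set from
  dimension 2 on. This disposes of the lines with infinite energy.\<close>

lemma AE_lborel_not_in_line:
  fixes b :: "'a::euclidean_space"
  assumes "2 \<le> DIM('a)"
  shows "AE x in lborel. x - (x \<bullet> b) *\<^sub>R b \<noteq> 0"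
proof -
  let ?S = "{x :: 'a. x - (x \<bullet> b) *\<^sub>R b = 0}"
  have "?S \<subseteq> span {b}"
  proof
    fix x assume "x \<in> ?S"
    then have "x = (x \<bullet> b) *\<^sub>R b" by simp
    then show "x \<in> span {b}" by (metis insertI1 span_base span_scale)
  qed
  then have "dim ?S \<le> card {b}" by (intro dim_le_card) auto
  then have "negligible ?S" using assms by (intro negligible_lowdim) simp
  moreover have "closed ?S" by (intro closed_Collect_eq continuous_intros)
  ultimately have "?S \<in> null_sets lborel"
    by (simp add: negligible_iff_null_sets null_sets_completion_iff)
  then show ?thesis by (intro AE_I'[of ?S]) auto
qed

text \<open>On the sphere the constant is \<open>d - 1\<close>: the Gaussian inequality is applied to the
  one-homogeneous extension \<open>|x| (\<Phi>(x/|x|) - c)\<close>.\<close>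

lemma cone_poincare:
  fixes \<Phi> :: "'a::euclidean_space \<Rightarrow> real"
  assumes d: "2 \<le> DIM('a)"
    and \<Phi>: "\<And>x. GDERIV \<Phi> x :> \<Psi> x" and \<Psi>: "continuous_on UNIV \<Psi>"
  obtains c where "ennreal (DIM('a) - 1) * (\<integral>\<^sup>+ \<theta>. ennreal ((\<Phi> \<theta> - c)\<^sup>2) \<partial>cone_measure)
    \<le> (\<integral>\<^sup>+ \<theta>. ennreal ((norm (\<Psi> \<theta> - (\<theta> \<bullet> \<Psi> \<theta>) *\<^sub>R \<theta>))\<^sup>2) \<partial>cone_measure)"
proof -
  interpret S: finite_measure "cone_measure :: 'a measure" by (rule finite_cone_measure)
  interpret G: prob_space "gauss :: 'a measure" by (rule prob_space_gauss)
  have \<Phi>_der: "(\<Phi> has_derivative (\<lambda>h. h \<bullet> \<Psi> x)) (at x)" for x using \<Phi> by (simp add: gderiv_def)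
  have \<Phi>c: "continuous_on UNIV \<Phi>"
    using \<Phi>_der by (meson has_derivative_continuous continuous_at_imp_continuous_on)
  have [measurable]: "\<Phi> \<in> borel_measurable borel" "\<Psi> \<in> borel_measurable borel"
    using \<Phi>c \<Psi> by (auto intro: borel_measurable_continuous_onI)
  have "compact (\<Phi> ` sphere 0 1)"
    by (intro compact_continuous_image continuous_on_subset[OF \<Phi>c] compact_sphere) auto
  then obtain B where "\<forall>\<theta>\<in>sphere 0 1. \<bar>\<Phi> \<theta>\<bar> \<le> B"
    using compact_imp_bounded[of "\<Phi> ` sphere 0 1"] by (auto simp: bounded_iff)
  then have B: "\<bar>\<Phi> \<theta>\<bar> \<le> B" if "norm \<theta> = 1" for \<theta> using that by simp
  have \<Phi>int: "integrable cone_measure \<Phi>"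
  proof (rule S.integrable_const_bound)
    show "AE \<theta> in cone_measure. norm (\<Phi> \<theta>) \<le> B"
      using AE_cone_measure_norm by eventually_elim (use B in auto)
  qed simp
  define s where "s = measure (cone_measure :: 'a measure) UNIV"
  define q where "q = ennreal ((1 / sqrt (2 * pi)) ^ DIM('a))"
  \<comment> \<open>The radial moment of order \<open>j\<close>; \<open>A 0 * s = 1\<close> and
    \<open>A 2 * s = d\<close> follow by testing with the constant function.\<close>
  define A where "A j = q * (\<integral>\<^sup>+ r. indicator {0..} r * ennreal (r ^ (DIM('a) - 1 + j) * exp (- r\<^sup>2 / 2)) \<partial>lborel)" for j
  have polar: "(\<integral>\<^sup>+ x. ennreal (norm x ^ j) * u (sgn x) \<partial>gauss) = A j * (\<integral>\<^sup>+ \<theta>. u \<theta> \<partial>cone_measure)"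
    if "u \<in> borel_measurable borel" for u :: "'a \<Rightarrow> ennreal" and j
    using gauss_polar[OF that, of j] by (simp add: A_def q_def)
  have s: "emeasure (cone_measure :: 'a measure) UNIV = ennreal s"
    by (simp add: s_def S.emeasure_eq_measure)
  have A0: "A 0 * ennreal s = 1"
    using polar[of "\<lambda>_. 1" 0] G.emeasure_space_1 by (simp add: s)
  have A2: "A 2 * ennreal s = ennreal DIM('a)"
    using polar[of "\<lambda>_. 1" 2] gauss_second_moment[where 'a = 'a] by (simp add: s)
  have s0: "s > 0" using A0 by (cases "s = 0") (auto simp: s_def less_le)
  have A2f: "A 2 \<noteq> \<infinity>" using A2 s0 by (auto simp: ennreal_top_mult)
  \<comment> \<open>The spherical mean of \<open>\<Phi>\<close>; it makes the Gaussian mean of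
    \<open>H\<close> vanish, so that \<open>pvar gauss H\<close> is twice its second moment.\<close>
  define c where "c = (\<integral>\<theta>. \<Phi> \<theta> \<partial>cone_measure) / s"
  define \<phi> where "\<phi> \<theta> = \<Phi> \<theta> - c" for \<theta>
  define T where "T \<theta> = \<Psi> \<theta> - (\<theta> \<bullet> \<Psi> \<theta>) *\<^sub>R \<theta>" for \<theta>
  \<comment> \<open>On the sphere \<open>V\<close> is the gradient of the one-homogeneous
    \<open>H\<close>: the radial part is \<open>\<phi>\<close>, the tangential part
    \<open>T\<close>. That gradient is homogeneous of degree 0, hence \<open>V (sgn x)\<close> away
    from the origin.\<close>
  define V where "V \<theta> = \<phi> \<theta> *\<^sub>R \<theta> + T \<theta>" for \<theta>
  define H where "H x = norm x * \<phi> (sgn x)" for x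
  have [measurable]: "\<phi> \<in> borel_measurable borel" "T \<in> borel_measurable borel"
    unfolding \<phi>_def T_def by measurable
  then have [measurable]: "V \<in> borel_measurable borel" "H \<in> borel_measurable borel"
    unfolding V_def H_def by measurable
  have \<phi>int: "integrable cone_measure \<phi>" unfolding \<phi>_def using \<Phi>int by simp
  have "(\<integral>\<theta>. \<phi> \<theta> \<partial>cone_measure) = 0"
    unfolding \<phi>_def using \<Phi>int s0 by (simp add: c_def s_def[symmetric])
  then have mean0: "enn2real (\<integral>\<^sup>+ \<theta>. ennreal (\<phi> \<theta>) \<partial>cone_measure) = enn2real (\<integral>\<^sup>+ \<theta>. ennreal (- \<phi> \<theta>) \<partial>cone_measure)"
    using real_lebesgue_integral_def[OF \<phi>int] by simp
  have \<phi>2: "(\<integral>\<^sup>+ \<theta>. ennreal ((\<phi> \<theta>)\<^sup>2) \<partial>cone_measure) < \<infinity>"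
  proof -
    have "(\<integral>\<^sup>+ \<theta>. ennreal ((\<phi> \<theta>)\<^sup>2) \<partial>(cone_measure :: 'a measure)) \<le> (\<integral>\<^sup>+ \<theta>. ennreal ((B + \<bar>c\<bar>)\<^sup>2) \<partial>(cone_measure :: 'a measure))"
    proof (rule nn_integral_mono_AE)
      show "AE \<theta> in cone_measure. ennreal ((\<phi> \<theta>)\<^sup>2) \<le> ennreal ((B + \<bar>c\<bar>)\<^sup>2)"
        using AE_cone_measure_norm
      proof eventually_elim
        case (elim \<theta>)
        have "\<bar>\<phi> \<theta>\<bar> \<le> B + \<bar>c\<bar>" using B[OF elim] by (simp add: \<phi>_def)
        then have "\<bar>\<phi> \<theta>\<bar>\<^sup>2 \<le> (B + \<bar>c\<bar>)\<^sup>2" by (intro power_mono) auto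
        then show ?case by (intro ennreal_leI) simp
      qed
    qed
    also have "\<dots> < \<infinity>" by (simp add: s ennreal_mult_less_top)
    finally show ?thesis .
  qed
  have H2: "(\<integral>\<^sup>+ x. ennreal ((H x)\<^sup>2) \<partial>gauss) = A 2 * (\<integral>\<^sup>+ \<theta>. ennreal ((\<phi> \<theta>)\<^sup>2) \<partial>cone_measure)"
    by (subst polar[symmetric]) (auto simp: H_def power_mult_distrib ennreal_mult)
  have Hint2: "integrable gauss (\<lambda>x. (H x)\<^sup>2)"
  proof (rule integrableI_nonneg)
    show "(\<integral>\<^sup>+ x. ennreal ((H x)\<^sup>2) \<partial>gauss) < \<infinity>"
      unfolding H2 using A2f \<phi>2 by (simp add: ennreal_mult_less_top less_top)
  qed auto
  have Hint: "integrable gauss H"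
    by (rule G.square_integrable_imp_integrable[OF _ Hint2]) simp
  \<comment> \<open>The polar formula is for nonnegative functions, so the mean of \<open>H\<close>
    is computed through its positive and negative parts.\<close>
  have "(\<integral>\<^sup>+ x. ennreal (H x) \<partial>gauss) = A 1 * (\<integral>\<^sup>+ \<theta>. ennreal (\<phi> \<theta>) \<partial>cone_measure)"
    by (subst polar[symmetric]) (auto simp: H_def ennreal_mult')
  moreover have "(\<integral>\<^sup>+ x. ennreal (- H x) \<partial>gauss) = A 1 * (\<integral>\<^sup>+ \<theta>. ennreal (- \<phi> \<theta>) \<partial>cone_measure)"
  proof -
    have "- H x = norm x * (- \<phi> (sgn x))" for x by (simp add: H_def)
    then have "ennreal (- H x) = ennreal (norm x ^ 1) * ennreal (- \<phi> (sgn x))" for x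
      by (simp only: power_one_right ennreal_mult'[OF norm_ge_zero])
    then show ?thesis by (simp only:) (rule polar, measurable)
  qed
  ultimately have "(\<integral>x. H x \<partial>gauss) = 0"
    unfolding real_lebesgue_integral_def[OF Hint] by (simp add: enn2real_mult mean0)
  then have "pvar gauss H = 2 * (\<integral>\<^sup>+ x. ennreal ((H x)\<^sup>2) \<partial>gauss)"
    using pvar_eq[OF prob_space_gauss Hint Hint2]
    by (simp add: nn_integral_eq_integral[OF Hint2] ennreal_mult)
  then have lhs: "pvar gauss H = 2 * (A 2 * (\<integral>\<^sup>+ \<theta>. ennreal ((\<phi> \<theta>)\<^sup>2) \<partial>cone_measure))"
    by (simp add: H2)
  \<comment> \<open>\<open>H\<close> need not be differentiable at the origin, so the line through
    it in direction \<open>b\<close> gets infinite energy. The 2 matches \<open>pvar\<close> being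
    twice the variance.\<close>
  define D where "D b x = (if x - (x \<bullet> b) *\<^sub>R b = 0 then \<infinity> else 2 * ennreal ((V (sgn x) \<bullet> b)\<^sup>2))" for b x
  have [measurable]: "D b \<in> borel_measurable borel" for b unfolding D_def by measurable
  have "pvar gauss H \<le> (\<integral>\<^sup>+ x. (\<Sum>b\<in>Basis. D b x) \<partial>gauss)"
  proof (rule gauss_poincare_lines)
    fix b z :: 'a assume b: "b \<in> Basis" and z: "z \<bullet> b = 0"
    have b1: "b \<bullet> b = 1" "norm b = 1" using b by auto
    interpret N: prob_space std_gauss by (rule prob_space_std_gauss)
    have proj: "(z + t *\<^sub>R b) - ((z + t *\<^sub>R b) \<bullet> b) *\<^sub>R b = z" for t
      by (simp add: inner_add_left z b1)
    show "pvar std_gauss (\<lambda>t. H (z + t *\<^sub>R b)) \<le> (\<integral>\<^sup>+ t. D b (z + t *\<^sub>R b) \<partial>std_gauss)"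
    proof (cases "z = 0")
      case True
      then have "(\<integral>\<^sup>+ t. D b (z + t *\<^sub>R b) \<partial>std_gauss) = (\<integral>\<^sup>+ t. \<infinity> \<partial>std_gauss)"
        by (intro nn_integral_cong) (simp add: D_def b1)
      then show ?thesis using N.emeasure_space_1 by simp
    next
      case False
      let ?p = "\<lambda>t. z + t *\<^sub>R b"
      define m where "m t = norm (?p t)" for t
      have m2: "(m t)\<^sup>2 = z \<bullet> z + t\<^sup>2" for t
        unfolding m_def power2_norm_eq_inner
        using b1 z by (simp add: inner_add inner_commute[of b z] power2_eq_square)
      have m: "m t > 0" for t
      proof -
        have "z \<bullet> z > 0" using False by simp
        then have "(m t)\<^sup>2 > 0" unfolding m2 by (simp add: add_pos_nonneg)
        then show ?thesis by (simp add: m_def)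
      qed
      have p0: "?p t \<noteq> 0" for t using m[of t] by (auto simp: m_def)
      have sg: "sgn (?p t) = ?p t /\<^sub>R m t" for t by (simp add: sgn_div_norm m_def)
      have m_sqrt: "m t = sqrt (z \<bullet> z + t\<^sup>2)" for t
        using m2[of t] m[of t] by (metis less_eq_real_def real_sqrt_unique)
      have m_der: "(m has_real_derivative t / m t) (at t)" for t
      proof -
        have "z \<bullet> z + t\<^sup>2 > 0" using m2[of t] m[of t] by (metis zero_less_power)
        then have "((\<lambda>t. sqrt (z \<bullet> z + t\<^sup>2)) has_real_derivative t / sqrt (z \<bullet> z + t\<^sup>2)) (at t)"
          by (auto intro!: derivative_eq_intros simp: field_simps)
        then show ?thesis by (simp flip: m_sqrt)
      qed
      have mc: "continuous_on UNIV m" unfolding m_def by (intro continuous_intros)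
      define \<theta> where "\<theta> t = ?p t /\<^sub>R m t" for t
      have \<theta>c: "continuous_on UNIV \<theta>"
        unfolding \<theta>_def using m by (intro continuous_intros mc) (metis less_irrefl)
      have \<theta>b: "\<theta> t \<bullet> b = t / m t" for t
        by (simp add: \<theta>_def inner_add_left z b1 divide_inverse mult.commute)
      have \<theta>_der: "(\<theta> has_vector_derivative (b /\<^sub>R m t - (t / (m t)\<^sup>2) *\<^sub>R \<theta> t)) (at t)" for t
      proof -
        have i: "((\<lambda>t. inverse (m t)) has_real_derivative - (t / m t) / (m t)\<^sup>2) (at t)"
          using m[of t] by (auto intro!: derivative_eq_intros m_der simp: power2_eq_square field_simps)
        have "(?p has_vector_derivative b) (at t)"
          by (auto intro!: derivative_eq_intros)
        from has_vector_derivative_scaleR[OF i this]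
        have "(\<theta> has_vector_derivative (inverse (m t) *\<^sub>R b + (- (t / m t) / (m t)\<^sup>2) *\<^sub>R ?p t)) (at t)"
          by (simp add: \<theta>_def[abs_def])
        also have "(- (t / m t) / (m t)\<^sup>2) *\<^sub>R ?p t = - ((t / (m t)\<^sup>2) *\<^sub>R \<theta> t)"
          by (simp add: \<theta>_def divide_inverse mult_ac)
        finally show ?thesis by simp
      qed
      define g where "g t = H (?p t)" for t
      define g' where "g' t = V (\<theta> t) \<bullet> b" for t
      have g: "g t = m t * \<phi> (\<theta> t)" for t by (simp add: g_def H_def sg \<theta>_def m_def)
      have "(g has_real_derivative g' t) (at t)" for t
      proof -
        have "((\<lambda>t. \<Phi> (\<theta> t)) has_derivative (\<lambda>h. (h *\<^sub>R (b /\<^sub>R m t - (t / (m t)\<^sup>2) *\<^sub>R \<theta> t)) \<bullet> \<Psi> (\<theta> t))) (at t)"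
          using has_derivative_compose[OF \<theta>_der[of t, unfolded has_vector_derivative_def] \<Phi>_der[of "\<theta> t"]] .
        then have "((\<lambda>t. \<Phi> (\<theta> t)) has_real_derivative (b /\<^sub>R m t - (t / (m t)\<^sup>2) *\<^sub>R \<theta> t) \<bullet> \<Psi> (\<theta> t)) (at t)"
          by (simp add: has_field_derivative_def mult_commute_abs)
        then have "(g has_real_derivative (t / m t) * \<phi> (\<theta> t) + ((b /\<^sub>R m t - (t / (m t)\<^sup>2) *\<^sub>R \<theta> t) \<bullet> \<Psi> (\<theta> t)) * m t) (at t)"
          unfolding g[abs_def] \<phi>_def by (auto intro!: derivative_eq_intros m_der)
        also have "(t / m t) * \<phi> (\<theta> t) + ((b /\<^sub>R m t - (t / (m t)\<^sup>2) *\<^sub>R \<theta> t) \<bullet> \<Psi> (\<theta> t)) * m t = g' t"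
          using m[of t]
          by (simp add: g'_def V_def T_def inner_diff_left inner_add_left \<theta>b inner_commute[of "\<Psi> _" b] field_simps power2_eq_square)
        finally show ?thesis .
      qed
      moreover have "continuous_on UNIV g'"
        unfolding g'_def V_def T_def \<phi>_def
        by (intro continuous_intros continuous_on_compose2[OF \<Phi>c \<theta>c] continuous_on_compose2[OF \<Psi> \<theta>c] \<theta>c) auto
      ultimately have "(\<integral>\<^sup>+ t. ennreal ((g t - g 0)\<^sup>2) \<partial>std_gauss) \<le> (\<integral>\<^sup>+ t. ennreal ((g' t)\<^sup>2) \<partial>std_gauss)"
        by (rule gaussian_line)
      moreover have "pvar std_gauss g \<le> 2 * (\<integral>\<^sup>+ t. ennreal ((g t - g 0)\<^sup>2) \<partial>std_gauss)"
        unfolding g_def by (intro pvar_le prob_space_std_gauss) measurable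
      ultimately have "pvar std_gauss g \<le> 2 * (\<integral>\<^sup>+ t. ennreal ((g' t)\<^sup>2) \<partial>std_gauss)"
        by (meson mult_left_mono order_trans zero_le)
      also have "\<dots> = (\<integral>\<^sup>+ t. 2 * ennreal ((g' t)\<^sup>2) \<partial>std_gauss)"
      proof (rule nn_integral_cmult[symmetric])
        have [measurable]: "g' \<in> borel_measurable borel"
          using \<open>continuous_on UNIV g'\<close> by (rule borel_measurable_continuous_onI)
        show "(\<lambda>t. ennreal ((g' t)\<^sup>2)) \<in> borel_measurable std_gauss" by measurable
      qed
      also have "\<dots> = (\<integral>\<^sup>+ t. D b (?p t) \<partial>std_gauss)"
        using False by (intro nn_integral_cong) (simp only: D_def proj if_False g'_def sg \<theta>_def)
      finally show ?thesis by (simp add: g_def[abs_def])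
    qed
  qed measurable
  also have "\<dots> = (\<integral>\<^sup>+ x. ennreal (norm x ^ 0) * (2 * ennreal ((norm (V (sgn x)))\<^sup>2)) \<partial>gauss)"
  proof (rule nn_integral_cong_AE)
    have "AE x in lborel. \<forall>b\<in>(Basis :: 'a set). x - (x \<bullet> b) *\<^sub>R b \<noteq> 0"
      by (intro AE_finite_allI AE_lborel_not_in_line d) simp
    then have "AE x in gauss. \<forall>b\<in>(Basis :: 'a set). x - (x \<bullet> b) *\<^sub>R b \<noteq> 0"
      unfolding gauss_def by (subst AE_density) (auto elim: eventually_mono)
    then show "AE x in gauss. (\<Sum>b\<in>Basis. D b x) = ennreal (norm x ^ 0) * (2 * ennreal ((norm (V (sgn x)))\<^sup>2))"
    proof eventually_elim
      case (elim x)
      then have "(\<Sum>b\<in>Basis. D b x) = (\<Sum>b\<in>Basis. 2 * ennreal ((V (sgn x) \<bullet> b)\<^sup>2))"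
        by (intro sum.cong refl) (simp add: D_def)
      also have "\<dots> = 2 * (\<Sum>b\<in>Basis. ennreal ((V (sgn x) \<bullet> b)\<^sup>2))"
        by (rule sum_distrib_left[symmetric])
      also have "(\<Sum>b\<in>Basis. ennreal ((V (sgn x) \<bullet> b)\<^sup>2)) = ennreal ((norm (V (sgn x)))\<^sup>2)"
        by (simp only: power2_norm_eq_sum_Basis sum_ennreal zero_le_power2)
      finally show ?case by simp
    qed
  qed
  also have "\<dots> = A 0 * (\<integral>\<^sup>+ \<theta>. 2 * ennreal ((norm (V \<theta>))\<^sup>2) \<partial>cone_measure)"
    by (rule polar) measurable
  also have "\<dots> = 2 * (A 0 * (\<integral>\<^sup>+ \<theta>. ennreal ((norm (V \<theta>))\<^sup>2) \<partial>cone_measure))"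
    by (subst nn_integral_cmult) (auto simp: mult_ac)
  finally have "A 2 * (\<integral>\<^sup>+ \<theta>. ennreal ((\<phi> \<theta>)\<^sup>2) \<partial>cone_measure)
      \<le> A 0 * (\<integral>\<^sup>+ \<theta>. ennreal ((norm (V \<theta>))\<^sup>2) \<partial>cone_measure)"
    unfolding lhs by (subst (asm) ennreal_mult_le_mult_iff) auto
  then have "ennreal s * (A 2 * (\<integral>\<^sup>+ \<theta>. ennreal ((\<phi> \<theta>)\<^sup>2) \<partial>cone_measure))
      \<le> ennreal s * (A 0 * (\<integral>\<^sup>+ \<theta>. ennreal ((norm (V \<theta>))\<^sup>2) \<partial>cone_measure))"
    by (rule mult_left_mono) simp
  then have "(A 2 * ennreal s) * (\<integral>\<^sup>+ \<theta>. ennreal ((\<phi> \<theta>)\<^sup>2) \<partial>cone_measure)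
      \<le> (A 0 * ennreal s) * (\<integral>\<^sup>+ \<theta>. ennreal ((norm (V \<theta>))\<^sup>2) \<partial>cone_measure)"
    by (simp only: mult_ac)
  then have "ennreal DIM('a) * (\<integral>\<^sup>+ \<theta>. ennreal ((\<phi> \<theta>)\<^sup>2) \<partial>cone_measure)
      \<le> (\<integral>\<^sup>+ \<theta>. ennreal ((norm (V \<theta>))\<^sup>2) \<partial>cone_measure)"
    by (simp only: A0 A2 mult_1)
  \<comment> \<open>The radial and tangential parts of \<open>V\<close> are orthogonal; the radial
    one contributes a copy of the left-hand integral.\<close>
  also have "\<dots> = (\<integral>\<^sup>+ \<theta>. ennreal ((\<phi> \<theta>)\<^sup>2) + ennreal ((norm (T \<theta>))\<^sup>2) \<partial>cone_measure)"
  proof (rule nn_integral_cong_AE)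
    show "AE \<theta> in cone_measure. ennreal ((norm (V \<theta>))\<^sup>2) = ennreal ((\<phi> \<theta>)\<^sup>2) + ennreal ((norm (T \<theta>))\<^sup>2)"
      using AE_cone_measure_norm
    proof eventually_elim
      case (elim \<theta>)
      have t1: "\<theta> \<bullet> \<theta> = 1" using elim by (simp add: norm_eq_1)
      have "\<theta> \<bullet> T \<theta> = 0" by (simp add: T_def inner_diff_right t1)
      then have "(norm (V \<theta>))\<^sup>2 = (\<phi> \<theta>)\<^sup>2 + (norm (T \<theta>))\<^sup>2"
        unfolding power2_norm_eq_inner V_def
        by (simp add: inner_add inner_commute[of "T \<theta>" \<theta>] t1 power2_eq_square)
      then show ?case by simp
    qed
  qed
  also have "\<dots> = (\<integral>\<^sup>+ \<theta>. ennreal ((\<phi> \<theta>)\<^sup>2) \<partial>cone_measure) + (\<integral>\<^sup>+ \<theta>. ennreal ((norm (T \<theta>))\<^sup>2) \<partial>cone_measure)"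
    by (rule nn_integral_add) measurable
  finally have "ennreal DIM('a) * (\<integral>\<^sup>+ \<theta>. ennreal ((\<phi> \<theta>)\<^sup>2) \<partial>cone_measure)
      \<le> (\<integral>\<^sup>+ \<theta>. ennreal ((\<phi> \<theta>)\<^sup>2) \<partial>cone_measure) + (\<integral>\<^sup>+ \<theta>. ennreal ((norm (T \<theta>))\<^sup>2) \<partial>cone_measure)" .
  moreover have "ennreal DIM('a) = 1 + ennreal (DIM('a) - 1)"
    by (subst ennreal_1[symmetric], subst ennreal_plus[symmetric]) (auto simp: of_nat_diff DIM_positive Suc_leI)
  \<comment> \<open>Cancelling that copy lowers \<open>d\<close> to \<open>d - 1\<close>. In
    \<open>ennreal\<close> this requires the finiteness from \<open>\<phi>2\<close>.\<close>
  ultimately have "ennreal (DIM('a) - 1) * (\<integral>\<^sup>+ \<theta>. ennreal ((\<phi> \<theta>)\<^sup>2) \<partial>cone_measure)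
      \<le> (\<integral>\<^sup>+ \<theta>. ennreal ((norm (T \<theta>))\<^sup>2) \<partial>cone_measure)"
    using \<phi>2 by (auto simp: distrib_right ennreal_add_left_cancel_le)
  then show thesis by (intro that[of c]) (simp add: \<phi>_def T_def)
qed

section \<open>Radial measures on balls\<close>

lemma GDERIV_line:
  assumes "\<And>x. GDERIV f x :> G x"
  shows "((\<lambda>t. f (t *\<^sub>R \<theta>)) has_real_derivative G (t *\<^sub>R \<theta>) \<bullet> \<theta>) (at t)"
proof -
  have "((\<lambda>t. t *\<^sub>R \<theta>) has_derivative (\<lambda>h. h *\<^sub>R \<theta>)) (at t)"
    by (auto intro!: derivative_eq_intros)
  from has_derivative_compose[OF this assms[unfolded gderiv_def]]
  have "((\<lambda>t. f (t *\<^sub>R \<theta>)) has_derivative (\<lambda>h. (h *\<^sub>R \<theta>) \<bullet> G (t *\<^sub>R \<theta>))) (at t)" .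
  then show ?thesis
    by (simp add: has_field_derivative_def inner_commute[of \<theta>] mult_commute_abs)
qed

lemma GDERIV_continuous_on:
  assumes "\<And>x. GDERIV f x :> G x"
  shows "continuous_on UNIV f"
  using assms unfolding gderiv_def by (meson has_derivative_continuous continuous_at_imp_continuous_on)

lemma nn_integral_ball_polar:
  fixes h :: "'a::euclidean_space \<Rightarrow> real"
  assumes h: "continuous_on UNIV h" "\<And>x. h x \<ge> 0" and \<phi>: "continuous_on UNIV \<phi>"
  shows "(\<integral>\<^sup>+ x. indicator (ball 0 R) x * ennreal (h x * exp (- \<phi> (norm x))) \<partial>lborel)
    = (\<integral>\<^sup>+ \<theta>. ennreal (integral {0..R} (\<lambda>r. h (r *\<^sub>R \<theta>) * (r ^ (DIM('a) - 1) * exp (- \<phi> r)))) \<partial>cone_measure)"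
proof -
  let ?F = "\<lambda>\<theta> r. ennreal (r ^ (DIM('a) - 1)) * indicator {0..} r *
        (indicator (ball 0 R) (r *\<^sub>R \<theta>) * ennreal (h (r *\<^sub>R \<theta>) * exp (- \<phi> (norm (r *\<^sub>R \<theta>)))))"
  have [measurable]: "h \<in> borel_measurable borel" "\<phi> \<in> borel_measurable borel" 
    using h \<phi> by (auto intro: borel_measurable_continuous_onI)
  have [measurable]: "ball (0 :: 'a) R \<in> sets borel" by simp
  have "(\<integral>\<^sup>+ x. indicator (ball 0 R) x * ennreal (h x * exp (- \<phi> (norm x))) \<partial>lborel)
    = (\<integral>\<^sup>+ \<theta>. (\<integral>\<^sup>+ r. ?F \<theta> r \<partial>lborel) \<partial>(cone_measure :: 'a measure))"
    by (rule nn_integral_polar) measurable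
  also have "\<dots> = (\<integral>\<^sup>+ \<theta>. ennreal (integral {0..R} (\<lambda>r. h (r *\<^sub>R \<theta>) * (r ^ (DIM('a) - 1) * exp (- \<phi> r)))) \<partial>cone_measure)"
  proof (rule nn_integral_cong_AE)
    show "AE \<theta> in cone_measure. (\<integral>\<^sup>+ r. ?F \<theta> r \<partial>lborel)
       = ennreal (integral {0..R} (\<lambda>r. h (r *\<^sub>R \<theta>) * (r ^ (DIM('a) - 1) * exp (- \<phi> r))))"
      using AE_cone_measure_norm
    proof eventually_elim
      case (elim \<theta>)
      have "(\<integral>\<^sup>+ r. ?F \<theta> r \<partial>lborel)
        = (\<integral>\<^sup>+ r. ennreal (h (r *\<^sub>R \<theta>) * (r ^ (DIM('a) - 1) * exp (- \<phi> r))) * indicator {0..R} r \<partial>lborel)"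
      proof (rule nn_integral_cong_AE)
        show "AE r in lborel. ?F \<theta> r
          = ennreal (h (r *\<^sub>R \<theta>) * (r ^ (DIM('a) - 1) * exp (- \<phi> r))) * indicator {0..R} r"
          \<comment> \<open>The ball is open and the interval closed, so the integrands may differ
            at \<open>r = R\<close>.\<close>
          using AE_lborel_singleton[of R]
        proof eventually_elim
          case (elim r)
          then show ?case using \<open>norm \<theta> = 1\<close> h(2)[of "r *\<^sub>R \<theta>"]
            by (auto simp: mult_ac simp flip: ennreal_mult' split: split_indicator)
        qed
      qed
      also have "\<dots> = ennreal (integral {0..R} (\<lambda>r. h (r *\<^sub>R \<theta>) * (r ^ (DIM('a) - 1) * exp (- \<phi> r))))"
        using h
        by (intro nn_integral_Icc continuous_intros continuous_on_compose2[OF h(1)] continuous_on_subset[OF \<phi>]) auto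
      finally show ?case .
    qed
  qed
  finally show ?thesis .
qed

text \<open>A radial density on a ball is a product in polar coordinates, so the variance splits into a
  radial part and the variance of \<open>\<theta> \<mapsto> \<Phi> \<theta>\<close>, the radial average.\<close>

lemma radial_poincare:
  fixes f :: "'a::euclidean_space \<Rightarrow> real" and \<phi> \<phi>' \<phi>'' :: "real \<Rightarrow> real" and C R :: real
  assumes R: "0 < R" and C: "0 < C"
    and \<phi>: "\<And>r. (\<phi> has_real_derivative \<phi>' r) (at r)"
    and \<phi>': "\<And>r. (\<phi>' has_real_derivative \<phi>'' r) (at r)" "\<phi>' 0 \<ge> 0"
    and \<phi>'': "\<And>r. \<phi>'' r \<ge> 0"
    and moment: "integral {0..R} (\<lambda>r. r\<^sup>2 * (r ^ (DIM('a) - 1) * exp (- \<phi> r)))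
      < C * DIM('a) / 2 * integral {0..R} (\<lambda>r. r ^ (DIM('a) - 1) * exp (- \<phi> r))"
    and f: "\<And>x. GDERIV f x :> G x" and G: "continuous_on UNIV G"
  shows "\<exists>c. (\<integral>\<^sup>+ x. indicator (ball 0 R) x * ennreal ((f x - c)\<^sup>2 * exp (- \<phi> (norm x))) \<partial>lborel)
    \<le> ennreal C * (\<integral>\<^sup>+ x. indicator (ball 0 R) x * ennreal ((norm (G x))\<^sup>2 * exp (- \<phi> (norm x))) \<partial>lborel)"
proof -
  define n where "n = DIM('a) - 1"
  define \<rho> where "\<rho> r = r ^ n * exp (- \<phi> r)" for r
  have fc: "continuous_on UNIV f" by (rule GDERIV_continuous_on[OF f])
  have \<phi>c: "continuous_on UNIV \<phi>" and \<phi>'c: "continuous_on UNIV \<phi>'"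
    using \<phi> \<phi>' by (meson DERIV_isCont continuous_at_imp_continuous_on)+
  have \<rho>c: "continuous_on X \<rho>" for X
    unfolding \<rho>_def by (intro continuous_intros continuous_on_subset[OF \<phi>c]) auto
  have \<rho>0: "\<rho> r \<ge> 0" if "r \<ge> 0" for r using that by (simp add: \<rho>_def)
  have mono: "mono_on {0..R} \<phi>'"
  proof (rule mono_onI)
    fix r s :: real assume "r \<le> s"
    then show "\<phi>' r \<le> \<phi>' s" using \<phi>'(1) \<phi>'' by (meson DERIV_nonneg_imp_nondecreasing)
  qed
  have line: "((\<lambda>r. f (r *\<^sub>R \<theta>)) has_real_derivative G (r *\<^sub>R \<theta>) \<bullet> \<theta>) (at r within X)" for r \<theta> X
    using GDERIV_line[OF f] by (rule has_field_derivative_at_within)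
  have fray: "continuous_on X (\<lambda>r. f (r *\<^sub>R \<theta>))" and Gray: "continuous_on X (\<lambda>r. G (r *\<^sub>R \<theta>))" for X \<theta>
    by (intro continuous_on_compose2[OF fc] continuous_on_compose2[OF G] continuous_intros; simp)+
  define I where "I F = integral {0..R} (\<lambda>r. F r * \<rho> r)" for F
  define M where "M = integral {0..R} \<rho>"
  define S where "S = I power2"
  have I_mono: "I F \<le> I H" if "continuous_on {0..R} F" "continuous_on {0..R} H" "\<And>r. F r \<le> H r" for F H
    unfolding I_def using that \<rho>0
    by (intro integral_le integrable_continuous_real continuous_intros \<rho>c mult_right_mono) auto
  have polar: "(\<integral>\<^sup>+ x. indicator (ball 0 R) x * ennreal (h x * exp (- \<phi> (norm x))) \<partial>lborel)
      = (\<integral>\<^sup>+ \<theta>. ennreal (I (\<lambda>r. h (r *\<^sub>R \<theta>))) \<partial>cone_measure)"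
    if "continuous_on UNIV h" "\<And>x. h x \<ge> 0" for h :: "'a \<Rightarrow> real"
    using nn_integral_ball_polar[OF that \<phi>c] by (simp add: I_def \<rho>_def n_def)
  have lhs: "(\<integral>\<^sup>+ x. indicator (ball 0 R) x * ennreal ((f x - c)\<^sup>2 * exp (- \<phi> (norm x))) \<partial>lborel)
      = (\<integral>\<^sup>+ \<theta>. ennreal (I (\<lambda>r. (f (r *\<^sub>R \<theta>) - c)\<^sup>2)) \<partial>(cone_measure :: 'a measure))" for c
    by (rule polar) (auto intro!: continuous_intros fc)
  have rhs: "(\<integral>\<^sup>+ x. indicator (ball 0 R) x * ennreal ((norm (G x))\<^sup>2 * exp (- \<phi> (norm x))) \<partial>lborel)
      = (\<integral>\<^sup>+ \<theta>. ennreal (I (\<lambda>r. (norm (G (r *\<^sub>R \<theta>)))\<^sup>2)) \<partial>(cone_measure :: 'a measure))"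
    by (rule polar) (auto intro!: continuous_intros G)
  have I_cont: "continuous_on UNIV (\<lambda>\<theta>. I (h \<theta>))"
    if "continuous_on UNIV (\<lambda>(\<theta>, r). h \<theta> r)" for h :: "'a \<Rightarrow> real \<Rightarrow> real"
  proof -
    have "continuous_on (UNIV \<times> cbox 0 R) (\<lambda>(\<theta>, r). h \<theta> r * \<rho> r)"
      unfolding split_beta
      by (intro continuous_intros continuous_on_compose2[OF \<rho>c[of UNIV]] continuous_on_subset[OF that[unfolded split_beta]]) auto
    from integral_continuous_on_param[OF this] show ?thesis by (simp add: I_def)
  qed
  have Gc: "continuous_on UNIV (\<lambda>(\<theta>, r). G (r *\<^sub>R \<theta>))" and fcp: "continuous_on UNIV (\<lambda>(\<theta>, r). f (r *\<^sub>R \<theta>))"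
    unfolding split_beta by (intro continuous_intros continuous_on_compose2[OF G] continuous_on_compose2[OF fc]; simp)+
  show ?thesis
  proof (cases "DIM('a) = 1")
    case True
    then have n0: "n = 0" by (simp add: n_def)
    \<comment> \<open>In dimension one each direction carries its own Dirichlet problem, because
      \<open>f - f 0\<close> vanishes at the common endpoint.\<close>
    have "I (\<lambda>r. (f (r *\<^sub>R \<theta>) - f 0)\<^sup>2) \<le> C * I (\<lambda>r. (norm (G (r *\<^sub>R \<theta>)))\<^sup>2)" if \<theta>: "norm \<theta> = 1" for \<theta>
    proof -
      have "I (\<lambda>r. (f (r *\<^sub>R \<theta>) - f 0)\<^sup>2) \<le> C * I (\<lambda>r. (G (r *\<^sub>R \<theta>) \<bullet> \<theta>)\<^sup>2)"
        unfolding I_def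
      proof (rule halfline_poincare[where V = \<phi>'])
        show "(\<rho> has_real_derivative - \<phi>' s * \<rho> s) (at s within {0..R})" for s
          unfolding \<rho>_def n0 by (auto intro!: derivative_eq_intros has_field_derivative_at_within[OF \<phi>])
        show "integral {0..R} (\<lambda>s. s\<^sup>2 * \<rho> s) < C / 2 * integral {0..R} \<rho>"
          using moment by (simp add: \<rho>_def[abs_def] n_def True)
        show "((\<lambda>r. f (r *\<^sub>R \<theta>) - f 0) has_real_derivative G (s *\<^sub>R \<theta>) \<bullet> \<theta>) (at s within {0..R})" for s
          using line[of \<theta> s] by (auto intro!: derivative_eq_intros)
        show "continuous_on {0..R} (\<lambda>s. G (s *\<^sub>R \<theta>) \<bullet> \<theta>)" by (intro continuous_intros Gray)
      qed (use R C mono \<phi>'(2) continuous_on_subset[OF \<phi>'c subset_UNIV] in \<open>auto simp: \<rho>_def n0\<close>)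
      also have "\<dots> \<le> C * I (\<lambda>r. (norm (G (r *\<^sub>R \<theta>)))\<^sup>2)"
      proof (intro mult_left_mono I_mono continuous_intros Gray)
        fix r
        have "\<bar>G (r *\<^sub>R \<theta>) \<bullet> \<theta>\<bar> \<le> norm (G (r *\<^sub>R \<theta>))" using Cauchy_Schwarz_ineq2[of "G (r *\<^sub>R \<theta>)" \<theta>] \<theta> by simp
        then have "\<bar>G (r *\<^sub>R \<theta>) \<bullet> \<theta>\<bar>\<^sup>2 \<le> (norm (G (r *\<^sub>R \<theta>)))\<^sup>2" by (intro power_mono) auto
        then show "(G (r *\<^sub>R \<theta>) \<bullet> \<theta>)\<^sup>2 \<le> (norm (G (r *\<^sub>R \<theta>)))\<^sup>2" by simp
      qed (use C in simp)
      finally show ?thesis .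
    qed
    then have "(\<integral>\<^sup>+ \<theta>. ennreal (I (\<lambda>r. (f (r *\<^sub>R \<theta>) - f 0)\<^sup>2)) \<partial>(cone_measure :: 'a measure))
        \<le> (\<integral>\<^sup>+ \<theta>. ennreal (C * I (\<lambda>r. (norm (G (r *\<^sub>R \<theta>)))\<^sup>2)) \<partial>(cone_measure :: 'a measure))"
      using AE_cone_measure_norm by (intro nn_integral_mono_AE) (auto elim!: eventually_mono intro!: ennreal_leI)
    also have "\<dots> = (\<integral>\<^sup>+ \<theta>. ennreal C * ennreal (I (\<lambda>r. (norm (G (r *\<^sub>R \<theta>)))\<^sup>2)) \<partial>(cone_measure :: 'a measure))"
      using C by (simp add: ennreal_mult')
    also have "\<dots> = ennreal C * (\<integral>\<^sup>+ \<theta>. ennreal (I (\<lambda>r. (norm (G (r *\<^sub>R \<theta>)))\<^sup>2)) \<partial>(cone_measure :: 'a measure))"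
    proof (rule nn_integral_cmult)
      have "continuous_on UNIV (\<lambda>\<theta>. I (\<lambda>r. (norm (G (r *\<^sub>R \<theta>)))\<^sup>2))"
        using Gc by (intro I_cont) (simp add: split_beta, intro continuous_intros)
      then have [measurable]: "(\<lambda>\<theta>. I (\<lambda>r. (norm (G (r *\<^sub>R \<theta>)))\<^sup>2)) \<in> borel_measurable borel"
        by (rule borel_measurable_continuous_onI)
      show "(\<lambda>\<theta>. ennreal (I (\<lambda>r. (norm (G (r *\<^sub>R \<theta>)))\<^sup>2))) \<in> borel_measurable cone_measure" by measurable
    qed
    finally show ?thesis by (intro exI[of _ "f 0"]) (simp only: lhs rhs)
  next
    case False
    then have d: "2 \<le> DIM('a)" using DIM_positive[where 'a = 'a] by linarith
    then have n: "n \<ge> 1" "real n = DIM('a) - 1" by (auto simp: n_def)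
    have int: "(\<lambda>r. F r * \<rho> r) integrable_on {0..R}" if "continuous_on {0..R} F" for F
      by (intro integrable_continuous_real continuous_intros that \<rho>c)
    have I_nonneg: "I F \<ge> 0" if "continuous_on {0..R} F" "\<And>r. F r \<ge> 0" for F
      unfolding I_def using that \<rho>0 by (intro integral_nonneg int mult_nonneg_nonneg) auto
    have I_lin: "I (\<lambda>r. F r + a * H r + b * K r) = I F + a * I H + b * I K"
      if "continuous_on {0..R} F" "continuous_on {0..R} H" "continuous_on {0..R} K" for F H K a b
    proof -
      have "I (\<lambda>r. F r + a * H r + b * K r) = integral {0..R} (\<lambda>r. (F r * \<rho> r + a * (H r * \<rho> r)) + b * (K r * \<rho> r))"
        unfolding I_def by (simp add: algebra_simps)
      moreover have "((\<lambda>r. (F r * \<rho> r + a * (H r * \<rho> r)) + b * (K r * \<rho> r)) has_integral (I F + a * I H + b * I K)) {0..R}"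
        unfolding I_def using that
        by (intro has_integral_add has_integral_mult_right integrable_integral int)
      then have "integral {0..R} (\<lambda>r. (F r * \<rho> r + a * (H r * \<rho> r)) + b * (K r * \<rho> r)) = I F + a * I H + b * I K"
        by (rule integral_unique)
      ultimately show ?thesis by simp
    qed
    have pos: "integral {0..R} (\<lambda>r. r ^ k * \<rho> r) > 0" for k
    proof -
      have c: "continuous_on {0..R} (\<lambda>r. r ^ k * \<rho> r)" by (intro continuous_intros \<rho>c)
      have "integral {0..R} (\<lambda>r. r ^ k * \<rho> r) \<noteq> 0"
      proof
        assume "integral {0..R} (\<lambda>r. r ^ k * \<rho> r) = 0"
        then have "\<forall>r\<in>{0..R}. r ^ k * \<rho> r = 0"
          using integral_eq_0_iff[OF c] R \<rho>0 by auto
        from bspec[OF this, of R] show False using R by (simp add: \<rho>_def)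
      qed
      moreover have "integral {0..R} (\<lambda>r. r ^ k * \<rho> r) \<ge> 0"
        using \<rho>0 by (intro integral_nonneg integrable_continuous_real c) auto
      ultimately show ?thesis by simp
    qed
    have M: "M > 0" using pos[of 0] by (simp add: M_def)
    have S: "S > 0" using pos[of 2] by (simp add: S_def I_def)
    define K where "K = S / (n * M)"
    have K0: "K \<ge> 0" using S M by (simp add: K_def)
    \<comment> \<open>The only place where the factor 2 is spent: \<open>d/2 <= d - 1\<close> for
      \<open>d >= 2\<close>.\<close>
    have KC: "K \<le> C"
    proof -
      have "S < C * DIM('a) / 2 * M"
        using moment by (simp add: S_def I_def M_def \<rho>_def[abs_def] n_def)
      also have "\<dots> \<le> C * (n * M)"
        using n(2) d C M by (simp add: field_simps)
      finally have "S \<le> C * (n * M)" by simp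
      then show ?thesis unfolding K_def using n(1) M by (subst pos_divide_le_eq) auto
    qed
    define \<Phi> where "\<Phi> \<theta> = I (\<lambda>r. f (r *\<^sub>R \<theta>)) / M" for \<theta>
    define Y where "Y \<theta> = integral {0..R} (\<lambda>r. (r * \<rho> r) *\<^sub>R G (r *\<^sub>R \<theta>))" for \<theta>
    have Yint: "(\<lambda>r. (r * \<rho> r) *\<^sub>R G (r *\<^sub>R \<theta>)) integrable_on {0..R}" for \<theta>
      by (intro integrable_continuous_real continuous_intros \<rho>c Gray)
    have \<Phi>_der: "GDERIV \<Phi> \<theta> :> Y \<theta> /\<^sub>R M" for \<theta>
    proof -
      \<comment> \<open>Differentiation under the integral sign takes the derivative as a bounded
        linear functional, here the inner product with the gradient; the factor \<open>r\<close>
        comes from the chain rule.\<close>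
      let ?fx = "\<lambda>\<theta> r. blinfun_inner_left ((r * \<rho> r) *\<^sub>R G (r *\<^sub>R \<theta>))"
      have "((\<lambda>\<theta>. integral (cbox 0 R) (\<lambda>r. f (r *\<^sub>R \<theta>) * \<rho> r)) has_derivative integral (cbox 0 R) (?fx \<theta>)) (at \<theta> within UNIV)"
      proof (rule leibniz_rule)
        fix \<theta> r
        have "((\<lambda>\<theta>. r *\<^sub>R \<theta>) has_derivative (\<lambda>h. r *\<^sub>R h)) (at \<theta>)" for \<theta> :: 'a
          by (auto intro!: derivative_eq_intros)
        from has_derivative_compose[OF this f[unfolded gderiv_def]]
        have "((\<lambda>\<theta>. f (r *\<^sub>R \<theta>) * \<rho> r) has_derivative (\<lambda>h. ((r *\<^sub>R h) \<bullet> G (r *\<^sub>R \<theta>)) * \<rho> r)) (at \<theta>)"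
          by (intro has_derivative_mult_left)
        also have "(\<lambda>h. ((r *\<^sub>R h) \<bullet> G (r *\<^sub>R \<theta>)) * \<rho> r) = blinfun_apply (?fx \<theta> r)"
          by (auto simp: fun_eq_iff)
        finally show "((\<lambda>\<theta>. f (r *\<^sub>R \<theta>) * \<rho> r) has_derivative blinfun_apply (?fx \<theta> r)) (at \<theta> within UNIV)" by simp
      next
        show "(\<lambda>r. f (r *\<^sub>R \<theta>) * \<rho> r) integrable_on cbox 0 R" for \<theta>
          using int[OF fray] by simp
        show "continuous_on (UNIV \<times> cbox 0 R) (\<lambda>(\<theta>, r). ?fx \<theta> r)"
          unfolding split_beta
          by (intro bounded_linear.continuous_on[OF bounded_linear_blinfun_inner_left] continuous_intros
              continuous_on_compose2[OF \<rho>c[of UNIV]] continuous_on_compose2[OF G]) auto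
      qed auto
      moreover have "integral (cbox 0 R) (?fx \<theta>) = blinfun_inner_left (Y \<theta>)"
        unfolding Y_def
        using integral_linear[OF Yint bounded_linear_blinfun_inner_left, of \<theta>] by (simp add: o_def)
      ultimately have "((\<lambda>\<theta>. I (\<lambda>r. f (r *\<^sub>R \<theta>))) has_derivative (\<lambda>h. h \<bullet> Y \<theta>)) (at \<theta>)"
        by (simp add: I_def)
      from has_derivative_mult_right[OF this, of "inverse M"] show ?thesis
        by (simp add: gderiv_def \<Phi>_def[abs_def] divide_inverse mult.commute)
    qed
    have Yc: "continuous_on UNIV Y"
    proof -
      have "continuous_on (UNIV \<times> cbox 0 R) (\<lambda>(\<theta>, r). (r * \<rho> r) *\<^sub>R G (r *\<^sub>R \<theta>))"
        unfolding split_beta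
        by (intro continuous_intros continuous_on_compose2[OF \<rho>c[of UNIV]] continuous_on_compose2[OF G]) auto
      from integral_continuous_on_param[OF this] show ?thesis by (simp add: Y_def[abs_def])
    qed
    \<comment> \<open>For a unit vector \<theta>, this is the projection onto the tangent space of
      the sphere.\<close>
    define P where "P \<theta> v = v - (\<theta> \<bullet> v) *\<^sub>R \<theta>" for \<theta> v :: 'a
    have P_scale: "P \<theta> (a *\<^sub>R v) = a *\<^sub>R P \<theta> v" for \<theta> v :: 'a and a
      by (simp add: P_def scaleR_diff_right)
    have YMc: "continuous_on UNIV (\<lambda>\<theta>. Y \<theta> /\<^sub>R M)" by (intro continuous_intros Yc)
    obtain c where c: "ennreal (DIM('a) - 1) * (\<integral>\<^sup>+ \<theta>. ennreal ((\<Phi> \<theta> - c)\<^sup>2) \<partial>cone_measure)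
      \<le> (\<integral>\<^sup>+ \<theta>. ennreal ((norm (P \<theta> (Y \<theta> /\<^sub>R M)))\<^sup>2) \<partial>cone_measure)"
      using cone_poincare[OF d \<Phi>_der YMc] unfolding P_def by blast
    define J1 where "J1 \<theta> = I (\<lambda>r. (G (r *\<^sub>R \<theta>) \<bullet> \<theta>)\<^sup>2)" for \<theta>
    define J2 where "J2 \<theta> = I (\<lambda>r. (norm (P \<theta> (G (r *\<^sub>R \<theta>))))\<^sup>2)" for \<theta>
    have J1_nonneg: "J1 \<theta> \<ge> 0" and J2_nonneg: "J2 \<theta> \<ge> 0" for \<theta>
      unfolding J1_def J2_def P_def by (intro I_nonneg continuous_intros Gray; simp)+
    have Gp: "continuous_on UNIV (\<lambda>p. G (snd p *\<^sub>R fst p))"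
      by (intro continuous_on_compose2[OF G] continuous_intros) auto
    have "continuous_on UNIV J1"
      unfolding J1_def[abs_def] by (rule I_cont) (unfold split_beta, intro continuous_intros Gp)
    moreover have "continuous_on UNIV J2"
      unfolding J2_def[abs_def] P_def by (rule I_cont) (unfold split_beta, intro continuous_intros Gp)
    ultimately have [measurable]: "J1 \<in> borel_measurable borel" "J2 \<in> borel_measurable borel"
      by (auto intro: borel_measurable_continuous_onI)
    have [measurable]: "\<Phi> \<in> borel_measurable borel"
      using GDERIV_continuous_on[OF \<Phi>_der] by (rule borel_measurable_continuous_onI)
    \<comment> \<open>The tangential gradient of the radial average carries the weight
      \<open>r\<close>. Cauchy-Schwarz, as nonnegativity of the integral of
      \<open>|v - (r/S) w|^2\<close>, again produces the second moment \<open>S\<close>.\<close>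
    have angular: "(norm (P \<theta> (Y \<theta> /\<^sub>R M)))\<^sup>2 \<le> S / M\<^sup>2 * J2 \<theta>" for \<theta>
    proof -
      define w where "w = P \<theta> (Y \<theta>)"
      define v where "v r = P \<theta> (G (r *\<^sub>R \<theta>))" for r
      have vc: "continuous_on {0..R} v" unfolding v_def P_def by (intro continuous_intros Gray)
      have wv: "w \<bullet> w = I (\<lambda>r. r * (v r \<bullet> w))"
      proof -
        have lin: "bounded_linear (\<lambda>y. P \<theta> y \<bullet> w)"
          unfolding P_def by (intro bounded_linear_intros)
        have "w \<bullet> w = integral {0..R} (\<lambda>r. P \<theta> ((r * \<rho> r) *\<^sub>R G (r *\<^sub>R \<theta>)) \<bullet> w)"
          using integral_linear[OF Yint lin, of \<theta>]
          unfolding o_def Y_def[symmetric] w_def[symmetric] by simp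
        also have "\<dots> = I (\<lambda>r. r * (v r \<bullet> w))"
          by (simp add: P_scale I_def v_def mult_ac)
        finally show ?thesis .
      qed
      have "0 \<le> I (\<lambda>r. (norm (v r - (r / S) *\<^sub>R w))\<^sup>2)"
        using S by (intro I_nonneg continuous_intros vc) auto
      also have "I (\<lambda>r. (norm (v r - (r / S) *\<^sub>R w))\<^sup>2)
          = I (\<lambda>r. (norm (v r))\<^sup>2 + (- 2 / S) * (r * (v r \<bullet> w)) + (w \<bullet> w / S\<^sup>2) * r\<^sup>2)"
        unfolding power2_norm_eq_inner
        by (simp add: inner_diff inner_commute[of w "v _"] algebra_simps power2_eq_square)
      also have "\<dots> = J2 \<theta> + (- 2 / S) * (w \<bullet> w) + (w \<bullet> w / S\<^sup>2) * S"
        unfolding J2_def S_def wv v_def[symmetric] by (intro I_lin continuous_intros vc)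
      finally have "w \<bullet> w \<le> S * J2 \<theta>" using S by (simp add: field_simps power2_eq_square)
      moreover have "(norm (P \<theta> (Y \<theta> /\<^sub>R M)))\<^sup>2 = (w \<bullet> w) / M\<^sup>2"
      proof -
        have "P \<theta> (Y \<theta> /\<^sub>R M) = w /\<^sub>R M" by (simp add: w_def P_scale)
        then show ?thesis using M by (simp add: power2_norm_eq_inner[symmetric] power_divide divide_inverse power_mult_distrib power_inverse mult_ac)
      qed
      ultimately show ?thesis using M by (simp add: divide_right_mono)
    qed
    \<comment> \<open>On each ray the second moment about \<open>c\<close> splits at the ray mean
      \<open>\<Phi> \<theta>\<close>; the fluctuation is left to the one-dimensional Neumann
      inequality.\<close>
    have radial: "I (\<lambda>r. (f (r *\<^sub>R \<theta>) - c)\<^sup>2) \<le> K * J1 \<theta> + M * (\<Phi> \<theta> - c)\<^sup>2" for \<theta>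
    proof -
      have fcR: "continuous_on {0..R} (\<lambda>r. f (r *\<^sub>R \<theta>))" by (rule fray)
      have I1: "I (\<lambda>r. 1) = M" by (simp add: I_def M_def)
      have "I (\<lambda>r. f (r *\<^sub>R \<theta>) - \<Phi> \<theta>) = I (\<lambda>r. f (r *\<^sub>R \<theta>) + (- \<Phi> \<theta>) * 1 + 0 * 1)" by simp
      also have "\<dots> = 0"
        using M fcR by (subst I_lin) (auto simp: I1 \<Phi>_def)
      finally have mean: "I (\<lambda>r. f (r *\<^sub>R \<theta>) - \<Phi> \<theta>) = 0" .
      have "I (\<lambda>r. (f (r *\<^sub>R \<theta>) - c)\<^sup>2)
          = I (\<lambda>r. (f (r *\<^sub>R \<theta>) - \<Phi> \<theta>)\<^sup>2 + (2 * (\<Phi> \<theta> - c)) * (f (r *\<^sub>R \<theta>) - \<Phi> \<theta>) + (\<Phi> \<theta> - c)\<^sup>2 * 1)"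
        by (simp add: power2_eq_square algebra_simps)
      also have "\<dots> = I (\<lambda>r. (f (r *\<^sub>R \<theta>) - \<Phi> \<theta>)\<^sup>2) + (\<Phi> \<theta> - c)\<^sup>2 * M"
        by (subst I_lin) (auto intro!: continuous_intros fcR simp: mean I1)
      also have "I (\<lambda>r. (f (r *\<^sub>R \<theta>) - \<Phi> \<theta>)\<^sup>2) \<le> K * J1 \<theta>"
        using neumann_poincare[of R n \<phi> \<phi>' \<phi>'' "\<lambda>r. f (r *\<^sub>R \<theta>)" "\<lambda>r. G (r *\<^sub>R \<theta>) \<bullet> \<theta>"]
          R n(1) has_field_derivative_at_within[OF \<phi>] continuous_on_subset[OF \<phi>'c subset_UNIV] \<phi>'(1) \<phi>'' line
        by (simp add: I_def \<Phi>_def K_def S_def M_def J1_def \<rho>_def[abs_def] continuous_on_inner Gray)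
      finally show ?thesis by (simp add: mult.commute)
    qed
    have pyth: "(norm v)\<^sup>2 = (v \<bullet> \<theta>)\<^sup>2 + (norm (P \<theta> v))\<^sup>2" if "norm \<theta> = 1" for \<theta> v
    proof -
      have "\<theta> \<bullet> \<theta> = 1" using that by (simp add: norm_eq_1)
      then show ?thesis
        unfolding power2_norm_eq_inner P_def
        by (simp add: inner_diff inner_commute[of \<theta> v] algebra_simps power2_eq_square)
    qed
    have "(\<integral>\<^sup>+ \<theta>. ennreal (I (\<lambda>r. (f (r *\<^sub>R \<theta>) - c)\<^sup>2)) \<partial>cone_measure)
        \<le> (\<integral>\<^sup>+ \<theta>. ennreal (K * J1 \<theta>) + ennreal M * ennreal ((\<Phi> \<theta> - c)\<^sup>2) \<partial>cone_measure)"
    proof (intro nn_integral_mono)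
      fix \<theta>
      show "ennreal (I (\<lambda>r. (f (r *\<^sub>R \<theta>) - c)\<^sup>2)) \<le> ennreal (K * J1 \<theta>) + ennreal M * ennreal ((\<Phi> \<theta> - c)\<^sup>2)"
        using ennreal_leI[OF radial[of \<theta>]] K0 M J1_nonneg[of \<theta>] by (simp add: ennreal_mult)
    qed
    also have "\<dots> = (\<integral>\<^sup>+ \<theta>. ennreal (K * J1 \<theta>) \<partial>cone_measure) + ennreal M * (\<integral>\<^sup>+ \<theta>. ennreal ((\<Phi> \<theta> - c)\<^sup>2) \<partial>cone_measure)"
      by (subst nn_integral_add, measurable) (subst nn_integral_cmult, measurable)
    \<comment> \<open>The angular constant is \<open>(M/n) * (S/M^2) = S/(n M)\<close>, the same
      \<open>K\<close> as in the radial part, so both energies combine with one constant.\<close>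
    also have "ennreal M * (\<integral>\<^sup>+ \<theta>. ennreal ((\<Phi> \<theta> - c)\<^sup>2) \<partial>cone_measure)
        = ennreal (M / n) * (ennreal (DIM('a) - 1) * (\<integral>\<^sup>+ \<theta>. ennreal ((\<Phi> \<theta> - c)\<^sup>2) \<partial>cone_measure))"
      using n M by (simp add: mult.assoc[symmetric] flip: ennreal_mult)
    also have "\<dots> \<le> ennreal (M / n) * (\<integral>\<^sup>+ \<theta>. ennreal (S / M\<^sup>2 * J2 \<theta>) \<partial>cone_measure)"
    proof (intro mult_left_mono order_trans[OF c] nn_integral_mono ennreal_leI angular)
    qed simp
    also have "\<dots> = (\<integral>\<^sup>+ \<theta>. ennreal (M / n) * ennreal (S / M\<^sup>2 * J2 \<theta>) \<partial>cone_measure)"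
      by (rule nn_integral_cmult[symmetric]) measurable
    also have "\<dots> = (\<integral>\<^sup>+ \<theta>. ennreal (K * J2 \<theta>) \<partial>cone_measure)"
    proof (intro nn_integral_cong)
      fix \<theta>
      have "M / n * (S / M\<^sup>2 * J2 \<theta>) = K * J2 \<theta>" using M by (simp add: K_def power2_eq_square)
      then show "ennreal (M / n) * ennreal (S / M\<^sup>2 * J2 \<theta>) = ennreal (K * J2 \<theta>)"
        using M by (simp flip: ennreal_mult')
    qed
    also have "(\<integral>\<^sup>+ \<theta>. ennreal (K * J1 \<theta>) \<partial>cone_measure) + \<dots> = (\<integral>\<^sup>+ \<theta>. ennreal (K * J1 \<theta>) + ennreal (K * J2 \<theta>) \<partial>cone_measure)"
      by (rule nn_integral_add[symmetric]) measurable
    also have "\<dots> \<le> (\<integral>\<^sup>+ \<theta>. ennreal C * ennreal (J1 \<theta> + J2 \<theta>) \<partial>cone_measure)"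
    proof (intro nn_integral_mono)
      fix \<theta>
      have "K * J1 \<theta> + K * J2 \<theta> \<le> C * (J1 \<theta> + J2 \<theta>)"
        using KC J1_nonneg[of \<theta>] J2_nonneg[of \<theta>] by (simp add: mult_right_mono flip: distrib_left)
      then show "ennreal (K * J1 \<theta>) + ennreal (K * J2 \<theta>) \<le> ennreal C * ennreal (J1 \<theta> + J2 \<theta>)"
        using ennreal_leI C K0 J1_nonneg[of \<theta>] J2_nonneg[of \<theta>]
        by (simp flip: ennreal_mult' ennreal_plus)
    qed
    also have "\<dots> = ennreal C * (\<integral>\<^sup>+ \<theta>. ennreal (J1 \<theta> + J2 \<theta>) \<partial>cone_measure)"
      by (rule nn_integral_cmult) measurable
    also have "(\<integral>\<^sup>+ \<theta>. ennreal (J1 \<theta> + J2 \<theta>) \<partial>cone_measure) = (\<integral>\<^sup>+ \<theta>. ennreal (I (\<lambda>r. (norm (G (r *\<^sub>R \<theta>)))\<^sup>2)) \<partial>cone_measure)"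
    proof (rule nn_integral_cong_AE)
      show "AE \<theta> in cone_measure. ennreal (J1 \<theta> + J2 \<theta>) = ennreal (I (\<lambda>r. (norm (G (r *\<^sub>R \<theta>)))\<^sup>2))"
        using AE_cone_measure_norm
      proof eventually_elim
        case (elim \<theta>)
        have "I (\<lambda>r. (norm (G (r *\<^sub>R \<theta>)))\<^sup>2)
            = I (\<lambda>r. (G (r *\<^sub>R \<theta>) \<bullet> \<theta>)\<^sup>2 + 1 * (norm (P \<theta> (G (r *\<^sub>R \<theta>))))\<^sup>2 + 0 * 1)"
          using pyth[OF elim, of "G (_ *\<^sub>R \<theta>)"] by simp
        also have "\<dots> = J1 \<theta> + 1 * J2 \<theta> + 0 * I (\<lambda>r. 1)"
          unfolding J1_def J2_def P_def by (intro I_lin continuous_intros Gray)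
        finally show ?case by simp
      qed
    qed
    finally have "(\<integral>\<^sup>+ \<theta>. ennreal (I (\<lambda>r. (f (r *\<^sub>R \<theta>) - c)\<^sup>2)) \<partial>cone_measure)
      \<le> ennreal C * (\<integral>\<^sup>+ \<theta>. ennreal (I (\<lambda>r. (norm (G (r *\<^sub>R \<theta>)))\<^sup>2)) \<partial>cone_measure)"
      by (simp add: add_left_mono)
    then show ?thesis by (intro exI[of _ c]) (simp only: lhs rhs)
  qed
qed

section \<open>Covariance\<close>

lemma GDERIV_unique:
  assumes "GDERIV f x :> D" "GDERIV f x :> E"
  shows "D = E"
proof -
  have "(\<lambda>h. h \<bullet> D) = (\<lambda>h. h \<bullet> E)"
    using assms unfolding gderiv_def by (rule has_derivative_unique)
  then show ?thesis by (metis vector_eq_ldot)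
qed

lemma grad_eq: "GDERIV f x :> D \<Longrightarrow> grad f x = D"
  unfolding grad_def by (rule the_equality) (auto intro: GDERIV_unique)

text \<open>The Riesz representative of a derivative \<open>D\<close> is \<open>adjoint D 1\<close>;
  this gives the existence that the definite description in \<open>grad\<close> presupposes.\<close>

lemma GDERIV_grad:
  fixes f :: "real^'n \<Rightarrow> real"
  assumes "f differentiable (at x)"
  shows "GDERIV f x :> grad f x"
proof -
  obtain D where D: "(f has_derivative D) (at x)" using assms by (auto simp: differentiable_def)
  then have "linear D" by (simp add: has_derivative_linear)
  then have "D = (\<lambda>h. h \<bullet> adjoint D 1)" by (simp add: adjoint_works fun_eq_iff)
  with D have "GDERIV f x :> adjoint D 1" by (simp add: gderiv_def)
  with grad_eq[OF this] show ?thesis by simp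
qed

lemma smooth_GDERIV:
  assumes "smooth f"
  shows "GDERIV f x :> grad f x"
proof -
  have "C_k 1 f" using assms by (simp add: smooth_def)
  then have "f differentiable_on UNIV" by simp
  then show ?thesis by (intro GDERIV_grad) (simp add: differentiable_on_def)
qed

lemma smooth_grad_component: "smooth f \<Longrightarrow> smooth (\<lambda>x. grad f x $ i)"
  unfolding smooth_def by (metis C_k.simps(2))

lemma smooth_continuous_on: "smooth f \<Longrightarrow> continuous_on UNIV f"
  unfolding smooth_def by (metis C_k.simps(1))

lemma smooth_continuous_on_grad:
  fixes f :: "real^'n \<Rightarrow> real"
  assumes "smooth f"
  shows "continuous_on UNIV (grad f)"
proof -
  have "continuous_on UNIV (\<lambda>x. \<chi> i. grad f x $ i)"
    using smooth_continuous_on[OF smooth_grad_component[OF assms]] by (rule continuous_on_vec_lambda)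
  then show ?thesis by simp
qed

text \<open>\<open>GREATEST\<close> says nothing until a maximum is exhibited. A maximizer
  \<open>v\<close> of the quadratic form on the compact unit sphere is an eigenvector: moving
  \<open>v\<close> in the direction of the defect \<open>w = A v - l v\<close> would otherwise
  exceed the bound to first order.\<close>

lemma symmetric_max_eigenvalue:
  fixes A :: "real^'n^'n"
  assumes A: "transpose A = A"
  obtains l where "(GREATEST l. is_eigenvalue A l) = l" "is_eigenvalue A l" "\<And>v. v \<bullet> (A *v v) \<le> l * (v \<bullet> v)"
proof -
  have sym: "x \<bullet> (A *v y) = y \<bullet> (A *v x)" for x y
    by (metis A dot_lmul_matrix inner_commute matrix_vector_mul_assoc transpose_matrix_vector vector_transpose_matrix)
  have "continuous_on (sphere 0 1) (\<lambda>v. v \<bullet> (A *v v))"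
    by (intro continuous_intros matrix_vector_mult_linear_continuous_on)
  then obtain v where v: "norm v = 1" "\<And>u. norm u = 1 \<Longrightarrow> u \<bullet> (A *v u) \<le> v \<bullet> (A *v v)"
    using continuous_attains_sup[of "sphere (0 :: real^'n) 1"] by fastforce
  define l where "l = v \<bullet> (A *v v)"
  have bound: "u \<bullet> (A *v u) \<le> l * (u \<bullet> u)" for u
  proof (cases "u = 0")
    case False
    have "(u /\<^sub>R norm u) \<bullet> (A *v (u /\<^sub>R norm u)) \<le> l"
      unfolding l_def using False by (intro v) simp
    then show ?thesis using False
      by (simp add: matrix_vector_mult_scaleR field_simps dot_square_norm power2_eq_square)
  qed simp
  have v1: "v \<bullet> v = 1" using v(1) by (simp add: norm_eq_1)
  have "A *v v = l *\<^sub>R v"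
  proof -
    define w where "w = A *v v - l *\<^sub>R v"
    have wv: "w \<bullet> (A *v v) - l * (w \<bullet> v) = w \<bullet> w" by (simp add: w_def inner_diff)
    define q where "q = w \<bullet> (A *v w) - l * (w \<bullet> w)"
    have "2 * t * (w \<bullet> w) + t\<^sup>2 * q \<le> 0" for t
    proof -
      have "(v + t *\<^sub>R w) \<bullet> (A *v (v + t *\<^sub>R w)) - l * ((v + t *\<^sub>R w) \<bullet> (v + t *\<^sub>R w))
          = (v \<bullet> (A *v v) - l * (v \<bullet> v)) + 2 * t * (w \<bullet> (A *v v) - l * (w \<bullet> v)) + t\<^sup>2 * q"
        by (simp add: q_def matrix_vector_right_distrib matrix_vector_mult_scaleR inner_add
            sym[of v w] inner_commute[of v w] algebra_simps power2_eq_square)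
      also have "v \<bullet> (A *v v) - l * (v \<bullet> v) = 0" by (simp add: l_def v1)
      finally show ?thesis using bound[of "v + t *\<^sub>R w"] unfolding wv by linarith
    qed
    note quadratic = this
    have "w \<bullet> w \<le> 0"
    proof (rule ccontr)
      assume "\<not> w \<bullet> w \<le> 0"
      then have pos: "w \<bullet> w > 0" by linarith
      \<comment> \<open>Small enough that the second-order term \<open>s * \<bar>q\<bar>\<close> is
        at most \<open>w \<bullet> w\<close>, so the first-order term wins.\<close>
      define s where "s = (w \<bullet> w) / (1 + \<bar>q\<bar>)"
      have s: "s > 0" using pos by (simp add: s_def add_pos_nonneg)
      have "s * \<bar>q\<bar> \<le> w \<bullet> w" using pos by (simp add: s_def field_simps)
      moreover have "- (s * \<bar>q\<bar>) \<le> s * q"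
        using s mult_left_mono[of "- \<bar>q\<bar>" q s] by simp
      ultimately have "0 < 2 * (w \<bullet> w) + s * q" using pos by linarith
      then have "0 < s * (2 * (w \<bullet> w) + s * q)" using s by (intro mult_pos_pos)
      then show False using quadratic[of s] by (simp add: algebra_simps power2_eq_square)
    qed
    then have "w \<bullet> w = 0" using inner_ge_zero[of w] by linarith
    then have "w = 0" by (simp only: inner_eq_zero_iff)
    then show ?thesis by (simp add: w_def)
  qed
  then have ev: "is_eigenvalue A l" using v1 by (auto simp: is_eigenvalue_def intro!: exI[of _ v])
  moreover have "l' \<le> l" if l': "is_eigenvalue A l'" for l'
  proof -
    obtain u where u: "u \<noteq> 0" "A *v u = l' *\<^sub>R u" using l' by (auto simp: is_eigenvalue_def)
    then have "l' * (u \<bullet> u) \<le> l * (u \<bullet> u)" using bound[of u] by simp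
    then show ?thesis using u by simp
  qed
  ultimately have "(GREATEST l. is_eigenvalue A l) = l" by (intro Greatest_equality)
  with ev bound show thesis by (intro that)
qed

lemma cov_matrix_quadratic_form:
  fixes \<rho> :: "(real^'n) measure"
  assumes "prob_space \<rho>" and sets: "sets \<rho> = sets borel" and int: "integrable \<rho> (\<lambda>x. (norm x)\<^sup>2)"
  shows "v \<bullet> (cov_matrix \<rho> *v v) = (\<integral>x. (x \<bullet> v - (\<integral>y. y \<bullet> v \<partial>\<rho>))\<^sup>2 \<partial>\<rho>)"
    and "integrable \<rho> (\<lambda>x. (x \<bullet> v)\<^sup>2)" and "integrable \<rho> (\<lambda>x. x \<bullet> v)"
proof -
  interpret prob_space \<rho> by fact
  note [measurable_cong] = sets
  show sq: "integrable \<rho> (\<lambda>x. (x \<bullet> v)\<^sup>2)" for v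
  proof (rule Bochner_Integration.integrable_bound)
    show "integrable \<rho> (\<lambda>x. (norm v)\<^sup>2 * (norm x)\<^sup>2)" using int by simp
    show "AE x in \<rho>. norm ((x \<bullet> v)\<^sup>2) \<le> norm ((norm v)\<^sup>2 * (norm x)\<^sup>2)"
    proof (intro AE_I2)
      fix x
      have "\<bar>x \<bullet> v\<bar>\<^sup>2 \<le> (norm v * norm x)\<^sup>2"
        using Cauchy_Schwarz_ineq2[of x v] by (intro power_mono) (auto simp: mult.commute)
      then show "norm ((x \<bullet> v)\<^sup>2) \<le> norm ((norm v)\<^sup>2 * (norm x)\<^sup>2)" by (simp add: power_mult_distrib)
    qed
  qed measurable
  show lin: "integrable \<rho> (\<lambda>x. x \<bullet> v)" for v
    by (rule square_integrable_imp_integrable[OF _ sq]) measurable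
  have comp: "integrable \<rho> (\<lambda>x. x $ i)" "integrable \<rho> (\<lambda>x. (x $ i)\<^sup>2)" for i
    using lin[of "axis i 1"] sq[of "axis i 1"] by (simp_all add: inner_axis)
  define m where "m i = (\<integral>y. y $ i \<partial>\<rho>)" for i
  have prod_int: "integrable \<rho> (\<lambda>x. (x $ i - m i) * (x $ j - m j))" for i j
  proof (rule Bochner_Integration.integrable_bound)
    have "integrable \<rho> (\<lambda>x. (x $ i - m i)\<^sup>2)" for i
      using comp by (simp add: power2_diff)
    then show "integrable \<rho> (\<lambda>x. (x $ i - m i)\<^sup>2 + (x $ j - m j)\<^sup>2)" by simp
    show "AE x in \<rho>. norm ((x $ i - m i) * (x $ j - m j)) \<le> norm ((x $ i - m i)\<^sup>2 + (x $ j - m j)\<^sup>2)"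
    proof (intro AE_I2)
      fix x :: "real^'n"
      have "2 * \<bar>(x $ i - m i) * (x $ j - m j)\<bar> \<le> (x $ i - m i)\<^sup>2 + (x $ j - m j)\<^sup>2"
        using sum_squares_bound[of "\<bar>x $ i - m i\<bar>" "\<bar>x $ j - m j\<bar>"] by (simp add: abs_mult)
      then show "norm ((x $ i - m i) * (x $ j - m j)) \<le> norm ((x $ i - m i)\<^sup>2 + (x $ j - m j)\<^sup>2)" by simp
    qed
  qed measurable
  have mean: "(\<integral>y. y \<bullet> v \<partial>\<rho>) = (\<Sum>i\<in>UNIV. m i * v $ i)"
    using comp by (simp add: inner_vec_def m_def)
  have "v \<bullet> (cov_matrix \<rho> *v v)
      = (\<Sum>i\<in>UNIV. v $ i * (\<Sum>j\<in>UNIV. (\<integral>x. (x $ i - m i) * (x $ j - m j) \<partial>\<rho>) * v $ j))"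
    by (simp add: inner_vec_def matrix_vector_mult_def cov_matrix_def m_def)
  also have "\<dots> = (\<integral>x. (\<Sum>i\<in>UNIV. v $ i * (\<Sum>j\<in>UNIV. (x $ i - m i) * (x $ j - m j) * v $ j)) \<partial>\<rho>)"
    using prod_int by (simp add: Bochner_Integration.integral_sum)
  also have "\<dots> = (\<integral>x. (x \<bullet> v - (\<integral>y. y \<bullet> v \<partial>\<rho>))\<^sup>2 \<partial>\<rho>)"
  proof (intro Bochner_Integration.integral_cong refl)
    fix x :: "real^'n"
    have "x \<bullet> v - (\<integral>y. y \<bullet> v \<partial>\<rho>) = (\<Sum>i\<in>UNIV. (x $ i - m i) * v $ i)"
      unfolding mean by (simp add: inner_vec_def sum_subtractf left_diff_distrib)
    then show "(\<Sum>i\<in>UNIV. v $ i * (\<Sum>j\<in>UNIV. (x $ i - m i) * (x $ j - m j) * v $ j)) = (x \<bullet> v - (\<integral>y. y \<bullet> v \<partial>\<rho>))\<^sup>2"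
      by (simp add: power2_eq_square sum_product sum_distrib_left mult_ac)
  qed
  finally show "v \<bullet> (cov_matrix \<rho> *v v) = (\<integral>x. (x \<bullet> v - (\<integral>y. y \<bullet> v \<partial>\<rho>))\<^sup>2 \<partial>\<rho>)" .
qed

lemma transpose_cov_matrix: "transpose (cov_matrix \<rho>) = cov_matrix \<rho>"
  by (simp add: transpose_def cov_matrix_def mult.commute)

text \<open>When the covariances of \<nu> and its restriction are compared, the upper bound is
  applied to \<nu> and the extremal direction to the restriction.\<close>

lemma sigma2_max:
  fixes \<rho> :: "(real^'n) measure"
  assumes "prob_space \<rho>" "sets \<rho> = sets borel" "integrable \<rho> (\<lambda>x. (norm x)\<^sup>2)"
  shows "(\<integral>x. (x \<bullet> v - (\<integral>y. y \<bullet> v \<partial>\<rho>))\<^sup>2 \<partial>\<rho>) \<le> sigma2 \<rho> * (v \<bullet> v)"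
    and "\<exists>u. u \<noteq> 0 \<and> (\<integral>x. (x \<bullet> u - (\<integral>y. y \<bullet> u \<partial>\<rho>))\<^sup>2 \<partial>\<rho>) = sigma2 \<rho> * (u \<bullet> u)"
proof -
  obtain l where l: "sigma2 \<rho> = l" "is_eigenvalue (cov_matrix \<rho>) l"
    "\<And>v. v \<bullet> (cov_matrix \<rho> *v v) \<le> l * (v \<bullet> v)"
    using symmetric_max_eigenvalue[OF transpose_cov_matrix[of \<rho>]] unfolding sigma2_def by metis
  show "(\<integral>x. (x \<bullet> v - (\<integral>y. y \<bullet> v \<partial>\<rho>))\<^sup>2 \<partial>\<rho>) \<le> sigma2 \<rho> * (v \<bullet> v)"
    using l(3)[of v] l(1) by (simp add: cov_matrix_quadratic_form(1)[OF assms])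
  obtain u where "u \<noteq> 0" "cov_matrix \<rho> *v u = l *\<^sub>R u" using l(2) by (auto simp: is_eigenvalue_def)
  then show "\<exists>u. u \<noteq> 0 \<and> (\<integral>x. (x \<bullet> u - (\<integral>y. y \<bullet> u \<partial>\<rho>))\<^sup>2 \<partial>\<rho>) = sigma2 \<rho> * (u \<bullet> u)"
    using l(1) cov_matrix_quadratic_form(1)[OF assms, of u] by (intro exI[of _ u]) simp
qed

lemma sigma2_nonneg:
  assumes "prob_space \<rho>" "sets \<rho> = sets borel" "integrable \<rho> (\<lambda>x. (norm x)\<^sup>2)"
  shows "0 \<le> sigma2 \<rho>"
proof -
  obtain u where u: "u \<noteq> 0" "(\<integral>x. (x \<bullet> u - (\<integral>y. y \<bullet> u \<partial>\<rho>))\<^sup>2 \<partial>\<rho>) = sigma2 \<rho> * (u \<bullet> u)"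
    using sigma2_max(2)[OF assms] by blast
  have "0 \<le> (\<integral>x. (x \<bullet> u - (\<integral>y. y \<bullet> u \<partial>\<rho>))\<^sup>2 \<partial>\<rho>)" by simp
  moreover have "u \<bullet> u > 0" using u by simp
  ultimately show ?thesis using u(2) by (simp add: zero_le_mult_iff)
qed

lemma centered_inner:
  assumes "centered \<rho>"
  shows "(\<integral>x. x \<bullet> v \<partial>\<rho>) = 0"
  using assms by (simp add: centered_def)

text \<open>For mean zero the left side is the trace of the covariance matrix.\<close>

lemma second_moment_le_sigma2:
  fixes \<rho> :: "(real^'n) measure"
  assumes "prob_space \<rho>" "sets \<rho> = sets borel" "integrable \<rho> (\<lambda>x. (norm x)\<^sup>2)" and c: "centered \<rho>"
  shows "(\<integral>x. (norm x)\<^sup>2 \<partial>\<rho>) \<le> CARD('n) * sigma2 \<rho>"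
proof -
  have "(\<integral>x. (norm x)\<^sup>2 \<partial>\<rho>) = (\<integral>x. (\<Sum>b\<in>Basis. (x \<bullet> b)\<^sup>2) \<partial>\<rho>)"
    by (simp add: power2_norm_eq_sum_Basis)
  also have "\<dots> = (\<Sum>b\<in>Basis. \<integral>x. (x \<bullet> b)\<^sup>2 \<partial>\<rho>)"
    by (intro Bochner_Integration.integral_sum cov_matrix_quadratic_form(2)[OF assms(1-3)])
  also have "\<dots> \<le> (\<Sum>b\<in>(Basis :: (real^'n) set). sigma2 \<rho>)"
  proof (intro sum_mono)
    fix b :: "real^'n" assume "b \<in> Basis"
    then show "(\<integral>x. (x \<bullet> b)\<^sup>2 \<partial>\<rho>) \<le> sigma2 \<rho>"
      using sigma2_max(1)[OF assms(1-3), of b] by (simp add: centered_inner[OF c])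
  qed
  finally show ?thesis by simp
qed

text \<open>Beyond radius \<open>r\<close> the function \<open>W (t \<theta>) - a t\<close> is
  nondecreasing along every ray; inside, \<open>W\<close> is at least its minimum over the closed
  ball. Hence \<open>m\<close> is that minimum minus \<open>a r\<close>.\<close>

lemma linear_growth:
  fixes W :: "real^'n \<Rightarrow> real"
  assumes W: "\<And>x. GDERIV W x :> G x"
    and a: "a > 0" and growth: "\<And>x. norm x \<ge> r \<Longrightarrow> x \<bullet> G x \<ge> a * norm x"
    and r: "r > 0"
  obtains m where "\<And>x. W x \<ge> a * norm x + m"
proof -
  have Wc: "continuous_on X W" for X using GDERIV_continuous_on[OF W] continuous_on_subset by blast
  obtain z where "\<And>x. x \<in> cball 0 r \<Longrightarrow> W z \<le> W x"
    using continuous_attains_inf[OF compact_cball _ Wc, of 0 r] r by fastforce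
  then have z: "W z \<le> W x" if "norm x \<le> r" for x using that by simp
  have "W x \<ge> a * norm x + (W z - a * r)" for x
  proof (cases "norm x \<le> r")
    case True
    then have "a * norm x \<le> a * r" using a by (intro mult_left_mono) auto
    then show ?thesis using z[OF True] by linarith
  next
    case False
    define \<theta> where "\<theta> = x /\<^sub>R norm x"
    have "x \<noteq> 0" using False r by auto
    then have \<theta>: "norm \<theta> = 1" "norm x *\<^sub>R \<theta> = x" by (simp_all add: \<theta>_def)
    have "W (r *\<^sub>R \<theta>) - a * r \<le> W (norm x *\<^sub>R \<theta>) - a * norm x"
    proof (rule DERIV_nonneg_imp_nondecreasing[where f = "\<lambda>t. W (t *\<^sub>R \<theta>) - a * t"])
      fix t assume t: "r \<le> t" "t \<le> norm x"
      have "((\<lambda>t. W (t *\<^sub>R \<theta>) - a * t) has_real_derivative G (t *\<^sub>R \<theta>) \<bullet> \<theta> - a) (at t)"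
        by (auto intro!: derivative_eq_intros GDERIV_line[OF W])
      moreover have "a \<le> G (t *\<^sub>R \<theta>) \<bullet> \<theta>"
        using growth[of "t *\<^sub>R \<theta>"] t r \<theta>(1) by (simp add: inner_commute mult.commute)
      ultimately show "\<exists>y. ((\<lambda>t. W (t *\<^sub>R \<theta>) - a * t) has_real_derivative y) (at t) \<and> 0 \<le> y" by auto
    qed (use False in simp)
    moreover have "W z \<le> W (r *\<^sub>R \<theta>)" using r \<theta> by (intro z) simp
    ultimately show ?thesis using \<theta> by simp
  qed
  then show thesis by (rule that)
qed

text \<open>Comparison with \<open>exp (- a |x|)\<close>, whose radial integral in polar coordinates
  is a multiple of the total mass of an Erlang law.\<close>

lemma integrable_second_moment:
  fixes W :: "real^'n \<Rightarrow> real"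
  assumes W: "continuous_on UNIV W" and a: "a > 0" and growth: "\<And>x. W x \<ge> a * norm x + m"
  shows "integrable (exp_measure W) (\<lambda>x. (norm x)\<^sup>2)"
proof -
  have [measurable]: "W \<in> borel_measurable borel" by (rule borel_measurable_continuous_onI[OF W])
  \<comment> \<open>\<open>d\<close> is the exponent of the radial volume element, one less than the
    dimension; \<open>k\<close> adds the 2 of the squared norm.\<close>
  define d k where "d = CARD('n) - 1" and "k = CARD('n) + 1"
  have "d + 2 = k" using zero_less_card_finite[where 'a = 'n] by (simp add: d_def k_def)
  then have rk: "r ^ d * r\<^sup>2 = r ^ k" for r :: real by (metis power_add)
  have dim: "DIM(real^'n) - 1 = d" by (simp add: d_def)
  interpret S: finite_measure "cone_measure :: (real^'n) measure" by (rule finite_cone_measure)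
  have "(\<integral>\<^sup>+ x. ennreal ((norm x)\<^sup>2) \<partial>exp_measure W) = (\<integral>\<^sup>+ x. ennreal (exp (- W x) * (norm x)\<^sup>2) \<partial>lborel)"
    unfolding exp_measure_def by (subst nn_integral_density) (auto simp: ennreal_mult)
  also have "\<dots> \<le> (\<integral>\<^sup>+ x. ennreal (exp (- m) * (exp (- a * norm x) * (norm x)\<^sup>2)) \<partial>(lborel :: (real^'n) measure))"
  proof (intro nn_integral_mono ennreal_leI)
    fix x
    have "exp (- W x) \<le> exp (- m) * exp (- a * norm x)"
      using growth[of x] by (simp flip: exp_add)
    then show "exp (- W x) * (norm x)\<^sup>2 \<le> exp (- m) * (exp (- a * norm x) * (norm x)\<^sup>2)"
      using mult_right_mono[of _ _ "(norm x)\<^sup>2"] by (simp add: mult.assoc[symmetric])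
  qed
  also have "\<dots> = (\<integral>\<^sup>+ \<theta>. (\<integral>\<^sup>+ r. ennreal (r ^ d) * indicator {0..} r *
      ennreal (exp (- m) * (exp (- a * norm (r *\<^sub>R \<theta>)) * (norm (r *\<^sub>R \<theta>))\<^sup>2)) \<partial>lborel) \<partial>(cone_measure :: (real^'n) measure))"
    unfolding dim[symmetric] by (rule nn_integral_polar) measurable
  also have "\<dots> = (\<integral>\<^sup>+ \<theta>. ennreal (exp (- m) * (fact k / a ^ (k + 1))) \<partial>(cone_measure :: (real^'n) measure))"
  proof (rule nn_integral_cong_AE)
    show "AE \<theta> in (cone_measure :: (real^'n) measure). (\<integral>\<^sup>+ r. ennreal (r ^ d) * indicator {0..} r *
      ennreal (exp (- m) * (exp (- a * norm (r *\<^sub>R \<theta>)) * (norm (r *\<^sub>R \<theta>))\<^sup>2)) \<partial>lborel)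
      = ennreal (exp (- m) * (fact k / a ^ (k + 1)))"
      using AE_cone_measure_norm
    proof eventually_elim
      case (elim \<theta>)
      have "(\<integral>\<^sup>+ r. ennreal (r ^ d) * indicator {0..} r *
          ennreal (exp (- m) * (exp (- a * norm (r *\<^sub>R \<theta>)) * (norm (r *\<^sub>R \<theta>))\<^sup>2)) \<partial>lborel)
        = (\<integral>\<^sup>+ r. ennreal (exp (- m) * (fact k / a ^ (k + 1))) * ennreal (erlang_density k a r * r ^ 0) \<partial>lborel)"
      proof (intro nn_integral_cong)
        fix r :: real
        have "r ^ d * (exp (- m) * (exp (- a * r) * r\<^sup>2)) = exp (- m) * (fact k / a ^ (k + 1)) * erlang_density k a r"
          if "r \<ge> 0"
        proof -
          have "r ^ d * (exp (- m) * (exp (- a * r) * r\<^sup>2)) = exp (- m) * (exp (- a * r) * r ^ k)"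
            using rk[of r] by (simp add: mult_ac)
          also have "\<dots> = exp (- m) * (fact k / a ^ (k + 1)) * erlang_density k a r"
            using that a by (simp add: erlang_density_def)
          finally show ?thesis .
        qed
        then show "ennreal (r ^ d) * indicator {0..} r *
            ennreal (exp (- m) * (exp (- a * norm (r *\<^sub>R \<theta>)) * (norm (r *\<^sub>R \<theta>))\<^sup>2))
          = ennreal (exp (- m) * (fact k / a ^ (k + 1))) * ennreal (erlang_density k a r * r ^ 0)"
          using a elim
          by (cases "r \<ge> 0") (simp_all add: erlang_density_def ennreal_mult'[symmetric] del: power_Suc)
      qed
      also have "\<dots> = ennreal (exp (- m) * (fact k / a ^ (k + 1))) * (\<integral>\<^sup>+ r. ennreal (erlang_density k a r * r ^ 0) \<partial>lborel)"
        by (rule nn_integral_cmult) measurable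
      finally show ?case by (simp only: nn_integral_erlang_ith_moment[OF a]) simp
    qed
  qed
  also have "\<dots> < \<infinity>"
    using S.emeasure_finite[of UNIV] unfolding infinity_ennreal_def less_top by (simp add: ennreal_mult_less_top)
  finally show ?thesis
    by (intro integrableI_nonneg) (auto simp: exp_measure_def)
qed

text \<open>The given \<open>w\<close> need not be regular, and its values at negative numbers are
  arbitrary. Restricting \<open>W\<close> to a full coordinate line gives a profile that is smooth
  through 0, even and convex; its derivative is a component of the gradient of
  \<open>W\<close>.\<close>

lemma radial_profile:
  fixes W :: "real^'n \<Rightarrow> real"
  assumes W: "smooth W" and conv: "convex_on UNIV W" and rad: "\<And>x. W x = w (norm x)"
  obtains \<phi> \<phi>' \<phi>'' where "\<And>x. W x = \<phi> (norm x)" "\<And>r. (\<phi> has_real_derivative \<phi>' r) (at r)"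
    "\<And>r. (\<phi>' has_real_derivative \<phi>'' r) (at r)" "\<phi>' 0 = 0" "\<And>r. \<phi>'' r \<ge> 0"
proof -
  fix i :: 'n
  define e :: "real^'n" where "e = axis i 1"
  have e: "norm e = 1" by (simp add: e_def)
  define \<phi> where "\<phi> t = W (t *\<^sub>R e)" for t
  define \<phi>' where "\<phi>' t = grad W (t *\<^sub>R e) \<bullet> e" for t
  define \<phi>'' where "\<phi>'' t = grad (\<lambda>x. grad W x $ i) (t *\<^sub>R e) \<bullet> e" for t
  have eq: "W x = \<phi> (norm x)" for x by (simp add: \<phi>_def rad[of x] rad[of "norm x *\<^sub>R e"] e)
  have even: "\<phi> (- t) = \<phi> t" for t by (simp add: \<phi>_def rad[of "t *\<^sub>R e"] rad[of "- (t *\<^sub>R e)"])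
  have d1: "(\<phi> has_real_derivative \<phi>' r) (at r)" for r
    unfolding \<phi>_def \<phi>'_def by (rule GDERIV_line[OF smooth_GDERIV[OF W]])
  have "\<phi>' = (\<lambda>t. grad W (t *\<^sub>R e) $ i)" by (simp add: \<phi>'_def fun_eq_iff e_def inner_axis)
  then have d2: "(\<phi>' has_real_derivative \<phi>'' r) (at r)" for r
    unfolding \<phi>''_def
    using GDERIV_line[OF smooth_GDERIV[OF smooth_grad_component[OF W, of i]], of e r] by simp
  \<comment> \<open>Evenness forces the derivative at 0 to equal its negative.\<close>
  have "((\<lambda>t. \<phi> (- t)) has_real_derivative - \<phi>' 0) (at 0)"
    using DERIV_chain2[OF d1[of "- 0"] DERIV_minus[OF DERIV_ident]] by simp
  then have "(\<phi> has_real_derivative - \<phi>' 0) (at 0)" by (simp add: even)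
  from DERIV_unique[OF d1[of 0] this] have zero: "\<phi>' 0 = 0" by simp
  have conv\<phi>: "convex_on UNIV \<phi>"
  proof (rule convex_onI)
    fix t x y :: real assume "0 < t" "t < 1"
    have "((1 - t) *\<^sub>R x + t *\<^sub>R y) *\<^sub>R e = (1 - t) *\<^sub>R (x *\<^sub>R e) + t *\<^sub>R (y *\<^sub>R e)"
      by (simp add: scaleR_add_left)
    then show "\<phi> ((1 - t) *\<^sub>R x + t *\<^sub>R y) \<le> (1 - t) * \<phi> x + t * \<phi> y"
      unfolding \<phi>_def using convex_onD[OF conv, of t "x *\<^sub>R e" "y *\<^sub>R e"] \<open>0 < t\<close> \<open>t < 1\<close> by simp
  qed simp
  have "mono_on UNIV \<phi>'"
  proof (rule mono_onI)
    fix x y :: real assume "x \<le> y"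
    show "\<phi>' x \<le> \<phi>' y"
    proof (cases "x = y")
      case False
      \<comment> \<open>Adding the tangent inequalities at \<open>x\<close> and at \<open>y\<close>
        gives monotonicity of the derivative.\<close>
      have "\<phi>' x * (y - x) \<le> \<phi> y - \<phi> x"
        by (rule convex_on_imp_above_tangent[OF conv\<phi>]) (auto intro: d1)
      moreover have "\<phi>' y * (x - y) \<le> \<phi> x - \<phi> y"
        by (rule convex_on_imp_above_tangent[OF conv\<phi>]) (auto intro: d1)
      ultimately have "(\<phi>' y - \<phi>' x) * (y - x) \<ge> 0" by (simp add: algebra_simps)
      then show ?thesis using False \<open>x \<le> y\<close> by (simp add: zero_le_mult_iff)
    qed simp
  qed
  then have "\<phi>'' r \<ge> 0" for r by (rule mono_on_imp_deriv_nonneg) (auto intro: d2)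
  with zero eq d1 d2 show thesis by (intro that)
qed

section \<open>Restrictions to balls\<close>

lemma sets_exp_measure [measurable_cong, simp]: "sets (exp_measure V) = sets borel"
  and space_exp_measure [simp]: "space (exp_measure V) = UNIV"
  by (simp_all add: exp_measure_def)

lemma sets_ball_restr [measurable_cong, simp]: "sets (ball_restr (exp_measure V) R) = sets borel"
  and space_ball_restr [simp]: "space (ball_restr (exp_measure V) R) = UNIV"
  by (simp_all add: ball_restr_def)

lemma bounded_on_cball:
  fixes h :: "real^'n \<Rightarrow> real"
  assumes "continuous_on UNIV h"
  obtains K where "\<And>x. x \<in> cball 0 R \<Longrightarrow> \<bar>h x\<bar> \<le> K"
proof -
  have "compact (h ` cball 0 R)"
    by (intro compact_continuous_image continuous_on_subset[OF assms]) auto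
  then have "\<exists>K. \<forall>x\<in>cball 0 R. \<bar>h x\<bar> \<le> K"
    using compact_imp_bounded[of "h ` cball 0 R"] by (auto simp: bounded_iff)
  then show thesis using that by blast
qed

lemma emeasure_exp_measure_ball_pos:
  fixes V :: "real^'n \<Rightarrow> real"
  assumes V: "continuous_on UNIV V" and R: "R > 0"
  shows "emeasure (exp_measure V) (ball 0 R) > 0"
proof -
  have [measurable]: "V \<in> borel_measurable borel" by (rule borel_measurable_continuous_onI[OF V])
  obtain K where K: "\<And>x. x \<in> cball 0 R \<Longrightarrow> \<bar>V x\<bar> \<le> K" using bounded_on_cball[OF V] by blast
  have "0 < ennreal (exp (- K)) * emeasure lborel (ball (0 :: real^'n) R)"
    using content_ball_pos[OF R, of "0 :: real^'n"] emeasure_lborel_ball_finite[of "0 :: real^'n" R]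
    by (simp add: ennreal_zero_less_mult_iff emeasure_eq_ennreal_measure less_top)
  also have "\<dots> = (\<integral>\<^sup>+ x. ennreal (exp (- K)) * indicator (ball (0 :: real^'n) R) x \<partial>lborel)"
    by (simp add: nn_integral_cmult_indicator)
  also have "\<dots> \<le> (\<integral>\<^sup>+ x. ennreal (exp (- V x)) * indicator (ball 0 R) x \<partial>lborel)"
  proof (intro nn_integral_mono)
    fix x
    show "ennreal (exp (- K)) * indicator (ball 0 R) x \<le> ennreal (exp (- V x)) * indicator (ball 0 R) x"
      using K[of x] by (auto intro!: ennreal_leI split: split_indicator)
  qed
  also have "\<dots> = emeasure (exp_measure V) (ball 0 R)"
    unfolding exp_measure_def by (subst emeasure_density) auto
  finally show ?thesis .
qed

lemma measure_exp_measure_ball_pos: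
  fixes V :: "real^'n \<Rightarrow> real"
  assumes "prob_space (exp_measure V)" "continuous_on UNIV V" "R > 0"
  shows "measure (exp_measure V) (ball 0 R) > 0"
    and "emeasure (exp_measure V) (ball 0 R) = ennreal (measure (exp_measure V) (ball 0 R))"
proof -
  interpret prob_space "exp_measure V" by fact
  show *: "emeasure (exp_measure V) (ball 0 R) = ennreal (measure (exp_measure V) (ball 0 R))"
    by (rule emeasure_eq_measure)
  show "measure (exp_measure V) (ball 0 R) > 0"
    using emeasure_exp_measure_ball_pos[OF assms(2,3)] unfolding * by simp
qed

lemma prob_space_ball_restr:
  fixes V :: "real^'n \<Rightarrow> real"
  assumes "prob_space (exp_measure V)" "continuous_on UNIV V" "R > 0"
  shows "prob_space (ball_restr (exp_measure V) R)"
  unfolding ball_restr_def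
  using measure_exp_measure_ball_pos[OF assms] by (intro prob_space_uniform_measure) auto

lemma nn_integral_ball_restr:
  fixes V F :: "real^'n \<Rightarrow> real"
  assumes "prob_space (exp_measure V)" and V: "continuous_on UNIV V" and "R > 0"
    and F: "continuous_on UNIV F" "\<And>x. F x \<ge> 0"
  shows "(\<integral>\<^sup>+ x. ennreal (F x) \<partial>ball_restr (exp_measure V) R)
    = (\<integral>\<^sup>+ x. indicator (ball 0 R) x * ennreal (F x * exp (- V x)) \<partial>lborel)
      / ennreal (measure (exp_measure V) (ball 0 R))"
proof -
  have [measurable]: "V \<in> borel_measurable borel" "F \<in> borel_measurable borel"
    using V F by (auto intro: borel_measurable_continuous_onI)
  have [measurable]: "ball (0 :: real^'n) R \<in> sets borel" by simp
  have "(\<integral>\<^sup>+ x. ennreal (F x) \<partial>ball_restr (exp_measure V) R)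
      = (\<integral>\<^sup>+ x. ennreal (F x) * indicator (ball 0 R) x \<partial>exp_measure V) / emeasure (exp_measure V) (ball 0 R)"
    unfolding ball_restr_def by (rule nn_integral_uniform_measure) measurable
  also have "(\<integral>\<^sup>+ x. ennreal (F x) * indicator (ball 0 R) x \<partial>exp_measure V)
      = (\<integral>\<^sup>+ x. ennreal (exp (- V x)) * (ennreal (F x) * indicator (ball 0 R) x) \<partial>lborel)"
    unfolding exp_measure_def by (rule nn_integral_density) measurable
  also have "\<dots> = (\<integral>\<^sup>+ x. indicator (ball 0 R) x * ennreal (F x * exp (- V x)) \<partial>lborel)"
    using F(2) by (intro nn_integral_cong) (auto simp: ennreal_mult mult_ac)
  finally show ?thesis by (simp add: measure_exp_measure_ball_pos(2)[OF assms(1-3)])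
qed

lemma integrable_ball_restr:
  fixes V h :: "real^'n \<Rightarrow> real"
  assumes "prob_space (exp_measure V)" "continuous_on UNIV V" "R > 0" and h: "continuous_on UNIV h"
  shows "integrable (ball_restr (exp_measure V) R) h"
proof -
  interpret prob_space "ball_restr (exp_measure V) R" by (rule prob_space_ball_restr[OF assms(1-3)])
  obtain K where K: "\<And>x. x \<in> cball 0 R \<Longrightarrow> \<bar>h x\<bar> \<le> K" using bounded_on_cball[OF h] by blast
  show ?thesis
  proof (rule integrable_const_bound)
    show "AE x in ball_restr (exp_measure V) R. norm (h x) \<le> K"
      unfolding ball_restr_def using K by (intro AE_uniform_measureI) auto
    show "h \<in> borel_measurable (ball_restr (exp_measure V) R)"
      using borel_measurable_continuous_onI[OF h] by (simp cong: measurable_cong_sets)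
  qed
qed

lemma variance_le_second_moment:
  fixes g :: "'a \<Rightarrow> real"
  assumes "prob_space M" "integrable M g" "integrable M (\<lambda>x. (g x)\<^sup>2)"
  shows "(\<integral>x. (g x - (\<integral>x. g x \<partial>M))\<^sup>2 \<partial>M) \<le> (\<integral>x. (g x - c)\<^sup>2 \<partial>M)"
proof -
  interpret prob_space M by fact
  define m where "m = (\<integral>x. g x \<partial>M)"
  have "(\<integral>x. (g x - c)\<^sup>2 \<partial>M) = (\<integral>x. (g x - m)\<^sup>2 + (2 * (m - c)) * (g x - m) + (m - c)\<^sup>2 \<partial>M)"
    by (simp add: power2_eq_square algebra_simps)
  also have "\<dots> = (\<integral>x. (g x - m)\<^sup>2 \<partial>M) + (m - c)\<^sup>2"
    using assms by (simp add: prob_space power2_diff flip: m_def)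
  finally show ?thesis by (simp add: m_def)
qed

text \<open>Suprema and infima of reals are meaningful only on bounded sets; boundedness on the open
  ball comes from compactness of the closed one.\<close>

lemma osc_bounds:
  fixes U :: "real^'n \<Rightarrow> real"
  assumes U: "continuous_on UNIV U" and R: "R > 0"
  obtains a b where "osc (ball 0 R) U = b - a" "\<And>x. x \<in> ball 0 R \<Longrightarrow> a \<le> U x" "\<And>x. x \<in> ball 0 R \<Longrightarrow> U x \<le> b"
proof -
  have "compact (U ` cball 0 R)"
    by (intro compact_continuous_image continuous_on_subset[OF U]) auto
  then have "bounded (U ` ball 0 R)"
    using compact_imp_bounded bounded_subset image_mono[OF ball_subset_cball] by metis
  then have "bdd_above (U ` ball 0 R)" "bdd_below (U ` ball 0 R)"
    by (auto intro: bounded_imp_bdd_above bounded_imp_bdd_below)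
  then show thesis
    by (intro that[of "SUP x\<in>ball 0 R. U x" "INF x\<in>ball 0 R. U x"])
      (auto simp: osc_def intro: cINF_lower cSUP_upper)
qed

text \<open>Holley--Stroock perturbation. Bounds with every \<open>C + \<epsilon>\<close> suffice, so the infimum defining a
  Poincare constant need not be attained.\<close>

lemma poincare_const_perturb:
  fixes U W :: "real^'n \<Rightarrow> real"
  assumes U: "continuous_on UNIV U" and W: "continuous_on UNIV W"
    and prob: "prob_space (exp_measure (\<lambda>x. U x + W x))" and R: "R > 0" and C: "C \<ge> 0"
    and poincare: "\<And>\<epsilon> g. \<epsilon> > 0 \<Longrightarrow> smooth g \<Longrightarrow>
      \<exists>c. (\<integral>\<^sup>+ x. indicator (ball 0 R) x * ennreal ((g x - c)\<^sup>2 * exp (- W x)) \<partial>lborel)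
        \<le> ennreal (C + \<epsilon>) * (\<integral>\<^sup>+ x. indicator (ball 0 R) x * ennreal ((norm (grad g x))\<^sup>2 * exp (- W x)) \<partial>lborel)"
  shows "poincare_const (ball_restr (exp_measure (\<lambda>x. U x + W x)) R) \<le> ennreal (C * exp (osc (ball 0 R) U))"
proof -
  let ?V = "\<lambda>x. U x + W x"
  let ?\<mu> = "ball_restr (exp_measure ?V) R"
  let ?J = "\<lambda>h V. \<integral>\<^sup>+ x. indicator (ball 0 R) x * ennreal (h x * exp (- V x)) \<partial>lborel"
  have V: "continuous_on UNIV ?V" by (intro continuous_intros U W)
  have [measurable]: "U \<in> borel_measurable borel" "W \<in> borel_measurable borel"
    using U W by (auto intro: borel_measurable_continuous_onI)
  have [measurable]: "ball (0 :: real^'n) R \<in> sets borel" by simp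
  define Z where "Z = measure (exp_measure ?V) (ball 0 R)"
  have Z: "Z > 0" unfolding Z_def by (rule measure_exp_measure_ball_pos[OF prob V R])
  interpret \<mu>: prob_space ?\<mu> by (rule prob_space_ball_restr[OF prob V R])
  obtain a b where ab: "osc (ball 0 R) U = b - a" "\<And>x. x \<in> ball 0 R \<Longrightarrow> a \<le> U x" "\<And>x. x \<in> ball 0 R \<Longrightarrow> U x \<le> b"
    using osc_bounds[OF U R] by metis
  have adm: "poincare_ineq ?\<mu> (ennreal ((C + \<epsilon>) * exp (b - a)))" if \<epsilon>: "\<epsilon> > 0" for \<epsilon>
    unfolding poincare_ineq_def
  proof (intro allI impI)
    fix g :: "real^'n \<Rightarrow> real" assume "smooth g \<and> integrable ?\<mu> (\<lambda>x. (g x)\<^sup>2)"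
    then have g: "smooth g" by simp
    have gc: "continuous_on UNIV g" and Gc: "continuous_on UNIV (grad g)"
      using g by (auto intro: smooth_continuous_on smooth_continuous_on_grad)
    have [measurable]: "g \<in> borel_measurable borel" "grad g \<in> borel_measurable borel"
      using gc Gc by (auto intro: borel_measurable_continuous_onI)
    obtain c where c: "?J (\<lambda>x. (g x - c)\<^sup>2) W
        \<le> ennreal (C + \<epsilon>) * ?J (\<lambda>x. (norm (grad g x))\<^sup>2) W"
      using poincare[OF \<epsilon> g] by blast
    have int: "integrable ?\<mu> g" "integrable ?\<mu> (\<lambda>x. (g x)\<^sup>2)" "integrable ?\<mu> (\<lambda>x. (g x - c)\<^sup>2)"
      by (intro integrable_ball_restr[OF prob V R] continuous_intros gc)+
    \<comment> \<open>The constant \<open>c\<close> suits the unperturbed measure. Passing from the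
      variance to the second moment about \<open>c\<close> is what allows the two densities to be
      compared pointwise.\<close>
    have "ennreal (\<mu>.variance g) \<le> ennreal (\<integral>x. (g x - c)\<^sup>2 \<partial>?\<mu>)"
      by (intro ennreal_leI variance_le_second_moment \<mu>.prob_space_axioms int)
    also have "\<dots> = (\<integral>\<^sup>+ x. ennreal ((g x - c)\<^sup>2) \<partial>?\<mu>)"
      by (rule nn_integral_eq_integral[symmetric]) (auto intro: int)
    also have "\<dots> = ?J (\<lambda>x. (g x - c)\<^sup>2) ?V / ennreal Z"
      unfolding Z_def by (rule nn_integral_ball_restr[OF prob V R]) (auto intro!: continuous_intros gc)
    also have "?J (\<lambda>x. (g x - c)\<^sup>2) ?V
        \<le> (\<integral>\<^sup>+ x. ennreal (exp (- a)) * (indicator (ball 0 R) x * ennreal ((g x - c)\<^sup>2 * exp (- W x))) \<partial>lborel)"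
    proof (intro nn_integral_mono)
      fix x
      show "indicator (ball 0 R) x * ennreal ((g x - c)\<^sup>2 * exp (- ?V x))
        \<le> ennreal (exp (- a)) * (indicator (ball 0 R) x * ennreal ((g x - c)\<^sup>2 * exp (- W x)))"
      proof (cases "x \<in> ball 0 R")
        case True
        have "exp (- ?V x) \<le> exp (- a) * exp (- W x)" using ab(2)[OF True] by (simp flip: exp_add)
        from mult_left_mono[OF this zero_le_power2[of "g x - c"]]
        have "(g x - c)\<^sup>2 * exp (- ?V x) \<le> exp (- a) * ((g x - c)\<^sup>2 * exp (- W x))"
          by (simp only: mult_ac)
        then show ?thesis using True by (simp add: ennreal_leI flip: ennreal_mult)
      qed simp
    qed
    also have "\<dots> = ennreal (exp (- a)) * ?J (\<lambda>x. (g x - c)\<^sup>2) W"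
      by (rule nn_integral_cmult) measurable
    also note c
    also have "?J (\<lambda>x. (norm (grad g x))\<^sup>2) W
        \<le> (\<integral>\<^sup>+ x. ennreal (exp b) * (indicator (ball 0 R) x * ennreal ((norm (grad g x))\<^sup>2 * exp (- ?V x))) \<partial>lborel)"
    proof (intro nn_integral_mono)
      fix x
      show "indicator (ball 0 R) x * ennreal ((norm (grad g x))\<^sup>2 * exp (- W x))
        \<le> ennreal (exp b) * (indicator (ball 0 R) x * ennreal ((norm (grad g x))\<^sup>2 * exp (- ?V x)))"
      proof (cases "x \<in> ball 0 R")
        case True
        have "exp (- W x) \<le> exp b * exp (- ?V x)" using ab(3)[OF True] by (simp flip: exp_add)
        from mult_left_mono[OF this zero_le_power2[of "norm (grad g x)"]]
        have "(norm (grad g x))\<^sup>2 * exp (- W x) \<le> exp b * ((norm (grad g x))\<^sup>2 * exp (- ?V x))"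
          by (simp only: mult_ac)
        then show ?thesis using True by (simp add: ennreal_leI flip: ennreal_mult)
      qed simp
    qed
    also have "\<dots> = ennreal (exp b) * ?J (\<lambda>x. (norm (grad g x))\<^sup>2) ?V"
      by (rule nn_integral_cmult) measurable
    finally have main: "ennreal (\<mu>.variance g)
      \<le> ennreal (exp (- a)) * (ennreal (C + \<epsilon>) * (ennreal (exp b) *
          ?J (\<lambda>x. (norm (grad g x))\<^sup>2) ?V)) / ennreal Z"
      by (simp add: mult_left_mono divide_right_mono_ennreal)
    have "(\<integral>\<^sup>+ x. ennreal ((norm (grad g x))\<^sup>2) \<partial>?\<mu>)
        = ?J (\<lambda>x. (norm (grad g x))\<^sup>2) ?V / ennreal Z"
      unfolding Z_def by (rule nn_integral_ball_restr[OF prob V R]) (auto intro!: continuous_intros Gc)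
    moreover have "ennreal ((C + \<epsilon>) * exp (b - a)) = ennreal (exp (- a)) * (ennreal (C + \<epsilon>) * ennreal (exp b))"
    proof -
      have "(C + \<epsilon>) * exp (b - a) = exp (- a) * ((C + \<epsilon>) * exp b)"
        by (simp add: exp_diff exp_minus divide_inverse mult_ac)
      then show ?thesis using C \<epsilon> by (simp only: ennreal_mult' exp_ge_zero add_nonneg_nonneg less_imp_le)
    qed
    ultimately show "ennreal (\<mu>.variance g) \<le> ennreal ((C + \<epsilon>) * exp (b - a)) * (\<integral>\<^sup>+ x. ennreal ((norm (grad g x))\<^sup>2) \<partial>?\<mu>)"
      using main by (simp add: mult.assoc ennreal_times_divide)
  qed
  have eps: "poincare_const ?\<mu> \<le> ennreal (C * exp (b - a)) + ennreal \<epsilon>" if \<epsilon>: "\<epsilon> > 0" for \<epsilon>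
  proof -
    \<comment> \<open>The excess is scaled down beforehand, so that after multiplication by the
      oscillation factor exactly \<epsilon> remains.\<close>
    have "poincare_const ?\<mu> \<le> ennreal ((C + \<epsilon> / exp (b - a)) * exp (b - a))"
      unfolding poincare_const_def using adm[of "\<epsilon> / exp (b - a)"] \<epsilon> by (intro Inf_lower) simp
    also have "\<dots> = ennreal (C * exp (b - a)) + ennreal \<epsilon>"
      using C \<epsilon> by (simp add: distrib_right flip: ennreal_plus)
    finally show ?thesis .
  qed
  show ?thesis unfolding ab(1) by (rule ennreal_le_epsilon) (rule eps)
qed

section \<open>Log-concavity, covariance and Poincare inequalities for the restriction of
  \<nu>\<close>

lemma log_concave_ball_restr:
  fixes W :: "real^'n \<Rightarrow> real"
  assumes prob: "prob_space (exp_measure W)" and W: "continuous_on UNIV W" and R: "R > 0"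
    and conv: "convex_on UNIV W"
  shows "log_concave_measure (ball_restr (exp_measure W) R)"
proof -
  have [measurable]: "W \<in> borel_measurable borel" by (rule borel_measurable_continuous_onI[OF W])
  have [measurable]: "ball (0 :: real^'n) R \<in> sets borel" by simp
  define Z where "Z = measure (exp_measure W) (ball 0 R)"
  have Z: "Z > 0" "emeasure (exp_measure W) (ball 0 R) = ennreal Z"
    unfolding Z_def using measure_exp_measure_ball_pos[OF prob W R] by auto
  \<comment> \<open>With the normalization inside the exponent, the log-concavity inequality in the
    ball is convexity of \<open>W\<close>. If one point lies outside, the left side is 0.\<close>
  define f where "f x = indicator (ball 0 R) x * exp (- W x - ln Z)" for x
  have [measurable]: "f \<in> borel_measurable borel" unfolding f_def by measurable
  have "f x powr (1 - t) * f y powr t \<le> f ((1 - t) *\<^sub>R x + t *\<^sub>R y)" if t: "0 < t" "t < 1" for x y t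
  proof (cases "x \<in> ball 0 R \<and> y \<in> ball 0 R")
    case True
    let ?z = "(1 - t) *\<^sub>R x + t *\<^sub>R y"
    have z: "?z \<in> ball 0 R" using True t by (intro convexD[OF convex_ball]) auto
    have "W ?z \<le> (1 - t) * W x + t * W y" using convex_onD[OF conv, of t x y] t by simp
    then have "(1 - t) * (- W x - ln Z) + t * (- W y - ln Z) \<le> - W ?z - ln Z" by (simp add: algebra_simps)
    then show ?thesis using True z by (simp add: f_def powr_def flip: exp_add)
  next
    case False
    have "f z \<ge> 0" for z by (simp add: f_def)
    moreover have "f x powr (1 - t) * f y powr t = 0" using False by (auto simp: f_def)
    ultimately show ?thesis by (simp only:)
  qed
  moreover have "ball_restr (exp_measure W) R = density lborel (\<lambda>x. ennreal (f x))"
  proof (rule measure_eqI)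
    fix A assume "A \<in> sets (ball_restr (exp_measure W) R)"
    then have [measurable]: "A \<in> sets borel" by simp
    have "emeasure (ball_restr (exp_measure W) R) A = emeasure (exp_measure W) (ball 0 R \<inter> A) / ennreal Z"
      unfolding ball_restr_def by (subst emeasure_uniform_measure) (auto simp: Z(2))
    also have "emeasure (exp_measure W) (ball 0 R \<inter> A)
        = (\<integral>\<^sup>+ x. ennreal (exp (- W x)) * indicator (ball 0 R \<inter> A) x \<partial>lborel)"
      unfolding exp_measure_def by (rule emeasure_density) measurable
    also have "(\<integral>\<^sup>+ x. ennreal (exp (- W x)) * indicator (ball 0 R \<inter> A) x \<partial>lborel) / ennreal Z
        = (\<integral>\<^sup>+ x. ennreal (exp (- W x)) * indicator (ball 0 R \<inter> A) x \<partial>lborel) * ennreal (1 / Z)"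
      using Z(1) by (simp add: divide_ennreal_def inverse_ennreal divide_inverse)
    also have "\<dots> = (\<integral>\<^sup>+ x. ennreal (exp (- W x)) * indicator (ball 0 R \<inter> A) x * ennreal (1 / Z) \<partial>lborel)"
      by (rule nn_integral_multc[symmetric]) measurable
    also have "\<dots> = (\<integral>\<^sup>+ x. ennreal (f x) * indicator A x \<partial>lborel)"
      using Z(1) by (intro nn_integral_cong) (auto simp: f_def exp_diff divide_inverse split: split_indicator simp flip: ennreal_mult)
    also have "\<dots> = emeasure (density lborel (\<lambda>x. ennreal (f x))) A"
      by (rule emeasure_density[symmetric]) auto
    finally show "emeasure (ball_restr (exp_measure W) R) A = emeasure (density lborel (\<lambda>x. ennreal (f x))) A" .
  qed simp
  ultimately show ?thesis
    unfolding log_concave_measure_def by (intro exI[of _ f]) (auto simp: f_def)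
qed

lemma ennreal_divide_le_divide_iff:
  assumes "Z > 0"
  shows "X / ennreal Z \<le> Y / ennreal Z \<longleftrightarrow> X \<le> Y"
proof -
  have "X / ennreal Z = ennreal (inverse Z) * X" for X
    using assms by (simp add: divide_ennreal_def inverse_ennreal mult.commute)
  then show ?thesis using assms by (simp add: ennreal_mult_le_mult_iff)
qed

lemma integral_ball_restr_le:
  fixes V h :: "real^'n \<Rightarrow> real"
  assumes prob: "prob_space (exp_measure V)" and V: "continuous_on UNIV V" and R: "R > 0"
    and h: "continuous_on UNIV h" "\<And>x. h x \<ge> 0" and int: "integrable (exp_measure V) h"
  shows "(\<integral>x. h x \<partial>ball_restr (exp_measure V) R) \<le> (\<integral>x. h x \<partial>exp_measure V) / measure (exp_measure V) (ball 0 R)"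
proof -
  define Z where "Z = measure (exp_measure V) (ball 0 R)"
  have Z: "Z > 0" "emeasure (exp_measure V) (ball 0 R) = ennreal Z"
    unfolding Z_def using measure_exp_measure_ball_pos[OF prob V R] by auto
  have [measurable]: "h \<in> borel_measurable borel" by (rule borel_measurable_continuous_onI[OF h(1)])
  have "ennreal (\<integral>x. h x \<partial>ball_restr (exp_measure V) R) = (\<integral>\<^sup>+ x. ennreal (h x) \<partial>ball_restr (exp_measure V) R)"
    by (rule nn_integral_eq_integral[symmetric]) (auto intro: integrable_ball_restr[OF prob V R h(1)] h(2))
  also have "\<dots> = (\<integral>\<^sup>+ x. ennreal (h x) * indicator (ball 0 R) x \<partial>exp_measure V) / ennreal Z"
    unfolding ball_restr_def Z(2)[symmetric] by (rule nn_integral_uniform_measure) measurable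
  also have "\<dots> \<le> (\<integral>\<^sup>+ x. ennreal (h x) \<partial>exp_measure V) / ennreal Z"
    by (intro divide_right_mono_ennreal nn_integral_mono) (auto split: split_indicator)
  also have "(\<integral>\<^sup>+ x. ennreal (h x) \<partial>exp_measure V) = ennreal (\<integral>x. h x \<partial>exp_measure V)"
    by (rule nn_integral_eq_integral) (auto intro: int h(2))
  also have "\<dots> / ennreal Z = ennreal ((\<integral>x. h x \<partial>exp_measure V) / Z)"
    using Z(1) h(2) by (intro divide_ennreal) auto
  finally show ?thesis using Z(1) h(2) by (simp add: Z_def)
qed

text \<open>The restriction need not be centered. In one of its extremal directions, its variance is
  at most the second moment about 0, and this integral of a nonnegative function only grows when the
  ball is replaced by the whole space.\<close>

lemma sigma2_ball_restr_le:
  fixes V :: "real^'n \<Rightarrow> real"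
  assumes prob: "prob_space (exp_measure V)" and V: "continuous_on UNIV V" and R: "R > 0"
    and int: "integrable (exp_measure V) (\<lambda>x. (norm x)\<^sup>2)" and c: "centered (exp_measure V)"
  shows "sigma2 (ball_restr (exp_measure V) R) \<le> sigma2 (exp_measure V) / measure (exp_measure V) (ball 0 R)"
proof -
  let ?\<nu> = "exp_measure V" and ?\<rho> = "ball_restr (exp_measure V) R"
  have \<rho>: "prob_space ?\<rho>" by (rule prob_space_ball_restr[OF prob V R])
  have int\<rho>: "integrable ?\<rho> h" if "continuous_on UNIV h" for h :: "real^'n \<Rightarrow> real"
    by (rule integrable_ball_restr[OF prob V R that])
  have int2: "integrable ?\<rho> (\<lambda>x. (norm x)\<^sup>2)" by (intro int\<rho> continuous_intros)
  obtain u where u: "u \<noteq> 0" "(\<integral>x. (x \<bullet> u - (\<integral>y. y \<bullet> u \<partial>?\<rho>))\<^sup>2 \<partial>?\<rho>) = sigma2 ?\<rho> * (u \<bullet> u)"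
    using sigma2_max(2)[OF \<rho> sets_ball_restr int2] by blast
  have "sigma2 ?\<rho> * (u \<bullet> u) \<le> (\<integral>x. (x \<bullet> u - 0)\<^sup>2 \<partial>?\<rho>)"
    unfolding u(2)[symmetric]
    by (intro variance_le_second_moment \<rho> int\<rho> continuous_intros)
  also have "\<dots> \<le> (\<integral>x. (x \<bullet> u - 0)\<^sup>2 \<partial>?\<nu>) / measure ?\<nu> (ball 0 R)"
    using cov_matrix_quadratic_form(2)[OF prob sets_exp_measure int, of u]
    by (intro integral_ball_restr_le[OF prob V R] continuous_intros) auto
  also have "\<dots> \<le> (sigma2 ?\<nu> * (u \<bullet> u)) / measure ?\<nu> (ball 0 R)"
    using sigma2_max(1)[OF prob sets_exp_measure int, of u]
    by (intro divide_right_mono) (simp_all add: centered_inner[OF c])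
  finally have "sigma2 ?\<rho> * (u \<bullet> u) \<le> sigma2 ?\<nu> / measure ?\<nu> (ball 0 R) * (u \<bullet> u)" by simp
  moreover have "u \<bullet> u > 0" using u(1) by simp
  ultimately show ?thesis by (rule mult_right_le_imp_le)
qed

text \<open>A strict bound on the infimum supplies an admissible constant below \<open>C\<close>.
  The result is put in unnormalized form, as \<open>poincare_const_perturb\<close> asks; the common
  factor \<open>Z\<close> cancels, and \<open>c\<close> is the mean of \<open>g\<close>.\<close>

lemma poincare_ineq_ball_restr:
  fixes V g :: "real^'n \<Rightarrow> real"
  assumes prob: "prob_space (exp_measure V)" and V: "continuous_on UNIV V" and R: "R > 0"
    and C: "poincare_const (ball_restr (exp_measure V) R) < C" and g: "smooth g"
  shows "\<exists>c. (\<integral>\<^sup>+ x. indicator (ball 0 R) x * ennreal ((g x - c)\<^sup>2 * exp (- V x)) \<partial>lborel)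
    \<le> C * (\<integral>\<^sup>+ x. indicator (ball 0 R) x * ennreal ((norm (grad g x))\<^sup>2 * exp (- V x)) \<partial>lborel)"
proof -
  let ?\<rho> = "ball_restr (exp_measure V) R"
  define Z where "Z = measure (exp_measure V) (ball 0 R)"
  have Z: "Z > 0" unfolding Z_def by (rule measure_exp_measure_ball_pos[OF prob V R])
  have gc: "continuous_on UNIV g" and Gc: "continuous_on UNIV (grad g)"
    using g by (auto intro: smooth_continuous_on smooth_continuous_on_grad)
  obtain C' where C': "poincare_ineq ?\<rho> C'" "C' < C"
    using C unfolding poincare_const_def Inf_less_iff by auto
  define c where "c = (\<integral>x. g x \<partial>?\<rho>)"
  have "(\<integral>\<^sup>+ x. ennreal ((g x - c)\<^sup>2) \<partial>?\<rho>) = ennreal (\<integral>x. (g x - c)\<^sup>2 \<partial>?\<rho>)"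
    by (intro nn_integral_eq_integral integrable_ball_restr[OF prob V R] continuous_intros gc) auto
  also have "\<dots> \<le> C' * (\<integral>\<^sup>+ x. ennreal ((norm (grad g x))\<^sup>2) \<partial>?\<rho>)"
    using C'(1) g integrable_ball_restr[OF prob V R, of "\<lambda>x. (g x)\<^sup>2"] continuous_on_power[OF gc]
    unfolding poincare_ineq_def c_def by blast
  also have "\<dots> \<le> C * (\<integral>\<^sup>+ x. ennreal ((norm (grad g x))\<^sup>2) \<partial>?\<rho>)"
    using C'(2) by (intro mult_right_mono) auto
  also have "(\<integral>\<^sup>+ x. ennreal ((norm (grad g x))\<^sup>2) \<partial>?\<rho>)
      = (\<integral>\<^sup>+ x. indicator (ball 0 R) x * ennreal ((norm (grad g x))\<^sup>2 * exp (- V x)) \<partial>lborel) / ennreal Z"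
    unfolding Z_def by (rule nn_integral_ball_restr[OF prob V R]) (auto intro!: continuous_intros Gc)
  also have "(\<integral>\<^sup>+ x. ennreal ((g x - c)\<^sup>2) \<partial>?\<rho>)
      = (\<integral>\<^sup>+ x. indicator (ball 0 R) x * ennreal ((g x - c)\<^sup>2 * exp (- V x)) \<partial>lborel) / ennreal Z"
    unfolding Z_def by (rule nn_integral_ball_restr[OF prob V R]) (auto intro!: continuous_intros gc)
  finally show ?thesis
    unfolding ennreal_times_divide ennreal_divide_le_divide_iff[OF Z] by blast
qed

text \<open>The moment hypothesis of \<open>radial_poincare\<close> is verified after multiplication
  by the total surface \<open>s\<close>: the mass becomes \<open>Z\<close>, and the second moment
  over the ball is at most the full one, hence at most \<open>d\<close> times
  \<open>sigma2\<close>.\<close>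

lemma poincare_ineq_radial:
  fixes W g :: "real^'n \<Rightarrow> real"
  assumes W: "smooth W" "convex_on UNIV W" and rad: "\<And>x. W x = w (norm x)"
    and prob: "prob_space (exp_measure W)" and c: "centered (exp_measure W)"
    and int: "integrable (exp_measure W) (\<lambda>x. (norm x)\<^sup>2)"
    and R: "R > 0" and \<epsilon>: "\<epsilon> > 0" and g: "smooth g"
  shows "\<exists>c. (\<integral>\<^sup>+ x. indicator (ball 0 R) x * ennreal ((g x - c)\<^sup>2 * exp (- W x)) \<partial>lborel)
    \<le> ennreal (2 * sigma2 (exp_measure W) / measure (exp_measure W) (ball 0 R) + \<epsilon>)
      * (\<integral>\<^sup>+ x. indicator (ball 0 R) x * ennreal ((norm (grad g x))\<^sup>2 * exp (- W x)) \<partial>lborel)"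
proof -
  let ?\<nu> = "exp_measure W"
  define Z where "Z = measure ?\<nu> (ball 0 R)"
  define \<sigma> where "\<sigma> = sigma2 ?\<nu>"
  have Wc: "continuous_on UNIV W" by (rule smooth_continuous_on[OF W(1)])
  have [measurable]: "W \<in> borel_measurable borel" by (rule borel_measurable_continuous_onI[OF Wc])
  have Z: "Z > 0" "emeasure ?\<nu> (ball 0 R) = ennreal Z"
    unfolding Z_def using measure_exp_measure_ball_pos[OF prob Wc R] by auto
  have \<sigma>: "\<sigma> \<ge> 0" unfolding \<sigma>_def by (rule sigma2_nonneg[OF prob sets_exp_measure int])
  obtain \<phi> \<phi>' \<phi>'' where \<phi>: "\<And>x. W x = \<phi> (norm x)" "\<And>r. (\<phi> has_real_derivative \<phi>' r) (at r)"
    "\<And>r. (\<phi>' has_real_derivative \<phi>'' r) (at r)" "\<phi>' 0 = 0" "\<And>r. \<phi>'' r \<ge> 0"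
    using radial_profile[OF W rad] by metis
  have \<phi>c: "continuous_on UNIV \<phi>"
    using \<phi>(2) by (meson DERIV_isCont continuous_at_imp_continuous_on)
  interpret S: finite_measure "cone_measure :: (real^'n) measure" by (rule finite_cone_measure)
  define s where "s = measure (cone_measure :: (real^'n) measure) UNIV"
  define I where "I k = integral {0..R} (\<lambda>r. r ^ k * (r ^ (DIM(real^'n) - 1) * exp (- \<phi> r)))" for k
  have I_nonneg: "I k \<ge> 0" for k
    unfolding I_def
    by (intro integral_nonneg integrable_continuous_real continuous_intros continuous_on_subset[OF \<phi>c]) auto
  have polar: "(\<integral>\<^sup>+ x. indicator (ball 0 R) x * ennreal (norm x ^ k * exp (- W x)) \<partial>(lborel :: (real^'n) measure)) = ennreal (s * I k)" for k
  proof -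
    have "(\<integral>\<^sup>+ x. indicator (ball 0 R) x * ennreal (norm x ^ k * exp (- \<phi> (norm x))) \<partial>(lborel :: (real^'n) measure))
      = (\<integral>\<^sup>+ \<theta>. ennreal (integral {0..R} (\<lambda>r. norm (r *\<^sub>R \<theta>) ^ k * (r ^ (DIM(real^'n) - 1) * exp (- \<phi> r)))) \<partial>(cone_measure :: (real^'n) measure))"
      by (intro nn_integral_ball_polar \<phi>c continuous_intros) auto
    also have "\<dots> = (\<integral>\<^sup>+ \<theta>. ennreal (I k) \<partial>(cone_measure :: (real^'n) measure))"
    proof (rule nn_integral_cong_AE)
      show "AE \<theta> in (cone_measure :: (real^'n) measure).
        ennreal (integral {0..R} (\<lambda>r. norm (r *\<^sub>R \<theta>) ^ k * (r ^ (DIM(real^'n) - 1) * exp (- \<phi> r)))) = ennreal (I k)"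
        using AE_cone_measure_norm
      proof eventually_elim
        case (elim \<theta>)
        have "integral {0..R} (\<lambda>r. norm (r *\<^sub>R \<theta>) ^ k * (r ^ (DIM(real^'n) - 1) * exp (- \<phi> r))) = I k"
          unfolding I_def by (intro integral_cong) (simp add: elim)
        then show ?case by simp
      qed
    qed
    also have "\<dots> = ennreal (s * I k)"
      using I_nonneg[of k] by (simp add: S.emeasure_eq_measure s_def mult.commute ennreal_mult)
    finally show ?thesis by (simp add: \<phi>(1))
  qed
  have sI0: "s * I 0 = Z"
  proof -
    have "ennreal Z = (\<integral>\<^sup>+ x. ennreal (exp (- W x)) * indicator (ball 0 R) x \<partial>lborel)"
      unfolding Z(2)[symmetric] exp_measure_def by (rule emeasure_density) measurable
    also have "\<dots> = ennreal (s * I 0)" using polar[of 0] by (simp add: mult.commute)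
    finally show ?thesis using Z(1) I_nonneg[of 0] by (simp add: s_def)
  qed
  have sI2: "s * I 2 \<le> CARD('n) * \<sigma>"
  proof -
    have "ennreal (s * I 2) \<le> (\<integral>\<^sup>+ x. ennreal (exp (- W x)) * ennreal ((norm x)\<^sup>2) \<partial>lborel)"
      unfolding polar[symmetric] by (intro nn_integral_mono) (auto simp: ennreal_mult mult.commute split: split_indicator)
    also have "\<dots> = (\<integral>\<^sup>+ x. ennreal ((norm x)\<^sup>2) \<partial>?\<nu>)"
      unfolding exp_measure_def by (rule nn_integral_density[symmetric]) measurable
    also have "\<dots> = ennreal (\<integral>x. (norm x)\<^sup>2 \<partial>?\<nu>)"
      by (rule nn_integral_eq_integral[OF int]) simp
    also have "\<dots> \<le> ennreal (CARD('n) * \<sigma>)"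
      unfolding \<sigma>_def by (intro ennreal_leI second_moment_le_sigma2 prob sets_exp_measure int c)
    finally show ?thesis using \<sigma> by (simp add: ennreal_le_iff)
  qed
  have s: "s > 0" using sI0 Z(1) by (cases "s = 0") (auto simp: s_def less_le)
  \<comment> \<open>The excess \<epsilon> makes the moment comparison strict.\<close>
  define C where "C = 2 * \<sigma> / Z + \<epsilon>"
  have C: "C > 0" using \<sigma> Z \<epsilon> by (simp add: C_def add_nonneg_pos)
  have "s * I 2 < C * DIM(real^'n) / 2 * (s * I 0)"
  proof -
    have "CARD('n) * \<sigma> < CARD('n) * \<sigma> + \<epsilon> * CARD('n) / 2 * Z" using \<epsilon> Z by simp
    also have "\<dots> = C * DIM(real^'n) / 2 * (s * I 0)"
      unfolding sI0 C_def using Z(1) by (simp add: field_simps)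
    finally have "CARD('n) * \<sigma> < C * DIM(real^'n) / 2 * (s * I 0)" .
    with sI2 show ?thesis by (rule le_less_trans)
  qed
  then have "s * I 2 < s * (C * DIM(real^'n) / 2 * I 0)" by (simp only: mult_ac)
  then have "I 2 < C * DIM(real^'n) / 2 * I 0" using s by (simp only: mult_less_cancel_left_pos)
  then have moment: "integral {0..R} (\<lambda>r. r\<^sup>2 * (r ^ (DIM(real^'n) - 1) * exp (- \<phi> r)))
      < C * DIM(real^'n) / 2 * integral {0..R} (\<lambda>r. r ^ (DIM(real^'n) - 1) * exp (- \<phi> r))"
    unfolding I_def power_0 mult_1 .
  show ?thesis
    using radial_poincare[OF R C \<phi>(2,3) _ \<phi>(5) moment smooth_GDERIV[OF g] smooth_continuous_on_grad[OF g]]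
    by (simp add: \<phi>(1)[symmetric] \<phi>(4) C_def \<sigma>_def Z_def)
qed

theorem theorem5p4:
  fixes U W :: "real^'n \<Rightarrow> real"
    and \<alpha>\<^sub>W \<beta>\<^sub>W \<kappa>\<^sub>U \<beta>\<^sub>U R R' \<gamma> :: real
  assumes "smooth U" and "smooth W"
    and "prob_space (exp_measure (\<lambda>x. U x + W x))"
    and "\<alpha>\<^sub>W > 0" and "\<beta>\<^sub>W \<ge> 1" and "R \<ge> 0"
    and "\<And>x. norm x \<ge> R \<Longrightarrow> x \<bullet> grad W x \<ge> \<alpha>\<^sub>W * norm x powr \<beta>\<^sub>W"
    and "\<kappa>\<^sub>U \<ge> 0" and "\<beta>\<^sub>U \<le> \<beta>\<^sub>W"
    and "\<And>x. norm x \<ge> R \<Longrightarrow> \<bar>x \<bullet> grad U x\<bar> \<le> \<kappa>\<^sub>U * norm x powr \<beta>\<^sub>U"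
    and "R' \<ge> R" and "R' > 0" and "\<gamma> > 0"
    and "\<alpha>\<^sub>W * R' powr (\<beta>\<^sub>W - 1) - (real CARD('n) - 1) / R' - \<gamma> - \<kappa>\<^sub>U * R' powr (\<beta>\<^sub>U - 1) > 0"
    and "convex_on UNIV W"
    and "prob_space (exp_measure W)" and "centered (exp_measure W)"
  shows "(\<forall>C. klartag_bound TYPE('n) C \<longrightarrow>
            poincare_const (ball_restr (exp_measure (\<lambda>x. U x + W x)) R')
              \<le> ennreal (C * sigma2 (exp_measure W) * (1 + ln (real CARD('n)))
                    / measure (exp_measure W) (ball 0 R') * exp (osc (ball 0 R') U)))
       \<and> ((\<exists>w. \<forall>x. W x = w (norm x)) \<longrightarrow>
            poincare_const (ball_restr (exp_measure (\<lambda>x. U x + W x)) R')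
              \<le> ennreal (2 * sigma2 (exp_measure W)
                    / measure (exp_measure W) (ball 0 R') * exp (osc (ball 0 R') U)))"
proof -
  let ?\<nu> = "exp_measure W" and ?\<rho> = "ball_restr (exp_measure W) R'"
  note U = smooth_continuous_on[OF assms(1)] and W = smooth_continuous_on[OF assms(2)]
  note prob = assms(16) and R' = assms(12)
  have Z: "measure ?\<nu> (ball 0 R') > 0" by (rule measure_exp_measure_ball_pos[OF prob W R'])
  have "x \<bullet> grad W x \<ge> \<alpha>\<^sub>W * norm x" if "norm x \<ge> max R 1" for x
  proof -
    \<comment> \<open>For norm at least 1, an exponent of at least 1 turns the power growth into
      linear growth.\<close>
    have "norm x powr 1 \<le> norm x powr \<beta>\<^sub>W" using that assms(5) by (intro powr_mono) auto
    then have "\<alpha>\<^sub>W * norm x \<le> \<alpha>\<^sub>W * norm x powr \<beta>\<^sub>W" using that assms(4) by (intro mult_left_mono) auto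
    then show ?thesis using assms(7)[of x] that by simp
  qed
  then obtain m where "\<And>x. W x \<ge> \<alpha>\<^sub>W * norm x + m"
    using linear_growth[OF smooth_GDERIV[OF assms(2)] assms(4), of "max R 1"] by (metis less_max_iff_disj zero_less_one)
  then have int: "integrable ?\<nu> (\<lambda>x. (norm x)\<^sup>2)" by (rule integrable_second_moment[OF W assms(4)])
  note \<sigma> = sigma2_nonneg[OF prob sets_exp_measure int]
  have \<sigma>\<rho>: "sigma2 ?\<rho> \<ge> 0"
    by (intro sigma2_nonneg prob_space_ball_restr[OF prob W R'] sets_ball_restr integrable_ball_restr[OF prob W R'] continuous_intros)
  have d: "1 + ln (real CARD('n)) \<ge> 0" using zero_less_card_finite[where 'a = 'n] by (simp add: Suc_le_eq)
  show ?thesis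
  proof (intro conjI allI impI)
    fix C assume C: "klartag_bound TYPE('n) C"
    define K where "K = C * sigma2 ?\<rho> * (1 + ln (real CARD('n)))"
    have "poincare_const ?\<rho> \<le> ennreal K"
      using C prob_space_ball_restr[OF prob W R'] log_concave_ball_restr[OF prob W R' assms(15)]
      unfolding klartag_bound_def K_def by blast
    \<comment> \<open>\<open>C\<close> may be negative, and \<open>ennreal\<close> sends negative
      reals to 0. The positive part gives the perturbation lemma its nonnegative constant; if
      \<open>C < 0\<close>, it is 0.\<close>
    also have "ennreal K = ennreal (max 0 K)" by (cases "0 \<le> K") (auto simp: max_def ennreal_neg)
    finally have K: "poincare_const ?\<rho> < ennreal (max 0 K + \<epsilon>)" if "\<epsilon> > 0" for \<epsilon>
      using that by (elim order.strict_trans1) (simp add: ennreal_less_iff)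
    have "poincare_const (ball_restr (exp_measure (\<lambda>x. U x + W x)) R') \<le> ennreal (max 0 K * exp (osc (ball 0 R') U))"
      using poincare_ineq_ball_restr[OF prob W R' K]
      by (intro poincare_const_perturb[OF U W assms(3) R']) auto
    also have "\<dots> \<le> ennreal (C * sigma2 ?\<nu> * (1 + ln (real CARD('n))) / measure ?\<nu> (ball 0 R') * exp (osc (ball 0 R') U))"
    proof (cases "C \<ge> 0")
      case True
      have "K \<le> C * (sigma2 ?\<nu> / measure ?\<nu> (ball 0 R')) * (1 + ln (real CARD('n)))"
        unfolding K_def using True d sigma2_ball_restr_le[OF prob W R' int assms(17)]
        by (intro mult_right_mono mult_left_mono)
      moreover have "0 \<le> K" unfolding K_def using True \<sigma>\<rho> d by simp
      ultimately show ?thesis by (intro ennreal_leI mult_right_mono) auto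
    next
      case False
      then have "K \<le> 0" unfolding K_def using \<sigma>\<rho> d by (simp add: mult_nonpos_nonneg)
      then show ?thesis by (simp add: max_absorb1)
    qed
    finally show "poincare_const (ball_restr (exp_measure (\<lambda>x. U x + W x)) R')
      \<le> ennreal (C * sigma2 ?\<nu> * (1 + ln (real CARD('n))) / measure ?\<nu> (ball 0 R') * exp (osc (ball 0 R') U))" .
  next
    assume "\<exists>w. \<forall>x. W x = w (norm x)"
    then obtain w where w: "\<And>x. W x = w (norm x)" by blast
    show "poincare_const (ball_restr (exp_measure (\<lambda>x. U x + W x)) R')
      \<le> ennreal (2 * sigma2 ?\<nu> / measure ?\<nu> (ball 0 R') * exp (osc (ball 0 R') U))"
      using \<sigma> Z
      by (intro poincare_const_perturb[OF U W assms(3) R']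
          poincare_ineq_radial[OF assms(2,15) w prob assms(17) int R']) auto
  qed
qed

end
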